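(* Let $(A,B,C,\psi,\zeta)$ be an entwining structure over a commutative $k$-algebra $B$. (a) There is a one-to-one correspondence between equivalence classes of infinitesimal deformations of $(A,B,C,\psi,\zeta)$ over $B$ and the cohomology group $H^2(A,B,C,\psi,\zeta)$. (b) Let $(\mu_t,\Delta_t,\psi_t)$ be a deformation of $(A,B,C,\psi,\zeta)$ over $B$ modulo $t^{n+1}$. Then $(\mu_t,\Delta_t,\psi_t)$ can be lifted to a deformation modulo $t^{n+2}$ if and only if the obstruction $$Obs^{n+1}=(Obs^{n+1}_{A,B},Obs^{n+1}_{\mu_t,\psi_t},Obs^{n+1}_{\Delta_t,\psi_t},Obs^{n+1}_C)\in Tot^3(A,B,C,\psi,\zeta)$$ is a coboundary, i.e. $Obs^{n+1}=0\in H^3(A,B,C,\psi,\zeta)$.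
   Context: Conventions: $k$ is a field; $\otimes$ and $\mathrm{Hom}$ are over $k$; powers of $A,B,C$ are tensor powers, and in composites of maps the symbols $A,C$ denote identity maps; $A$ is a unital associative $k$-algebra; $C\neq 0$ is a $k$-coalgebra with coproduct $\Delta(c)=c_1\otimes c_2$ (summation suppressed) and counit $\varepsilon$. For linear $\psi:C\otimes A\to A\otimes C$ write $\psi(c\otimes a)=a_\psi\otimes c^\psi$. Entwining structure over $k$: a triple $(A,C,\psi)$ with $\psi:C\otimes A\to A\otimes C$ linear such that $(ab)_\psi\otimes c^\psi=a_\psi b_\psi\otimes {c^\psi}^\psi$ [i.e. $\psi(1\otimes\mu)=(\mu\otimes 1)(1\otimes\psi)(\psi\otimes 1)$]; $a_\psi\otimes\Delta(c^\psi)={a_\psi}_\psi\otimes c_1^\psi\otimes c_2^\psi$ [i.e. $(1\otimes\Delta)\psi=(\psi\otimes1)(1\otimes\psi)(\Delta\otimes 1)$]; $a_\psi\varepsilon(c^\psi)=\varepsilon(c)a$; $1_\psi\otimes c^\psi=1\otimes c$. Entwining structure over a commutative $k$-algebra $B$: a tuple $(A,B,C,\psi,\zeta)$ with $(A,C,\psi)$ an entwining structure over $k$ and $\zeta:B\to A$ a $k$-algebra morphism with $\zeta(B)\subseteq Z(A)$ and $\psi(c\otimes\zeta(b))=\zeta(b)\otimes c$. Deformations. A formal deformation $(\mu_t,\Delta_t,\psi_t)$ of $(A,B,C,\psi,\zeta)$ over $B$ consists of $k$-linear maps $\mu^{(i)}:A\otimes A\otimes B\to A$, $\Delta^{(i)}:C\to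 C\otimes C$, $\psi^{(i)}:C\otimes A\to A\otimes C$ ($i\ge1$) such that, with $\mu^{(0)}(x\otimes y\otimes b)=\zeta(b)xy$, $\Delta^{(0)}=\Delta$, $\psi^{(0)}=\psi$, $\mu^{(i)}_b(x\otimes y)=\mu^{(i)}(x\otimes y\otimes b)$, $\mu_b=\mu_b^{(0)}$, and $k[[t]]$-linear maps determined by $\mu_{b,t}=\sum_{i\ge0}\mu_b^{(i)}t^i$ ($b\in B$), $\Delta_t=\sum_{i\ge0}\Delta^{(i)}t^i$, $\psi_t=\sum_{i\ge0}\psi^{(i)}t^i$, one has: (1) $\mu_{b_1b_2,t}(id\otimes\mu_{b_3,t})=\mu_{b_2b_3,t}(\mu_{b_1,t}\otimes id)$ for all $b_1,b_2,b_3\in B$; (2) $\Delta_t$ is coassociative on $C[[t]]$; (3) $\psi_t(id\otimes\mu_{b,t})=(\mu_{b,t}\otimes id)(id\otimes\psi_t)(\psi_t\otimes id)$ for all $b\in B$, and $(id\otimes\Delta_t)\psi_t=(\psi_t\otimes id)(id\otimes\psi_t)(\Delta_t\otimes id)$. A deformation modulo $t^{n+1}$ (an $n$-truncated deformation) is given by maps $\mu^{(i)},\Delta^{(i)},\psi^{(i)}$, $1\le i\le n$, satisfying these identities modulo $t^{n+1}$; lifting it to a deformation modulo $t^{n+2}$ means adding maps $\mu^{(n+1)},\Delta^{(n+1)},\psi^{(n+1)}$ so that the identities hold modulo $t^{n+2}$. An infinitesimal deformation is a deformation modulo $t^2$. Equivalence. Two deformations $(\mu_t,\Delta_t,\psi_t)$,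 $(\mu'_t,\Delta'_t,\psi'_t)$ are equivalent if there are $k[[t]]$-linear isomorphisms $\alpha:A[[t]]\to A[[t]]$, $\gamma:C[[t]]\to C[[t]]$ of the form $\alpha(x)=x+\sum_{i\ge1}\alpha^{(i)}(x)t^i$, $\gamma(c)=c+\sum_{i\ge1}\gamma^{(i)}(c)t^i$ ($\alpha^{(i)},\gamma^{(i)}$ $k$-linear) with $\alpha\circ\mu_{b,t}=\mu'_{b,t}\circ(\alpha\otimes\alpha)$ for all $b\in B$, $(\gamma\otimes\gamma)\circ\Delta_t=\Delta'_t\circ\gamma$ and $\psi'_t\circ(\gamma\otimes\alpha)=(\alpha\otimes\gamma)\circ\psi_t$; for infinitesimal deformations these identities are taken modulo $t^2$. Tensor matrices. An element of $V_m:=C\otimes A^m\otimes B^{m(m-1)/2}$ is written $c\otimes T$, $T$ an $m\times m$ upper triangular array with diagonal entries $a_i\in A$ and entries $b_{ij}\in B$ for $i<j$. Passing $c$ successively past $a_1,\dots,a_m$ by $\psi$ gives $T_\psi\otimes c^{\psi^m}$, where $T_\psi$ has diagonal $a_{1\psi},\dots,a_{m\psi}$ and the same $b_{ij}$. $V_m$ is a $C$-bicomodule via $\rho_L(c\otimes T)=c_1\otimes(c_2\otimes T)$, $\rho_R(c\otimes T)=(c_1\otimes T_\psi)\otimes c_2^{\psi^m}$. $A\otimes C^n$ is an $A$-bimodule via $a'\cdot(a\otimes c^1\otimes\cdots\otimes c^n)\cdot a''=a'aa''_{\psi^n}\otimes c^{1\psi}\otimes\cdots\otimes c^{n\psi}$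 ($a''$ is moved to the left past $c^n$, then $c^{n-1}$, ..., then $c^1$ by $\psi$). Differentials. $\delta^m:\mathrm{Hom}(V_m,A\otimes C^n)\to\mathrm{Hom}(V_{m+1},A\otimes C^n)$ is $$\delta^m(f)(c\otimes T)=\zeta\Big(\prod_{j=2}^{m+1}b_{1j}\Big)a_{1\psi}\cdot f(c^\psi\otimes T^{(0)})+\sum_{i=1}^m(-1)^if(c\otimes T^{(i)})+(-1)^{m+1}\zeta\Big(\prod_{r=1}^{m}b_{r,m+1}\Big)f(c\otimes T^{(m+1)})\cdot a_{m+1},$$ where $T^{(0)}$ (resp. $T^{(m+1)}$) is $T$ with first (resp. last) row and column deleted and $T^{(i)}$, $1\le i\le m$, is $T$ with indices $i,i+1$ merged (merged diagonal entry $\zeta(b_{i,i+1})a_ia_{i+1}$, entries $b_{ri}b_{r,i+1}$ for $r<i$ and $b_{is}b_{i+1,s}$ for $s>i+1$, other entries unchanged). The map $\delta:\mathrm{Hom}(A^m\otimes B^{m(m-1)/2},A)\to\mathrm{Hom}(A^{m+1}\otimes B^{m(m+1)/2},A)$ is given by the same formula with $c$ and $\psi$ omitted. The map $\bar\delta^n:\mathrm{Hom}(V_m,A\otimes C^n)\to\mathrm{Hom}(V_m,A\otimes C^{n+1})$ is $\bar\delta^nf=(\psi\otimes C^n)(C\otimes f)\rho_L+\sum_{i=1}^n(-1)^i(A\otimes C^{i-1}\otimes\Delta\otimes C^{n-i})f+(-1)^{n+1}(f\otimes C)\rho_R$; and $\bar\delta:\mathrm{Hom}(C,C^n)\to\mathrm{Hom}(C,C^{n+1})$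 is $\bar\delta g=(C\otimes g)\Delta+\sum_{i=1}^n(-1)^i(C^{i-1}\otimes\Delta\otimes C^{n-i})g+(-1)^{n+1}(g\otimes C)\Delta$. Put $j(f)=\varepsilon\otimes f$ for $f\in\mathrm{Hom}(A^m\otimes B^{m(m-1)/2},A)$ and $\bar j(g)=1\otimes g$ for $g\in\mathrm{Hom}(C,C^n)$. Bicomplex. For $m,n\ge1$: $C^{m,n}=\mathrm{Hom}(V_m,A\otimes C^n)$, $C^{m,0}=\mathrm{Hom}(A^m\otimes B^{m(m-1)/2},A)$, $C^{0,n}=\mathrm{Hom}(C,C^n)$ (there is no $C^{0,0}$ term), with horizontal differentials $d_h^{m,n}=(-1)^m\delta^m$, $d_h^{0,n}=\delta^0\circ\bar j$, $d_h^{m,0}=(-1)^m\delta$ and vertical differentials $d_v^{m,n}=(-1)^m\bar\delta^n$, $d_v^{0,n}=\bar\delta$, $d_v^{m,0}=(-1)^m\bar\delta^0\circ j$. $Tot^p(A,B,C,\psi,\zeta)=\bigoplus_{m+n=p}C^{m,n}$ for $p\ge1$, with $D=d_h+d_v$; its cohomology is $H^\bullet(A,B,C,\psi,\zeta)$. Obstruction. The components of $Obs^{n+1}$ lie in $\mathrm{Hom}(A^3\otimes B^3,A)$, $\mathrm{Hom}(C\otimes A^2\otimes B,A\otimes C)$, $\mathrm{Hom}(C\otimes A,A\otimes C^2)$, $\mathrm{Hom}(C,C^3)$ respectively; with all indices $\geq 0$, $$Obs^{n+1}_{A,B}\begin{pmatrix}a_1&b_{12}&b_{13}\\1&a_2&b_{23}\\1&1&a_3\end{pmatrix}=\sum_{i,j<n+1,\,i+j=n+1}\big(\mu^{(j)}_{b_{13}b_{23}}(\mu^{(i)}_{b_{12}}\otimes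 A)-\mu^{(i)}_{b_{12}b_{13}}(A\otimes\mu^{(j)}_{b_{23}})\big)(a_1\otimes a_2\otimes a_3),$$ $$Obs^{n+1}_{\mu_t,\psi_t}\Big(c\otimes\begin{pmatrix}a_1&b_{12}\\1&a_2\end{pmatrix}\Big)=\Big(\sum_{i,j,l<n+1,\,i+j+l=n+1}(\mu^{(i)}_{b_{12}}\otimes C)(A\otimes\psi^{(j)})(\psi^{(l)}\otimes A)-\sum_{i,j<n+1,\,i+j=n+1}\psi^{(i)}(C\otimes\mu^{(j)}_{b_{12}})\Big)(c\otimes a_1\otimes a_2),$$ $$Obs^{n+1}_{\Delta_t,\psi_t}=\sum_{i,j,l<n+1,\,i+j+l=n+1}(\psi^{(i)}\otimes C)(C\otimes\psi^{(j)})(\Delta^{(l)}\otimes A)-\sum_{i,j<n+1,\,i+j=n+1}(A\otimes\Delta^{(i)})\psi^{(j)},$$ $$Obs^{n+1}_C=\sum_{i,j<n+1,\,i+j=n+1}\big((\Delta^{(j)}\otimes C)\Delta^{(i)}-(C\otimes\Delta^{(j)})\Delta^{(i)}\big).$$ *)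

theory Defs
  imports "HOL.Vector_Spaces" "HOL-Library.Function_Algebras" "HOL-Library.Product_Plus"
begin

section \<open>Tensor powers\<close>

text \<open>
  Tensor products of vector spaces are realised canonically inside the space of functionals on
  multilinear forms: a pure tensor is evaluation of forms at its factors, and the tensor product is
  the span of the pure tensors. An element of \<open>C\<^sup>n\<close> has type \<open>('c list, 'k) tens\<close>
  (generators: lists of length \<open>n\<close>), an element of \<open>A \<otimes> C\<^sup>n\<close> has type
  \<open>('a \<times> 'c list, 'k) tens\<close>. The universal properties are proved below.
\<close>

type_synonym ('g, 'k) tens = "('g \<Rightarrow> 'k) \<Rightarrow> 'k"

definition tscale :: "'k::field \<Rightarrow> ('g, 'k) tens \<Rightarrow> ('g, 'k) tens" where
  "tscale r x = (\<lambda>\<phi>. r * x \<phi>)"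

definition mlinC ::
  "('k::field \<Rightarrow> 'c::ab_group_add \<Rightarrow> 'c) \<Rightarrow> nat \<Rightarrow> ('k \<Rightarrow> 'v::ab_group_add \<Rightarrow> 'v) \<Rightarrow> ('c list \<Rightarrow> 'v) \<Rightarrow> bool"
where
  "mlinC sC n sV \<phi> \<longleftrightarrow>
     (\<forall>xs ys. length xs + length ys + 1 = n \<longrightarrow> Vector_Spaces.linear sC sV (\<lambda>x. \<phi> (xs @ x # ys)))"

definition mlinAC ::
  "('k::field \<Rightarrow> 'a::ab_group_add \<Rightarrow> 'a) \<Rightarrow> ('k \<Rightarrow> 'c::ab_group_add \<Rightarrow> 'c) \<Rightarrow> nat \<Rightarrow>
   ('k \<Rightarrow> 'v::ab_group_add \<Rightarrow> 'v) \<Rightarrow> ('a \<times> 'c list \<Rightarrow> 'v) \<Rightarrow> bool"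
where
  "mlinAC sA sC n sV \<phi> \<longleftrightarrow>
     (\<forall>cs. length cs = n \<longrightarrow> Vector_Spaces.linear sA sV (\<lambda>a. \<phi> (a, cs))) \<and>
     (\<forall>a. mlinC sC n sV (\<lambda>cs. \<phi> (a, cs)))"

definition evalt :: "('g \<Rightarrow> 'k::field) set \<Rightarrow> 'g \<Rightarrow> ('g, 'k) tens" where
  "evalt M g = (\<lambda>\<phi>. if \<phi> \<in> M then \<phi> g else 0)"

definition pureC :: "('k::field \<Rightarrow> 'c::ab_group_add \<Rightarrow> 'c) \<Rightarrow> 'c list \<Rightarrow> ('c list, 'k) tens" where
  "pureC sC cs = evalt {\<phi>. mlinC sC (length cs) (*) \<phi>} cs"

definition pureAC ::
  "('k::field \<Rightarrow> 'a::ab_group_add \<Rightarrow> 'a) \<Rightarrow> ('k \<Rightarrow> 'c::ab_group_add \<Rightarrow> 'c) \<Rightarrow>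
   'a \<times> 'c list \<Rightarrow> ('a \<times> 'c list, 'k) tens"
where
  "pureAC sA sC g = evalt {\<phi>. mlinAC sA sC (length (snd g)) (*) \<phi>} g"

definition tensC :: "('k::field \<Rightarrow> 'c::ab_group_add \<Rightarrow> 'c) \<Rightarrow> nat \<Rightarrow> ('c list, 'k) tens set" where
  "tensC sC n = module.span tscale {pureC sC cs |cs. length cs = n}"

definition tensAC ::
  "('k::field \<Rightarrow> 'a::ab_group_add \<Rightarrow> 'a) \<Rightarrow> ('k \<Rightarrow> 'c::ab_group_add \<Rightarrow> 'c) \<Rightarrow> nat \<Rightarrow>
   ('a \<times> 'c list, 'k) tens set"
where
  "tensAC sA sC n = module.span tscale {pureAC sA sC (a, cs) |a cs. length cs = n}"

text \<open>
  \<open>sweedler x G\<close> is the linear extension of a multilinear map \<open>G\<close> evaluated at the tensor \<open>x\<close>: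
  if \<open>x\<close> is the sum of the pure tensors on \<open>g\<^sub>1, g\<^sub>2, \<dots>\<close>, it is the sum of \<open>G g\<^sub>1, G g\<^sub>2, \<dots>\<close>.
  Thus \<open>sweedler (\<Delta> c) (\<lambda>cs. G (cs ! 0) (cs ! 1))\<close> is \<open>G(c\<^sub>1, c\<^sub>2)\<close>, and
  \<open>sweedler (\<psi> c a) (\<lambda>(x, cs). G x (cs ! 0))\<close> is \<open>G(a\<^sub>\<psi>, c\<^sup>\<psi>)\<close>.
\<close>

definition sweedler :: "('g, 'k) tens \<Rightarrow> ('g \<Rightarrow> ('h, 'k) tens) \<Rightarrow> ('h, 'k::field) tens" where
  "sweedler x G = (\<lambda>\<phi>. x (\<lambda>g. G g \<phi>))"

lemma vector_space_tscale: "vector_space (tscale :: 'k::field \<Rightarrow> ('g, 'k) tens \<Rightarrow> _)"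
  by unfold_locales (auto simp: tscale_def algebra_simps)

lemma vector_space_mult: "vector_space ((*) :: 'k::field \<Rightarrow> 'k \<Rightarrow> 'k)"
  by unfold_locales (auto simp: algebra_simps)

lemma exists_functional:
  fixes s :: "'k::field \<Rightarrow> 'v::ab_group_add \<Rightarrow> 'v"
  assumes "vector_space s" and "d \<noteq> 0"
  shows "\<exists>l. Vector_Spaces.linear s (*) l \<and> l d = (1::'k)"
proof -
  interpret vector_space s by fact
  interpret p: vector_space_pair s "(*) :: 'k \<Rightarrow> 'k \<Rightarrow> 'k"
    using assms(1) vector_space_mult by (simp add: vector_space_pair_def)
  have "independent {d}" using \<open>d \<noteq> 0\<close> by simp
  from p.linear_independent_extend[OF this, of "\<lambda>_. 1"] show ?thesis by auto
qed

lemma linear_comp: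
  assumes "Vector_Spaces.linear s1 s2 f" "Vector_Spaces.linear s2 s3 l"
  shows "Vector_Spaces.linear s1 s3 (\<lambda>x. l (f x))"
  using Vector_Spaces.linear_compose[OF assms] by (simp add: o_def)

lemma tens_universal:
  fixes s :: "'k::field \<Rightarrow> 'v::ab_group_add \<Rightarrow> 'v" and G :: "'g \<Rightarrow> 'v"
  assumes vs: "vector_space s"
    and G: "\<And>l. Vector_Spaces.linear s (*) l \<Longrightarrow> (\<lambda>g. l (G g)) \<in> M"
  shows "\<exists>h. Vector_Spaces.linear tscale s h \<and> (\<forall>g\<in>S. h (evalt M g) = G g)"
proof -
  interpret T: vector_space "tscale :: 'k \<Rightarrow> ('g, 'k) tens \<Rightarrow> _" by (rule vector_space_tscale)
  interpret p: vector_space_pair "tscale :: 'k \<Rightarrow> ('g, 'k) tens \<Rightarrow> _" s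
    using vs vector_space_tscale by (simp add: vector_space_pair_def)
  obtain B where B: "B \<subseteq> evalt M ` S" "T.independent B" "evalt M ` S \<subseteq> T.span B"
    using T.maximal_independent_subset by blast
  define pick where "pick = inv_into S (evalt M)"
  have pick: "pick b \<in> S \<and> evalt M (pick b) = b" if "b \<in> B" for b
    using that B(1) unfolding pick_def by (meson f_inv_into_f inv_into_into subsetD)
  obtain h where h: "Vector_Spaces.linear tscale s h" "\<forall>b\<in>B. h b = G (pick b)"
    using p.linear_independent_extend[OF B(2), of "\<lambda>b. G (pick b)"] by blast
  interpret h: Vector_Spaces.linear tscale s h by fact
  have "h (evalt M g) = G g" if "g \<in> S" for g
  proof (rule ccontr)
    assume "h (evalt M g) \<noteq> G g"
    then have "h (evalt M g) - G g \<noteq> 0" by simp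
    from exists_functional[OF vs this] obtain l
      where l: "Vector_Spaces.linear s (*) l" "l (h (evalt M g) - G g) = 1" by blast
    interpret l: Vector_Spaces.linear s "(*)" l by fact
    have M: "(\<lambda>g. l (G g)) \<in> M" using G l(1) .
    have "evalt M g \<in> T.span B" using that B(3) by blast
    then obtain t r where t: "finite t" "t \<subseteq> B" "evalt M g = (\<Sum>b\<in>t. tscale (r b) b)"
      by (auto simp: T.span_explicit)
    have "l (h (evalt M g)) = (\<Sum>b\<in>t. r b * l (h b))"
      by (simp add: t(3) h.sum h.scale l.sum l.scale)
    also have "\<dots> = (\<Sum>b\<in>t. r b * b (\<lambda>g. l (G g)))"
    proof (rule sum.cong[OF refl])
      fix b assume "b \<in> t"
      then have b: "b \<in> B" using t(2) by blast
      have "b (\<lambda>g. l (G g)) = evalt M (pick b) (\<lambda>g. l (G g))" using pick[OF b] by simp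
      also have "\<dots> = l (h b)" using M h(2) b by (simp add: evalt_def)
      finally show "r b * l (h b) = r b * b (\<lambda>g. l (G g))" by simp
    qed
    also have "\<dots> = (\<Sum>b\<in>t. tscale (r b) b) (\<lambda>g. l (G g))"
      using t(1) by (induction rule: finite_induct) (auto simp: tscale_def)
    also have "\<dots> = l (G g)" unfolding t(3)[symmetric] using M by (simp add: evalt_def)
    finally show False using l(2) by (simp add: l.diff)
  qed
  then show ?thesis using h(1) by blast
qed

lemma mlinC_comp:
  "mlinC sC n sV G \<Longrightarrow> Vector_Spaces.linear sV sW l \<Longrightarrow> mlinC sC n sW (\<lambda>g. l (G g))"
  unfolding mlinC_def using linear_comp by blast

lemma mlinAC_comp:
  assumes "mlinAC sA sC n sV G" "Vector_Spaces.linear sV sW l"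
  shows "mlinAC sA sC n sW (\<lambda>g. l (G g))"
  unfolding mlinAC_def
proof (intro conjI allI impI)
  show "Vector_Spaces.linear sA sW (\<lambda>a. l (G (a, cs)))" if "length cs = n" for cs
    using linear_comp[of sA sV "\<lambda>a. G (a, cs)" sW l] that assms by (simp add: mlinAC_def)
  show "mlinC sC n sW (\<lambda>cs. l (G (a, cs)))" for a
    using mlinC_comp[of sC n sV "\<lambda>cs. G (a, cs)" sW l] assms by (simp add: mlinAC_def)
qed

lemma tensC_universal:
  assumes "vector_space sV" "mlinC sC n sV G"
  shows "\<exists>h. Vector_Spaces.linear tscale sV h \<and> (\<forall>cs. length cs = n \<longrightarrow> h (pureC sC cs) = G cs)"
proof -
  have "(\<lambda>g. l (G g)) \<in> {\<phi>. mlinC sC n (*) \<phi>}" if "Vector_Spaces.linear sV (*) l" for l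
    using mlinC_comp[OF assms(2) that] by simp
  from tens_universal[where G = G and S = "{cs. length cs = n}", OF assms(1) this]
  obtain h where "Vector_Spaces.linear tscale sV h"
    "\<forall>g\<in>{cs. length cs = n}. h (evalt {\<phi>. mlinC sC n (*) \<phi>} g) = G g" by blast
  then show ?thesis by (intro exI[of _ h]) (simp add: pureC_def)
qed

lemma tensAC_universal:
  assumes "vector_space sV" "mlinAC sA sC n sV G"
  shows "\<exists>h. Vector_Spaces.linear tscale sV h \<and>
           (\<forall>a cs. length cs = n \<longrightarrow> h (pureAC sA sC (a, cs)) = G (a, cs))"
proof -
  have "(\<lambda>g. l (G g)) \<in> {\<phi>. mlinAC sA sC n (*) \<phi>}" if "Vector_Spaces.linear sV (*) l" for l
    using mlinAC_comp[OF assms(2) that] by simp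
  from tens_universal[where G = G and S = "{g. length (snd g) = n}", OF assms(1) this]
  obtain h where "Vector_Spaces.linear tscale sV h"
    "\<forall>g\<in>{g. length (snd g) = n}. h (evalt {\<phi>. mlinAC sA sC n (*) \<phi>} g) = G g" by blast
  then show ?thesis by (intro exI[of _ h]) (simp add: pureAC_def)
qed

lemma linear_apply:
  "Vector_Spaces.linear tscale (*) (\<lambda>x :: ('g, 'k::field) tens. x \<phi>)"
proof -
  have "module_hom_axioms tscale (*) (\<lambda>x :: ('g, 'k) tens. x \<phi>)"
    unfolding module_hom_axioms_def tscale_def by (simp only: plus_fun_apply simp_thms)
  then show ?thesis
    unfolding Vector_Spaces.linear_def module_hom_def module_iff_vector_space
    by (intro conjI vector_space_tscale vector_space_mult)
qed

text \<open>The multilinear extension \<open>sweedler\<close> agrees with \<open>G\<close> on pure tensors and is linear.\<close>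

lemma sweedler_pureC:
  assumes "mlinC sC (length cs) tscale G"
  shows "sweedler (pureC sC cs) G = G cs"
  using mlinC_comp[OF assms linear_apply]
  by (simp add: sweedler_def pureC_def evalt_def)

lemma sweedler_pureAC:
  assumes "mlinAC sA sC (length cs) tscale G"
  shows "sweedler (pureAC sA sC (a, cs)) G = G (a, cs)"
  using mlinAC_comp[OF assms linear_apply]
  by (simp add: sweedler_def pureAC_def evalt_def)

lemma sweedler_linear:
  "sweedler (x + y) G = sweedler x G + sweedler y G"
  "sweedler (tscale r x) G = tscale r (sweedler x G)"
  unfolding sweedler_def tscale_def by (rule ext, simp only: plus_fun_apply)+

section \<open>Entwining structures\<close>

record ('k, 'a, 'b, 'c) entw_data =
  scaleA :: "'k \<Rightarrow> 'a \<Rightarrow> 'a"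
  scaleB :: "'k \<Rightarrow> 'b \<Rightarrow> 'b"
  scaleC :: "'k \<Rightarrow> 'c \<Rightarrow> 'c"
  Delta :: "'c \<Rightarrow> ('c list, 'k) tens"
  eps :: "'c \<Rightarrow> 'k"
  psi :: "'c \<Rightarrow> 'a \<Rightarrow> ('a \<times> 'c list, 'k) tens"
  zeta :: "'b \<Rightarrow> 'a"

abbreviation tC where "tC E \<equiv> pureC (scaleC E)"
abbreviation tAC where "tAC E \<equiv> pureAC (scaleA E) (scaleC E)"
abbreviation linAA where "linAA E \<equiv> Vector_Spaces.linear (scaleA E) (scaleA E)"
abbreviation linBA where "linBA E \<equiv> Vector_Spaces.linear (scaleB E) (scaleA E)"
abbreviation linCC where "linCC E \<equiv> Vector_Spaces.linear (scaleC E) (scaleC E)"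
abbreviation linAT where "linAT E \<equiv> Vector_Spaces.linear (scaleA E) tscale"
abbreviation linBT where "linBT E \<equiv> Vector_Spaces.linear (scaleB E) tscale"
abbreviation linCT where "linCT E \<equiv> Vector_Spaces.linear (scaleC E) tscale"

text \<open>
  The sorts \<open>{ring, monoid_mult}\<close> and \<open>{comm_ring, comm_monoid_mult}\<close> describe unital
  (commutative) rings without excluding the zero ring.
\<close>

locale k_algebra = vector_space s
  for s :: "'k::field \<Rightarrow> 'a::{ring, monoid_mult} \<Rightarrow> 'a" +
  assumes scale_mult_left: "s r (x * y) = s r x * y"
    and scale_mult_right: "s r (x * y) = x * s r y"

text \<open>
  Linear maps out of a tensor product are given as multilinear maps. The following are the
  composites
  \<open>(\<Delta>' \<otimes> C)\<Delta>''\<close>, \<open>(C \<otimes> \<Delta>')\<Delta>''\<close>, \<open>(\<mu>' \<otimes> C)(A \<otimes> \<psi>')(\<psi>'' \<otimes> A)\<close>,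
  \<open>(\<psi>' \<otimes> C\<^sup>n)(c \<otimes> x)\<close> for \<open>x \<in> A \<otimes> C\<^sup>n\<close>,
  \<open>(A \<otimes> C\<^sup>i\<^sup>-\<^sup>1 \<otimes> \<Delta>' \<otimes> C\<^sup>n\<^sup>-\<^sup>i)(x)\<close> for \<open>x \<in> A \<otimes> C\<^sup>n\<close>, the same without \<open>A\<close>,
  and \<open>(\<psi>' \<otimes> C)(C \<otimes> \<psi>'')(\<Delta>' \<otimes> A)\<close>.
\<close>

definition delta_left where
  "delta_left E D' D'' c =
     sweedler (D'' c) (\<lambda>cs. sweedler (D' (cs ! 0)) (\<lambda>ds. tC E (ds @ [cs ! 1])))"

definition delta_right where
  "delta_right E D' D'' c =
     sweedler (D'' c) (\<lambda>cs. sweedler (D' (cs ! 1)) (\<lambda>ds. tC E ((cs ! 0) # ds)))"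

definition mu_psi_psi where
  "mu_psi_psi E \<mu>' \<psi>' \<psi>'' c x y =
     sweedler (\<psi>'' c x) (\<lambda>(x', cs). sweedler (\<psi>' (cs ! 0) y) (\<lambda>(y', ds). tAC E (\<mu>' x' y', ds)))"

definition psi_on where
  "psi_on E \<psi>' c x =
     sweedler x (\<lambda>(a, cs). sweedler (\<psi>' c a) (\<lambda>(a', ds). tAC E (a', ds @ cs)))"

definition delta_at where
  "delta_at E i D' x =
     sweedler x (\<lambda>(a, cs). sweedler (D' (cs ! (i - 1)))
       (\<lambda>ds. tAC E (a, take (i - 1) cs @ ds @ drop i cs)))"

definition delta_atC where
  "delta_atC E i D' x =
     sweedler x (\<lambda>cs. sweedler (D' (cs ! (i - 1))) (\<lambda>ds. tC E (take (i - 1) cs @ ds @ drop i cs)))"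

definition psi_psi_delta where
  "psi_psi_delta E \<psi>' \<psi>'' D' c a = sweedler (D' c) (\<lambda>cs. psi_on E \<psi>' (cs ! 0) (\<psi>'' (cs ! 1) a))"

definition coalgebra ::
  "('k::field, 'a::{ring, monoid_mult}, 'b::{comm_ring, comm_monoid_mult}, 'c::ab_group_add) entw_data
   \<Rightarrow> bool"
where
  "coalgebra E \<longleftrightarrow>
     vector_space (scaleC E) \<and>
     linCT E (Delta E) \<and> (\<forall>c. Delta E c \<in> tensC (scaleC E) 2) \<and>
     Vector_Spaces.linear (scaleC E) (*) (eps E) \<and>
     (\<forall>c. delta_left E (Delta E) (Delta E) c = delta_right E (Delta E) (Delta E) c) \<and>
     (\<forall>c. sweedler (Delta E c) (\<lambda>cs. tC E [scaleC E (eps E (cs ! 0)) (cs ! 1)]) = tC E [c]) \<and>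
     (\<forall>c. sweedler (Delta E c) (\<lambda>cs. tC E [scaleC E (eps E (cs ! 1)) (cs ! 0)]) = tC E [c])"

text \<open>The space \<open>Hom(C \<otimes> A, A \<otimes> C)\<close>.\<close>

definition hom_CA_AC ::
  "('k::field, 'a::{ring, monoid_mult}, 'b::{comm_ring, comm_monoid_mult}, 'c::ab_group_add) entw_data
   \<Rightarrow> ('c \<Rightarrow> 'a \<Rightarrow> ('a \<times> 'c list, 'k) tens) set"
where
  "hom_CA_AC E = {p. (\<forall>a. linCT E (\<lambda>c. p c a)) \<and> (\<forall>c. linAT E (p c)) \<and>
     (\<forall>c a. p c a \<in> tensAC (scaleA E) (scaleC E) 1)}"

text \<open>In the counit axiom \<open>A\<close> is identified with \<open>A \<otimes> C\<^sup>0\<close> via \<open>a \<mapsto> tAC E (a, [])\<close>.\<close>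

definition entwining ::
  "('k::field, 'a::{ring, monoid_mult}, 'b::{comm_ring, comm_monoid_mult}, 'c::ab_group_add) entw_data
   \<Rightarrow> bool"
where
  "entwining E \<longleftrightarrow>
     k_algebra (scaleA E) \<and> coalgebra E \<and> (\<exists>c::'c. c \<noteq> 0) \<and> psi E \<in> hom_CA_AC E \<and>
     (\<forall>c x y. psi E c (x * y) = mu_psi_psi E (*) (psi E) (psi E) c x y) \<and>
     (\<forall>c a. delta_at E 1 (Delta E) (psi E c a) = psi_psi_delta E (psi E) (psi E) (Delta E) c a) \<and>
     (\<forall>c a. sweedler (psi E c a) (\<lambda>(x, cs). tAC E (scaleA E (eps E (cs ! 0)) x, [])) =
            tAC E (scaleA E (eps E c) a, [])) \<and>
     (\<forall>c. psi E c 1 = tAC E (1, [c]))"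

definition entwining_over ::
  "('k::field, 'a::{ring, monoid_mult}, 'b::{comm_ring, comm_monoid_mult}, 'c::ab_group_add) entw_data
   \<Rightarrow> bool"
where
  "entwining_over E \<longleftrightarrow>
     entwining E \<and> k_algebra (scaleB E) \<and>
     linBA E (zeta E) \<and> zeta E 1 = 1 \<and> (\<forall>b b'. zeta E (b * b') = zeta E b * zeta E b') \<and>
     (\<forall>b a. zeta E b * a = a * zeta E b) \<and>
     (\<forall>c b. psi E c (zeta E b) = tAC E (zeta E b, [c]))"

section \<open>The bicomplex\<close>

text \<open>
  A tensor matrix is a pair of functions \<open>a\<close>, \<open>b\<close>, with \<open>a i\<close> the diagonal entries
  (\<open>1 \<le> i \<le> m\<close>) and \<open>b i j\<close> the entries above the diagonal (\<open>1 \<le> i < j \<le> m\<close>). A map on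
  \<open>V\<^sub>m\<close> is a function of \<open>c\<close>, \<open>a\<close>, \<open>b\<close> that depends only on these entries and is linear
  in each of them.
\<close>

definition same_entries where
  "same_entries m a b a' b' \<longleftrightarrow>
     (\<forall>i\<in>{1..m}. a i = a' i) \<and> (\<forall>i j. 1 \<le> i \<and> i < j \<and> j \<le> m \<longrightarrow> b i j = b' i j)"

definition CochAC ::
  "('k::field, 'a::{ring, monoid_mult}, 'b::{comm_ring, comm_monoid_mult}, 'c::ab_group_add) entw_data
   \<Rightarrow> nat \<Rightarrow> nat \<Rightarrow> ('c \<Rightarrow> (nat \<Rightarrow> 'a) \<Rightarrow> (nat \<Rightarrow> nat \<Rightarrow> 'b) \<Rightarrow> ('a \<times> 'c list, 'k) tens) set"
where
  "CochAC E m n = {f.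
     (\<forall>c a b. f c a b \<in> tensAC (scaleA E) (scaleC E) n) \<and>
     (\<forall>c a b a' b'. same_entries m a b a' b' \<longrightarrow> f c a b = f c a' b') \<and>
     (\<forall>a b. linCT E (\<lambda>c. f c a b)) \<and>
     (\<forall>c a b. \<forall>i\<in>{1..m}. linAT E (\<lambda>x. f c (a(i := x)) b)) \<and>
     (\<forall>c a b i j. 1 \<le> i \<and> i < j \<and> j \<le> m \<longrightarrow> linBT E (\<lambda>x. f c a (b(i := (b i)(j := x)))))}"

definition CochA ::
  "('k::field, 'a::{ring, monoid_mult}, 'b::{comm_ring, comm_monoid_mult}, 'c::ab_group_add) entw_data
   \<Rightarrow> nat \<Rightarrow> ((nat \<Rightarrow> 'a) \<Rightarrow> (nat \<Rightarrow> nat \<Rightarrow> 'b) \<Rightarrow> 'a) set"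
where
  "CochA E m = {f.
     (\<forall>a b a' b'. same_entries m a b a' b' \<longrightarrow> f a b = f a' b') \<and>
     (\<forall>a b. \<forall>i\<in>{1..m}. linAA E (\<lambda>x. f (a(i := x)) b)) \<and>
     (\<forall>a b i j. 1 \<le> i \<and> i < j \<and> j \<le> m \<longrightarrow> linBA E (\<lambda>x. f a (b(i := (b i)(j := x)))))}"

definition CochC ::
  "('k::field, 'a::{ring, monoid_mult}, 'b::{comm_ring, comm_monoid_mult}, 'c::ab_group_add) entw_data
   \<Rightarrow> nat \<Rightarrow> ('c \<Rightarrow> ('c list, 'k) tens) set"
where
  "CochC E n = {g. linCT E g \<and> (\<forall>c. g c \<in> tensC (scaleC E) n)}"

text \<open>
  \<open>shiftA\<close>, \<open>shiftB\<close> give \<open>T\<^sup>(\<^sup>0\<^sup>)\<close>, and \<open>mergeA\<close>, \<open>mergeB\<close> give \<open>T\<^sup>(\<^sup>i\<^sup>)\<close>. The truncation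
  \<open>T\<^sup>(\<^sup>m\<^sup>+\<^sup>1\<^sup>)\<close> needs no operation, since maps on \<open>V\<^sub>m\<close> ignore the later entries.
\<close>

definition shiftA :: "(nat \<Rightarrow> 'a) \<Rightarrow> nat \<Rightarrow> 'a" where
  "shiftA a = (\<lambda>r. a (r + 1))"

definition shiftB :: "(nat \<Rightarrow> nat \<Rightarrow> 'b) \<Rightarrow> nat \<Rightarrow> nat \<Rightarrow> 'b" where
  "shiftB b = (\<lambda>r s. b (r + 1) (s + 1))"

definition mergeA where
  "mergeA E i a b = (\<lambda>r. if r < i then a r
     else if r = i then zeta E (b i (i + 1)) * a i * a (i + 1) else a (r + 1))"

definition mergeB :: "nat \<Rightarrow> (nat \<Rightarrow> nat \<Rightarrow> 'b::comm_monoid_mult) \<Rightarrow> nat \<Rightarrow> nat \<Rightarrow> 'b" where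
  "mergeB i b = (\<lambda>r s.
     if s = i then b r i * b r (i + 1)
     else if r = i then b i (s + 1) * b (i + 1) (s + 1)
     else b (if r < i then r else r + 1) (if s < i then s else s + 1))"

text \<open>The \<open>A\<close>-bimodule structure of \<open>A \<otimes> C\<^sup>n\<close>; \<open>move E cs a\<close> is \<open>a\<^bsub>\<psi>\<^sup>n\<^esub> \<otimes> c\<^sup>1\<^sup>\<psi> \<otimes> \<dots> \<otimes> c\<^sup>n\<^sup>\<psi>\<close>.\<close>

definition lact where
  "lact E a' x = sweedler x (\<lambda>(a, cs). tAC E (a' * a, cs))"

primrec move where
  "move E [] a = tAC E (a, [])"
| "move E (c # cs) a = psi_on E (psi E) c (move E cs a)"

definition ract where
  "ract E x a'' = sweedler x (\<lambda>(a, cs). lact E a (move E cs a''))"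

definition snocAC where
  "snocAC E x c = sweedler x (\<lambda>(a, cs). tAC E (a, cs @ [c]))"

definition consC where
  "consC E c x = sweedler x (\<lambda>cs. tC E (c # cs))"

definition snocC where
  "snocC E x c = sweedler x (\<lambda>cs. tC E (cs @ [c]))"

text \<open>\<open>pass E [1..<m+1] a c K\<close> is \<open>K(T\<^sub>\<psi>, c\<^bsup>\<psi>\<^sup>m\<^esup>)\<close>: \<open>c\<close> is passed successively past \<open>a 1, \<dots>, a m\<close>.\<close>

primrec pass where
  "pass E [] a c K = K a c"
| "pass E (i # is) a c K =
     sweedler (psi E c (a i)) (\<lambda>(x, cs). pass E is (a(i := x)) (cs ! 0) K)"

definition hdiff where
  "hdiff E m f = (\<lambda>c a b.
     sweedler (psi E c (a 1)) (\<lambda>(x, cs).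
       lact E (zeta E (\<Prod>j=2..m+1. b 1 j) * x) (f (cs ! 0) (shiftA a) (shiftB b)))
     + (\<Sum>i=1..m. tscale ((-1) ^ i) (f c (mergeA E i a b) (mergeB i b)))
     + tscale ((-1) ^ (m + 1)) (lact E (zeta E (\<Prod>r=1..m. b r (m + 1))) (ract E (f c a b) (a (m + 1)))))"

definition hdiffA where
  "hdiffA E m f = (\<lambda>a b.
     zeta E (\<Prod>j=2..m+1. b 1 j) * a 1 * f (shiftA a) (shiftB b)
     + (\<Sum>i=1..m. scaleA E ((-1) ^ i) (f (mergeA E i a b) (mergeB i b)))
     + scaleA E ((-1) ^ (m + 1)) (zeta E (\<Prod>r=1..m. b r (m + 1)) * f a b * a (m + 1)))"

definition vdiff where
  "vdiff E m n f = (\<lambda>c a b.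
     sweedler (Delta E c) (\<lambda>cs. psi_on E (psi E) (cs ! 0) (f (cs ! 1) a b))
     + (\<Sum>i=1..n. tscale ((-1) ^ i) (delta_at E i (Delta E) (f c a b)))
     + tscale ((-1) ^ (n + 1)) (sweedler (Delta E c) (\<lambda>cs.
         pass E [1..<m+1] a (cs ! 1) (\<lambda>a' c'. snocAC E (f (cs ! 0) a' b) c'))))"

definition vdiffC where
  "vdiffC E n g = (\<lambda>c.
     sweedler (Delta E c) (\<lambda>cs. consC E (cs ! 0) (g (cs ! 1)))
     + (\<Sum>i=1..n. tscale ((-1) ^ i) (delta_atC E i (Delta E) (g c)))
     + tscale ((-1) ^ (n + 1)) (sweedler (Delta E c) (\<lambda>cs. snocC E (g (cs ! 0)) (cs ! 1))))"

definition jmap where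
  "jmap E f = (\<lambda>c a b. tAC E (scaleA E (eps E c) (f a b), []))"

definition jbar where
  "jbar E g = (\<lambda>c a b. sweedler (g c) (\<lambda>cs. tAC E (1, cs)))"

text \<open>
  An element of \<open>Tot\<^sup>p\<close> is a triple consisting of its component in \<open>C\<^bsup>p,0\<^esup>\<close>, the family of its
  components in \<open>C\<^bsup>m,p-m\<^esup>\<close> indexed by \<open>0 < m < p\<close> (and \<open>0\<close> for other \<open>m\<close>), and its component in
  \<open>C\<^bsup>0,p\<^esup>\<close>.
\<close>

type_synonym ('k, 'a, 'b, 'c) cochain =
  "((nat \<Rightarrow> 'a) \<Rightarrow> (nat \<Rightarrow> nat \<Rightarrow> 'b) \<Rightarrow> 'a) \<times>
   (nat \<Rightarrow> 'c \<Rightarrow> (nat \<Rightarrow> 'a) \<Rightarrow> (nat \<Rightarrow> nat \<Rightarrow> 'b) \<Rightarrow> ('a \<times> 'c list, 'k) tens) \<times>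
   ('c \<Rightarrow> ('c list, 'k) tens)"

definition Tot ::
  "('k::field, 'a::{ring, monoid_mult}, 'b::{comm_ring, comm_monoid_mult}, 'c::ab_group_add) entw_data
   \<Rightarrow> nat \<Rightarrow> ('k, 'a, 'b, 'c) cochain set"
where
  "Tot E p = {(f, F, g). f \<in> CochA E p \<and> g \<in> CochC E p \<and>
     (\<forall>m. if 0 < m \<and> m < p then F m \<in> CochAC E m (p - m) else F m = 0)}"

definition Dtot ::
  "('k::field, 'a::{ring, monoid_mult}, 'b::{comm_ring, comm_monoid_mult}, 'c::ab_group_add) entw_data
   \<Rightarrow> nat \<Rightarrow> ('k, 'a, 'b, 'c) cochain \<Rightarrow> ('k, 'a, 'b, 'c) cochain"
where
  "Dtot E p = (\<lambda>(f, F, g).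
     (\<lambda>a b. scaleA E ((-1) ^ p) (hdiffA E p f a b),
      \<lambda>m. if 1 \<le> m \<and> m \<le> p then
            (\<lambda>c a b.
              (if m = 1 then hdiff E 0 (jbar E g) c a b
               else tscale ((-1) ^ (m - 1)) (hdiff E (m - 1) (F (m - 1)) c a b))
              + (if m = p then tscale ((-1) ^ p) (vdiff E p 0 (jmap E f) c a b)
                 else tscale ((-1) ^ m) (vdiff E m (p - m) (F m) c a b)))
          else 0,
      vdiffC E p g))"

definition cocycles where
  "cocycles E p = {x \<in> Tot E p. Dtot E p x = 0}"

text \<open>The complex starts in degree \<open>1\<close>.\<close>

definition coboundaries where
  "coboundaries E p = (if p \<le> 1 then {0} else Dtot E (p - 1) ` Tot E (p - 1))"

definition coh_class where
  "coh_class E p x = (\<lambda>y. x + y) ` coboundaries E p"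

definition cohomology where
  "cohomology E p = coh_class E p ` cocycles E p"

section \<open>Deformations\<close>

text \<open>
  A \<open>k[[t]]\<close>-linear map such as \<open>\<psi>\<^sub>t\<close> is given by its family of coefficients; identities
  modulo \<open>t\<^sup>n\<^sup>+\<^sup>1\<close> between composites are compared at each \<open>t\<^sup>p\<close>, \<open>p \<le> n\<close>. In
  \<open>dmu d i x y b\<close> the last argument is the one from \<open>B\<close>.
\<close>

record ('k, 'a, 'b, 'c) deform =
  dmu :: "nat \<Rightarrow> 'a \<Rightarrow> 'a \<Rightarrow> 'b \<Rightarrow> 'a"
  dDelta :: "nat \<Rightarrow> 'c \<Rightarrow> ('c list, 'k) tens"
  dpsi :: "nat \<Rightarrow> 'c \<Rightarrow> 'a \<Rightarrow> ('a \<times> 'c list, 'k) tens"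

definition hom_AAB_A ::
  "('k::field, 'a::{ring, monoid_mult}, 'b::{comm_ring, comm_monoid_mult}, 'c::ab_group_add) entw_data
   \<Rightarrow> ('a \<Rightarrow> 'a \<Rightarrow> 'b \<Rightarrow> 'a) set"
where
  "hom_AAB_A E = {h. (\<forall>y b. linAA E (\<lambda>x. h x y b)) \<and> (\<forall>x b. linAA E (\<lambda>y. h x y b)) \<and>
     (\<forall>x y. linBA E (h x y))}"

text \<open>A deformation modulo \<open>t\<^sup>n\<^sup>+\<^sup>1\<close>; the unused coefficients beyond \<open>n\<close> are \<open>0\<close>.\<close>

definition deformation_mod ::
  "('k::field, 'a::{ring, monoid_mult}, 'b::{comm_ring, comm_monoid_mult}, 'c::ab_group_add) entw_data
   \<Rightarrow> nat \<Rightarrow> ('k, 'a, 'b, 'c) deform \<Rightarrow> bool"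
where
  "deformation_mod E n d \<longleftrightarrow>
     dmu d 0 = (\<lambda>x y b. zeta E b * x * y) \<and> dDelta d 0 = Delta E \<and> dpsi d 0 = psi E \<and>
     (\<forall>i\<in>{1..n}. dmu d i \<in> hom_AAB_A E \<and> dDelta d i \<in> CochC E 2 \<and> dpsi d i \<in> hom_CA_AC E) \<and>
     (\<forall>i>n. dmu d i = 0 \<and> dDelta d i = 0 \<and> dpsi d i = 0) \<and>
     (\<forall>p\<le>n.
       (\<forall>b1 b2 b3 x y z.
          (\<Sum>(i, j)\<in>{(i, j). i + j = p}. dmu d i x (dmu d j y z b3) (b1 * b2)) =
          (\<Sum>(i, j)\<in>{(i, j). i + j = p}. dmu d i (dmu d j x y b1) z (b2 * b3))) \<and>
       (\<forall>c.
          (\<Sum>(i, j)\<in>{(i, j). i + j = p}. delta_left E (dDelta d i) (dDelta d j) c) =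
          (\<Sum>(i, j)\<in>{(i, j). i + j = p}. delta_right E (dDelta d i) (dDelta d j) c)) \<and>
       (\<forall>b c x y.
          (\<Sum>(i, j)\<in>{(i, j). i + j = p}. dpsi d i c (dmu d j x y b)) =
          (\<Sum>(i, j, l)\<in>{(i, j, l). i + j + l = p}.
             mu_psi_psi E (\<lambda>x y. dmu d i x y b) (dpsi d j) (dpsi d l) c x y)) \<and>
       (\<forall>c a.
          (\<Sum>(i, j)\<in>{(i, j). i + j = p}. delta_at E 1 (dDelta d i) (dpsi d j c a)) =
          (\<Sum>(i, j, l)\<in>{(i, j, l). i + j + l = p}.
             psi_psi_delta E (dpsi d i) (dpsi d j) (dDelta d l) c a)))"

definition lifts_to where
  "lifts_to n d d' \<longleftrightarrow> (\<forall>i\<le>n. dmu d' i = dmu d i \<and> dDelta d' i = dDelta d i \<and> dpsi d' i = dpsi d i)"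

text \<open>
  Equivalence modulo \<open>t\<^sup>n\<^sup>+\<^sup>1\<close>. Since the constant coefficients of \<open>\<alpha>\<close> and \<open>\<gamma>\<close> are identities,
  they are automatically \<open>k[[t]]\<close>-linear isomorphisms.
\<close>

definition equivalent_mod ::
  "('k::field, 'a::{ring, monoid_mult}, 'b::{comm_ring, comm_monoid_mult}, 'c::ab_group_add) entw_data
   \<Rightarrow> nat \<Rightarrow> ('k, 'a, 'b, 'c) deform \<Rightarrow> ('k, 'a, 'b, 'c) deform \<Rightarrow> bool"
where
  "equivalent_mod E n d d' \<longleftrightarrow>
     (\<exists>(\<alpha> :: nat \<Rightarrow> 'a \<Rightarrow> 'a) (\<gamma> :: nat \<Rightarrow> 'c \<Rightarrow> 'c).
       \<alpha> 0 = id \<and> \<gamma> 0 = id \<and> (\<forall>i\<ge>1. linAA E (\<alpha> i) \<and> linCC E (\<gamma> i)) \<and>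
       (\<forall>p\<le>n.
         (\<forall>b x y.
            (\<Sum>(i, j)\<in>{(i, j). i + j = p}. \<alpha> i (dmu d j x y b)) =
            (\<Sum>(i, j, l)\<in>{(i, j, l). i + j + l = p}. dmu d' i (\<alpha> j x) (\<alpha> l y) b)) \<and>
         (\<forall>c.
            (\<Sum>(i, j, l)\<in>{(i, j, l). i + j + l = p}.
               sweedler (dDelta d l c) (\<lambda>cs. tC E [\<gamma> i (cs ! 0), \<gamma> j (cs ! 1)])) =
            (\<Sum>(i, j)\<in>{(i, j). i + j = p}. dDelta d' i (\<gamma> j c))) \<and>
         (\<forall>c a.
            (\<Sum>(i, j, l)\<in>{(i, j, l). i + j + l = p}. dpsi d' i (\<gamma> j c) (\<alpha> l a)) =
            (\<Sum>(i, j, l)\<in>{(i, j, l). i + j + l = p}.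
               sweedler (dpsi d l c a) (\<lambda>(x, cs). tAC E (\<alpha> i x, [\<gamma> j (cs ! 0)]))))))"

definition inf_deformations where
  "inf_deformations E = {d. deformation_mod E 1 d}"

definition inf_equivalence where
  "inf_equivalence E =
     {(d, d'). d \<in> inf_deformations E \<and> d' \<in> inf_deformations E \<and> equivalent_mod E 1 d d'}"

text \<open>The element \<open>(\<mu>\<^sup>(\<^sup>1\<^sup>), \<psi>\<^sup>(\<^sup>1\<^sup>), \<Delta>\<^sup>(\<^sup>1\<^sup>))\<close> of \<open>C\<^bsup>2,0\<^esup> \<oplus> C\<^bsup>1,1\<^esup> \<oplus> C\<^bsup>0,2\<^esup>\<close>.\<close>

definition inf_cochain ::
  "('k::field, 'a, 'b, 'c) deform \<Rightarrow> ('k, 'a, 'b, 'c) cochain"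
where
  "inf_cochain d =
     (\<lambda>a b. dmu d 1 (a 1) (a 2) (b 1 2),
      \<lambda>m. if m = 1 then (\<lambda>c a b. dpsi d 1 c (a 1)) else 0,
      dDelta d 1)"

text \<open>\<open>obstruction E n d\<close> is \<open>Obs\<^sup>n\<^sup>+\<^sup>1\<close>.\<close>

definition obstruction ::
  "('k::field, 'a::{ring, monoid_mult}, 'b::{comm_ring, comm_monoid_mult}, 'c::ab_group_add) entw_data
   \<Rightarrow> nat \<Rightarrow> ('k, 'a, 'b, 'c) deform \<Rightarrow> ('k, 'a, 'b, 'c) cochain"
where
  "obstruction E n d =
     (let I2 = {(i, j). i < n + 1 \<and> j < n + 1 \<and> i + j = n + 1};
          I3 = {(i, j, l). i < n + 1 \<and> j < n + 1 \<and> l < n + 1 \<and> i + j + l = n + 1}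
      in
       (\<lambda>a b. \<Sum>(i, j)\<in>I2.
          dmu d j (dmu d i (a 1) (a 2) (b 1 2)) (a 3) (b 1 3 * b 2 3)
          - dmu d i (a 1) (dmu d j (a 2) (a 3) (b 2 3)) (b 1 2 * b 1 3),
        \<lambda>m. if m = 2 then
              (\<lambda>c a b.
                (\<Sum>(i, j, l)\<in>I3.
                   mu_psi_psi E (\<lambda>x y. dmu d i x y (b 1 2)) (dpsi d j) (dpsi d l) c (a 1) (a 2))
                - (\<Sum>(i, j)\<in>I2. dpsi d i c (dmu d j (a 1) (a 2) (b 1 2))))
            else if m = 1 then
              (\<lambda>c a b.
                (\<Sum>(i, j, l)\<in>I3. psi_psi_delta E (dpsi d i) (dpsi d j) (dDelta d l) c (a 1))
                - (\<Sum>(i, j)\<in>I2. delta_at E 1 (dDelta d i) (dpsi d j c (a 1))))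
            else 0,
        \<lambda>c. \<Sum>(i, j)\<in>I2.
          delta_left E (dDelta d j) (dDelta d i) c - delta_right E (dDelta d j) (dDelta d i) c))"

end

theory Submission
  imports Defs
begin

text \<open>
  Elements of \<open>Tot\<^sup>2\<close> are exactly the triples \<open>(\<mu>', \<psi>', \<Delta>')\<close> of candidate coefficients, and elements of
  \<open>Tot\<^sup>1\<close> the pairs \<open>(\<alpha>, \<gamma>)\<close>. Comparing coefficients of \<open>t\<^sup>n\<^sup>+\<^sup>1\<close> in the deformation equations, the
  terms containing a coefficient of index \<open>n + 1\<close> add up to minus \<open>D(\<mu>', \<psi>', \<Delta>')\<close>, and the remaining ones
  to \<open>Obs\<^sup>n\<^sup>+\<^sup>1\<close>. Hence a lift is the same thing as a solution of \<open>Obs\<^sup>n\<^sup>+\<^sup>1 = D(\<mu>', \<psi>', \<Delta>')\<close>; for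
  \<open>n = 0\<close> the obstruction vanishes, so infinitesimal deformations are the \<open>2\<close>-cocycles, and the
  coefficient of \<open>t\<close> in the equivalence equations says that two of them differ by \<open>D(\<alpha>, \<gamma>)\<close>. Neither
  \<open>D\<^sup>2 = 0\<close> nor the cocycle property of the obstruction is needed.

  Tensor computations use that \<open>sweedler\<close> is the bind operation of the continuation monad: it is
  associative by definition, and the pure tensors are its units on multilinear maps.
\<close>

text \<open>The representation of tensors shapes the technical half. A tensor is a function on
  arbitrary forms, and \<open>evalt\<close> returns 0 outside the multilinear ones. So
  \<open>sweedler x G\<close> is linear in \<open>x\<close> for every \<open>G\<close>, whereas
  linearity in \<open>G\<close> is available when \<open>x\<close> lies in the span of pure tensors
  and \<open>G\<close> is multilinear. Hence the many lemmas \<open>_mlin\<close>, and the care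
  about membership in a tensor power of fixed length. The comparison with \<open>Dtot\<close> works
  because in a sum over i + j = n + 1 an index n + 1 forces the others to be 0: the new coefficient
  meets only the original structure maps and enters linearly. In the row where \<open>jmap\<close>
  occurs, the counit axiom is what reduces the vertical differential to such composites. Cohomology
  classes are cosets, so equality of classes can be tested on the difference once the coboundaries
  are known to form a subgroup. This is where compatibility of \<open>Dtot\<close> with differences
  in degrees 1 and 2 enters.\<close>

text \<open>As simplification rules these also rewrite unapplied sums of tensors into abstractions.\<close>

declare plus_fun_apply [simp del] zero_fun_apply [simp del] minus_apply [simp del]
  uminus_apply [simp del]

interpretation tens: vector_space "tscale :: 'k::field \<Rightarrow> ('g, 'k) tens \<Rightarrow> _"
  by (rule vector_space_tscale)

lemma linear_add:
  assumes "Vector_Spaces.linear s t f" "Vector_Spaces.linear s t g"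
  shows "Vector_Spaces.linear s t (\<lambda>x. f x + g x)"
  using assms
  by (auto simp: Vector_Spaces.linear_iff vector_space_def algebra_simps)

lemma linear_diff:
  assumes "Vector_Spaces.linear s t f" "Vector_Spaces.linear s t g"
  shows "Vector_Spaces.linear s t (\<lambda>x. f x - g x)"
proof -
  interpret vector_space_pair s t
    using assms by (simp add: Vector_Spaces.linear_iff vector_space_pair_def)
  show ?thesis using linear_compose_sub[OF assms] .
qed

lemma linear_sum':
  assumes "vector_space s" "vector_space t" "\<And>i. i \<in> I \<Longrightarrow> Vector_Spaces.linear s t (f i)"
  shows "Vector_Spaces.linear s t (\<lambda>x. \<Sum>i\<in>I. f i x)"
proof -
  interpret vector_space_pair s t
    using assms by (simp add: vector_space_pair_def)
  show ?thesis using linear_compose_sum[of I f] assms by blast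
qed

lemma linear_scale_const:
  assumes "Vector_Spaces.linear s t f"
  shows "Vector_Spaces.linear s t (\<lambda>x. t r (f x))"
proof -
  interpret vector_space_pair s t
    using assms by (simp add: Vector_Spaces.linear_iff vector_space_pair_def)
  show ?thesis using linear_compose_scale_right[OF assms] .
qed

lemma linear_zero_fun:
  assumes "vector_space s" "vector_space t"
  shows "Vector_Spaces.linear s t (\<lambda>x. 0)"
proof -
  interpret vector_space_pair s t
    using assms by (simp add: vector_space_pair_def)
  show ?thesis using linear_zero .
qed

lemma linear_ident: "vector_space s \<Longrightarrow> Vector_Spaces.linear s s (\<lambda>x. x)"
  by (simp add: Vector_Spaces.linear_iff)

lemma linear_vs:
  assumes "Vector_Spaces.linear s t f"
  shows "vector_space s" "vector_space t"
  using assms by (simp_all add: Vector_Spaces.linear_iff)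

section \<open>Multilinear extension\<close>

lemma sweedler_assoc: "sweedler (sweedler x H) K = sweedler x (\<lambda>g. sweedler (H g) K)"
  by (simp add: sweedler_def)

lemma sweedler_zero: "sweedler 0 G = 0"
  by (rule ext) (simp add: sweedler_def zero_fun_apply)

lemma linear_sweedler_arg:
  assumes "Vector_Spaces.linear s tscale X"
  shows "Vector_Spaces.linear s tscale (\<lambda>u. sweedler (X u) G)"
  using assms by (simp add: Vector_Spaces.linear_iff sweedler_linear vector_space_tscale)

lemma sweedler_diff_left: "sweedler (x - y) G = sweedler x G - sweedler y G"
proof -
  have "Vector_Spaces.linear tscale tscale (\<lambda>x. sweedler x G)"
    by (rule linear_sweedler_arg[OF linear_ident[OF vector_space_tscale]])
  then interpret Vector_Spaces.linear tscale tscale "\<lambda>x. sweedler x G" .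
  show ?thesis by (rule diff)
qed

lemma sweedler_evalt:
  assumes "\<And>\<phi>. (\<lambda>g. G g \<phi>) \<in> M"
  shows "sweedler (evalt M g) G = G g"
  using assms by (simp add: sweedler_def evalt_def)

lemma span_tens_induct [consumes 1, case_names pure zero add scale]:
  assumes x: "x \<in> tens.span (evalt M ` S)"
    and pure: "\<And>g. g \<in> S \<Longrightarrow> P (evalt M g)"
    and zero: "P 0" and add: "\<And>x y. P x \<Longrightarrow> P y \<Longrightarrow> P (x + y)"
    and scale: "\<And>r x. P x \<Longrightarrow> P (tscale r x)"
  shows "P x"
  using x by (induction rule: tens.span_induct_alt) (auto intro: assms)

text \<open>Since membership in \<open>M\<close> depends only on the values on \<open>S\<close>, a
  coordinate of \<open>G\<close> and the same coordinate of \<open>H\<close> take the same branch of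
  \<open>evalt\<close> at a generator: either equal values or 0 on both sides.\<close>

lemma span_sweedler_cong:
  assumes "x \<in> tens.span (evalt M ` S)"
    and M: "\<And>\<phi> \<phi>'. (\<And>g. g \<in> S \<Longrightarrow> \<phi> g = \<phi>' g) \<Longrightarrow> \<phi> \<in> M \<longleftrightarrow> \<phi>' \<in> M"
    and eq: "\<And>g. g \<in> S \<Longrightarrow> G g = H g"
  shows "sweedler x G = sweedler x H"
  using assms(1)
proof (induction rule: span_tens_induct)
  case (pure g)
  have "(\<lambda>g. G g \<phi>) \<in> M \<longleftrightarrow> (\<lambda>g. H g \<phi>) \<in> M" for \<phi>
    by (rule M) (simp add: eq)
  then show ?case by (intro ext) (simp add: sweedler_def evalt_def eq[OF pure])
qed (simp_all add: sweedler_linear sweedler_zero)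

text \<open>Here the tensor is fixed and the integrand varies linearly with a parameter
  \<open>u\<close>. On a generator \<open>sweedler\<close> reduces to \<open>G u g\<close>, and sums
  and multiples of linear maps stay linear.\<close>

lemma span_linear_sweedler:
  assumes "x \<in> tens.span (evalt M ` S)" and s: "vector_space s"
    and M: "\<And>u \<phi>. (\<lambda>g. G u g \<phi>) \<in> M"
    and lin: "\<And>g. g \<in> S \<Longrightarrow> Vector_Spaces.linear s tscale (\<lambda>u. G u g)"
  shows "Vector_Spaces.linear s tscale (\<lambda>u. sweedler x (G u))"
  using assms(1)
proof (induction rule: span_tens_induct)
  case (pure g)
  then show ?case by (simp add: sweedler_evalt M lin)
next
  case zero
  then show ?case by (simp only: sweedler_zero) (rule linear_zero_fun[OF s vector_space_tscale])
next
  case (add x y)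
  then show ?case by (simp only: sweedler_linear) (rule linear_add)
next
  case (scale r x)
  then show ?case by (simp only: sweedler_linear) (rule linear_scale_const)
qed

lemma span_sweedler_in:
  assumes "x \<in> tens.span (evalt M ` S)" and sub: "tens.subspace V"
    and M: "\<And>\<phi>. (\<lambda>g. G g \<phi>) \<in> M"
    and G: "\<And>g. g \<in> S \<Longrightarrow> G g \<in> V"
  shows "sweedler x G \<in> V"
  using assms(1)
proof (induction rule: span_tens_induct)
  case (pure g)
  then show ?case by (simp add: sweedler_evalt M G)
qed (simp_all add: sweedler_linear sweedler_zero tens.subspace_0[OF sub] tens.subspace_add[OF sub]
    tens.subspace_scale[OF sub])

lemma span_sweedler_add:
  assumes "x \<in> tens.span (evalt M ` S)"
    and M: "\<And>\<phi>. (\<lambda>g. G g \<phi>) \<in> M" "\<And>\<phi>. (\<lambda>g. H g \<phi>) \<in> M" "\<And>\<phi>. (\<lambda>g. (G g + H g) \<phi>) \<in> M"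
  shows "sweedler x (\<lambda>g. G g + H g) = sweedler x G + sweedler x H"
  using assms(1)
proof (induction rule: span_tens_induct)
  case (pure g)
  then show ?case
    using M by (simp add: sweedler_evalt)
next
  case zero
  then show ?case by (simp add: sweedler_zero)
next
  case (add x y)
  then show ?case by (simp add: sweedler_linear algebra_simps)
next
  case (scale r x)
  then show ?case by (simp add: sweedler_linear algebra_simps tens.scale_right_distrib)
qed

text \<open>The second unit law of the continuation monad; it holds on the span because evaluation
  at generators has all its coordinates in \<open>M\<close>.\<close>

lemma span_sweedler_ident:
  assumes "x \<in> tens.span (evalt M ` S)" and M: "\<And>\<phi>. (\<lambda>g. evalt M g \<phi>) \<in> M"
  shows "sweedler x (evalt M) = x"
  using assms(1)
proof (induction rule: span_tens_induct)
  case (pure g)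
  show ?case by (rule sweedler_evalt[OF M])
qed (simp_all add: sweedler_linear sweedler_zero)

section \<open>Multilinear maps on lists\<close>

lemma mlinC_1: "mlinC sC (Suc 0) sV \<phi> \<longleftrightarrow> Vector_Spaces.linear sC sV (\<lambda>x. \<phi> [x])"
  by (simp add: mlinC_def)

lemma mlinC_2: "mlinC sC 2 sV \<phi> \<longleftrightarrow>
  (\<forall>y. Vector_Spaces.linear sC sV (\<lambda>x. \<phi> [x, y])) \<and> (\<forall>x. Vector_Spaces.linear sC sV (\<lambda>y. \<phi> [x, y]))"
  (is "?l \<longleftrightarrow> ?r")
proof
  assume l: ?l
  then have "length xs + length ys + 1 = 2 \<Longrightarrow> Vector_Spaces.linear sC sV (\<lambda>x. \<phi> (xs @ x # ys))" for xs ys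
    by (simp add: mlinC_def)
  from this[of "[]" "[_]"] this[of "[_]" "[]"] show ?r by simp
next
  assume r: ?r
  have "Vector_Spaces.linear sC sV (\<lambda>x. \<phi> (xs @ x # ys))" if "length xs + length ys + 1 = 2" for xs ys
  proof (cases xs)
    case Nil
    then have "length ys = Suc 0" using that by simp
    then show ?thesis using r Nil by (auto simp: length_Suc_conv)
  next
    case (Cons z zs)
    then have "zs = []" "ys = []" using that by auto
    then show ?thesis using r Cons by simp
  qed
  then show ?l by (simp add: mlinC_def)
qed

lemma mlinC_cong:
  assumes "\<And>cs. length cs = n \<Longrightarrow> \<phi> cs = \<phi>' cs"
  shows "mlinC sC n sV \<phi> \<longleftrightarrow> mlinC sC n sV \<phi>'"
  using assms by (simp add: mlinC_def)

lemma mlinAC_cong: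
  assumes "\<And>a cs. length cs = n \<Longrightarrow> \<phi> (a, cs) = \<phi>' (a, cs)"
  shows "mlinAC sA sC n sV \<phi> \<longleftrightarrow> mlinAC sA sC n sV \<phi>'"
  using mlinC_cong[of n "\<lambda>cs. \<phi> (_, cs)" "\<lambda>cs. \<phi>' (_, cs)" sC sV] assms
  by (simp add: mlinAC_def)

lemma mlinAC_1: "mlinAC sA sC (Suc 0) sV \<phi> \<longleftrightarrow>
  (\<forall>c. Vector_Spaces.linear sA sV (\<lambda>a. \<phi> (a, [c]))) \<and>
  (\<forall>a. Vector_Spaces.linear sC sV (\<lambda>c. \<phi> (a, [c])))"
  by (auto simp: mlinAC_def mlinC_1 length_Suc_conv)

lemma mlin_apply_tens:
  "mlinC sC n tscale G \<Longrightarrow> mlinC sC n (*) (\<lambda>g. G g \<phi>)"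
  "mlinAC sA sC n tscale H \<Longrightarrow> mlinAC sA sC n (*) (\<lambda>g. H g \<psi>)"
  using mlinC_comp[OF _ linear_apply] mlinAC_comp[OF _ linear_apply] by blast+

text \<open>Tensors carry pointwise operations, so linearity can be tested at each form \<phi>. This
  reduces multilinearity of the pure tensors to the scalar case.\<close>

lemma linear_tens_iff:
  "Vector_Spaces.linear s tscale f \<longleftrightarrow> vector_space s \<and> (\<forall>\<phi>. Vector_Spaces.linear s (*) (\<lambda>x. f x \<phi>))"
  by (auto simp: Vector_Spaces.linear_iff vector_space_tscale vector_space_mult tscale_def fun_eq_iff
      plus_fun_apply)

text \<open>At a multilinear form the coordinate of the pure tensor is that form itself; at any
  other form the default value of \<open>evalt\<close> makes it 0, which is linear as well.\<close>

lemma mlinC_pureC: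
  fixes sC :: "'k::field \<Rightarrow> 'c::ab_group_add \<Rightarrow> 'c"
  assumes "vector_space sC"
  shows "mlinC sC n tscale (pureC sC)"
  unfolding mlinC_def linear_tens_iff
proof (intro allI impI conjI assms)
  fix xs ys :: "'c list" and \<phi>
  assume n: "length xs + length ys + 1 = n"
  then have "mlinC sC n (*) \<phi> \<Longrightarrow> Vector_Spaces.linear sC (*) (\<lambda>x. \<phi> (xs @ x # ys))"
    by (simp add: mlinC_def)
  with n show "Vector_Spaces.linear sC (*) (\<lambda>x. pureC sC (xs @ x # ys) \<phi>)"
    by (cases "mlinC sC n (*) \<phi>") (auto simp: pureC_def evalt_def intro: linear_zero_fun assms vector_space_mult)
qed

lemma mlinAC_pureAC:
  fixes sA :: "'k::field \<Rightarrow> 'a::ab_group_add \<Rightarrow> 'a" and sC :: "'k \<Rightarrow> 'c::ab_group_add \<Rightarrow> 'c"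
  assumes "vector_space sA" "vector_space sC"
  shows "mlinAC sA sC n tscale (pureAC sA sC)"
  unfolding mlinAC_def mlinC_def linear_tens_iff
proof (intro allI impI conjI assms)
  fix a and xs ys :: "'c list" and \<phi>
  assume n: "length xs + length ys + 1 = n"
  then have "mlinAC sA sC n (*) \<phi> \<Longrightarrow> Vector_Spaces.linear sC (*) (\<lambda>x. \<phi> (a, xs @ x # ys))"
    by (simp add: mlinAC_def mlinC_def)
  with n show "Vector_Spaces.linear sC (*) (\<lambda>x. pureAC sA sC (a, xs @ x # ys) \<phi>)"
    by (cases "mlinAC sA sC n (*) \<phi>")
      (auto simp: pureAC_def evalt_def intro: linear_zero_fun assms vector_space_mult)
next
  fix cs :: "'c list" and \<phi>
  assume n: "length cs = n"
  then have "mlinAC sA sC n (*) \<phi> \<Longrightarrow> Vector_Spaces.linear sA (*) (\<lambda>a. \<phi> (a, cs))"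
    by (simp add: mlinAC_def mlinC_def)
  with n show "Vector_Spaces.linear sA (*) (\<lambda>a. pureAC sA sC (a, cs) \<phi>)"
    by (cases "mlinAC sA sC n (*) \<phi>")
      (auto simp: pureAC_def evalt_def intro: linear_zero_fun assms vector_space_mult)
qed

section \<open>Sweedler calculus on tensor powers\<close>

text \<open>The set of forms inside \<open>pureC\<close> varies with the length of the list. On
  lists of one common length it is constant, so the results about spans of \<open>evalt M\<close>
  become applicable.\<close>

lemma tensC_evalt:
  "tensC sC n = tens.span (evalt {\<phi>. mlinC sC n (*) \<phi>} ` {cs. length cs = n})"
  unfolding tensC_def by (rule arg_cong[where f = tens.span]) (auto simp: pureC_def)

lemma tensAC_evalt:
  "tensAC sA sC n = tens.span (evalt {\<phi>. mlinAC sA sC n (*) \<phi>} ` {g. length (snd g) = n})"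
proof -
  have "{pureAC sA sC (a, cs) |a cs. length cs = n} = pureAC sA sC ` {g. length (snd g) = n}"
    by (force simp: image_iff)
  also have "\<dots> = evalt {\<phi>. mlinAC sA sC n (*) \<phi>} ` {g. length (snd g) = n}"
    by (rule image_cong) (auto simp: pureAC_def)
  finally show ?thesis by (simp add: tensAC_def)
qed

lemma subspace_tensC: "tens.subspace (tensC sC n)"
  by (simp add: tensC_def)

lemma subspace_tensAC: "tens.subspace (tensAC sA sC n)"
  by (simp add: tensAC_def)

lemma pureC_in_tensC: "length cs = n \<Longrightarrow> pureC sC cs \<in> tensC sC n"
  unfolding tensC_def by (rule tens.span_base) blast

lemma pureAC_in_tensAC: "length cs = n \<Longrightarrow> pureAC sA sC (a, cs) \<in> tensAC sA sC n"
  unfolding tensAC_def by (rule tens.span_base) blast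

text \<open>Only lists of the right length matter, which allows an integrand to be rewritten after
  splitting the list into its entries, as for \<open>cs ! 0\<close> and
  \<open>cs ! 1\<close>.\<close>

lemma sweedlerC_cong:
  assumes "x \<in> tensC sC n" "\<And>cs. length cs = n \<Longrightarrow> G cs = H cs"
  shows "sweedler x G = sweedler x H"
proof (rule span_sweedler_cong[OF assms(1)[unfolded tensC_evalt]])
  show "\<phi> \<in> {\<phi>. mlinC sC n (*) \<phi>} \<longleftrightarrow> \<phi>' \<in> {\<phi>. mlinC sC n (*) \<phi>}"
    if "\<And>g. g \<in> {g. length g = n} \<Longrightarrow> \<phi> g = \<phi>' g" for \<phi> \<phi>'
    using mlinC_cong[of n \<phi> \<phi>'] that by simp
qed (auto simp: assms(2))

lemma sweedlerAC_cong:
  assumes "x \<in> tensAC sA sC n" "\<And>a cs. length cs = n \<Longrightarrow> G (a, cs) = H (a, cs)"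
  shows "sweedler x G = sweedler x H"
proof (rule span_sweedler_cong[OF assms(1)[unfolded tensAC_evalt]])
  show "\<phi> \<in> {\<phi>. mlinAC sA sC n (*) \<phi>} \<longleftrightarrow> \<phi>' \<in> {\<phi>. mlinAC sA sC n (*) \<phi>}"
    if "\<And>g. g \<in> {g. length (snd g) = n} \<Longrightarrow> \<phi> g = \<phi>' g" for \<phi> \<phi>'
    using mlinAC_cong[of n \<phi> \<phi>'] that by simp
qed (auto simp: assms(2))

lemma linear_sweedlerC:
  assumes "x \<in> tensC sC n" "vector_space s" "\<And>u. mlinC sC n tscale (G u)"
    "\<And>cs. length cs = n \<Longrightarrow> Vector_Spaces.linear s tscale (\<lambda>u. G u cs)"
  shows "Vector_Spaces.linear s tscale (\<lambda>u. sweedler x (G u))"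
  using assms(1) unfolding tensC_evalt
  by (rule span_linear_sweedler) (use assms in \<open>auto intro: mlin_apply_tens\<close>)

lemma linear_sweedlerAC:
  assumes "x \<in> tensAC sA sC n" "vector_space s" "\<And>u. mlinAC sA sC n tscale (G u)"
    "\<And>a cs. length cs = n \<Longrightarrow> Vector_Spaces.linear s tscale (\<lambda>u. G u (a, cs))"
  shows "Vector_Spaces.linear s tscale (\<lambda>u. sweedler x (G u))"
  using assms(1) unfolding tensAC_evalt
  by (rule span_linear_sweedler) (use assms in \<open>auto intro: mlin_apply_tens\<close>)

lemma sweedlerC_in:
  assumes "x \<in> tensC sC n" "tens.subspace V" "mlinC sC n tscale G"
    "\<And>cs. length cs = n \<Longrightarrow> G cs \<in> V"
  shows "sweedler x G \<in> V"
  using assms(1) unfolding tensC_evalt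
  by (rule span_sweedler_in) (use assms in \<open>auto intro: mlin_apply_tens\<close>)

lemma sweedlerAC_in:
  assumes "x \<in> tensAC sA sC n" "tens.subspace V" "mlinAC sA sC n tscale G"
    "\<And>a cs. length cs = n \<Longrightarrow> G (a, cs) \<in> V"
  shows "sweedler x G \<in> V"
  using assms(1) unfolding tensAC_evalt
  by (rule span_sweedler_in) (use assms in \<open>auto intro: mlin_apply_tens\<close>)

lemma mlinC_add:
  "mlinC sC n sV G \<Longrightarrow> mlinC sC n sV H \<Longrightarrow> mlinC sC n sV (\<lambda>g. G g + H g)"
  by (simp add: mlinC_def linear_add)

lemma mlinAC_add:
  "mlinAC sA sC n sV G \<Longrightarrow> mlinAC sA sC n sV H \<Longrightarrow> mlinAC sA sC n sV (\<lambda>g. G g + H g)"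
  by (simp add: mlinAC_def mlinC_add linear_add)

lemma mlinC_diff:
  "mlinC sC n sV G \<Longrightarrow> mlinC sC n sV H \<Longrightarrow> mlinC sC n sV (\<lambda>g. G g - H g)"
  by (simp add: mlinC_def linear_diff)

lemma mlinAC_diff:
  "mlinAC sA sC n sV G \<Longrightarrow> mlinAC sA sC n sV H \<Longrightarrow> mlinAC sA sC n sV (\<lambda>g. G g - H g)"
  by (simp add: mlinAC_def mlinC_diff linear_diff)

lemma sweedlerC_add:
  assumes "x \<in> tensC sC n" "mlinC sC n tscale G" "mlinC sC n tscale H"
  shows "sweedler x (\<lambda>g. G g + H g) = sweedler x G + sweedler x H"
  using assms(1) unfolding tensC_evalt
  by (rule span_sweedler_add)
    (use assms mlin_apply_tens(1)[OF mlinC_add[OF assms(2,3)]] in \<open>auto intro: mlin_apply_tens\<close>)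

lemma sweedlerAC_add:
  assumes "x \<in> tensAC sA sC n" "mlinAC sA sC n tscale G" "mlinAC sA sC n tscale H"
  shows "sweedler x (\<lambda>g. G g + H g) = sweedler x G + sweedler x H"
  using assms(1) unfolding tensAC_evalt
  by (rule span_sweedler_add)
    (use assms mlin_apply_tens(2)[OF mlinAC_add[OF assms(2,3)]] in \<open>auto intro: mlin_apply_tens\<close>)

lemma sweedlerC_diff:
  assumes "x \<in> tensC sC n" "mlinC sC n tscale G" "mlinC sC n tscale H"
  shows "sweedler x (\<lambda>g. G g - H g) = sweedler x G - sweedler x H"
proof -
  have "sweedler x (\<lambda>g. (G g - H g) + H g) = sweedler x (\<lambda>g. G g - H g) + sweedler x H"
    using assms(1) mlinC_diff[OF assms(2,3)] assms(3) by (rule sweedlerC_add)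
  then show ?thesis by (simp add: algebra_simps)
qed

lemma sweedlerAC_diff:
  assumes "x \<in> tensAC sA sC n" "mlinAC sA sC n tscale G" "mlinAC sA sC n tscale H"
  shows "sweedler x (\<lambda>g. G g - H g) = sweedler x G - sweedler x H"
proof -
  have "sweedler x (\<lambda>g. (G g - H g) + H g) = sweedler x (\<lambda>g. G g - H g) + sweedler x H"
    using assms(1) mlinAC_diff[OF assms(2,3)] assms(3) by (rule sweedlerAC_add)
  then show ?thesis by (simp add: algebra_simps)
qed

lemma sweedler_ident_C:
  assumes "x \<in> tensC sC n" "vector_space sC"
  shows "sweedler x (pureC sC) = x"
proof -
  have "sweedler x (evalt {\<phi>. mlinC sC n (*) \<phi>}) = x"
  proof (rule span_sweedler_ident[OF assms(1)[unfolded tensC_evalt]])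
    fix \<phi>
    have "mlinC sC n (*) (\<lambda>g. pureC sC g \<phi>) \<longleftrightarrow> mlinC sC n (*) (\<lambda>g. evalt {\<phi>. mlinC sC n (*) \<phi>} g \<phi>)"
      by (rule mlinC_cong) (simp add: pureC_def)
    then show "(\<lambda>g. evalt {\<phi>. mlinC sC n (*) \<phi>} g \<phi>) \<in> {\<phi>. mlinC sC n (*) \<phi>}"
      using mlin_apply_tens(1)[OF mlinC_pureC[OF assms(2)]] by simp
  qed
  \<comment> \<open>As a function on all lists, \<open>pureC sC\<close> is no single
    \<open>evalt M\<close>; congruence on lists of length \<open>n\<close> replaces it by the
    evaluation for that length.\<close>
  moreover have "sweedler x (pureC sC) = sweedler x (evalt {\<phi>. mlinC sC n (*) \<phi>})"
    using assms(1) by (rule sweedlerC_cong) (simp add: pureC_def)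
  ultimately show ?thesis by simp
qed

lemma sweedler_ident_AC:
  assumes "x \<in> tensAC sA sC n" "vector_space sA" "vector_space sC"
  shows "sweedler x (pureAC sA sC) = x"
proof -
  have "sweedler x (evalt {\<phi>. mlinAC sA sC n (*) \<phi>}) = x"
  proof (rule span_sweedler_ident[OF assms(1)[unfolded tensAC_evalt]])
    fix \<phi>
    have "mlinAC sA sC n (*) (\<lambda>g. pureAC sA sC g \<phi>) \<longleftrightarrow>
        mlinAC sA sC n (*) (\<lambda>g. evalt {\<phi>. mlinAC sA sC n (*) \<phi>} g \<phi>)"
      by (rule mlinAC_cong) (simp add: pureAC_def)
    then show "(\<lambda>g. evalt {\<phi>. mlinAC sA sC n (*) \<phi>} g \<phi>) \<in> {\<phi>. mlinAC sA sC n (*) \<phi>}"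
      using mlin_apply_tens(2)[OF mlinAC_pureAC[OF assms(2,3)]] by simp
  qed
  moreover have "sweedler x (pureAC sA sC) = sweedler x (evalt {\<phi>. mlinAC sA sC n (*) \<phi>})"
    using assms(1) by (rule sweedlerAC_cong) (simp add: pureAC_def)
  ultimately show ?thesis by simp
qed

section \<open>The fixed entwining structure over B and its axioms\<close>

locale entw =
  fixes E :: "('k::field, 'a::{ring, monoid_mult}, 'b::{comm_ring, comm_monoid_mult},
    'c::ab_group_add) entw_data"
  assumes entw: "entwining_over E"
begin

abbreviation "TAC \<equiv> tensAC (scaleA E) (scaleC E)"
abbreviation "TC \<equiv> tensC (scaleC E)"

lemma ent: "entwining E" and kalgB: "k_algebra (scaleB E)" and linear_zeta: "linBA E (zeta E)"
  and zeta_1 [simp]: "zeta E 1 = 1" and zeta_mult: "zeta E (b * b') = zeta E b * zeta E b'"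
  and zeta_central: "zeta E b * a = a * zeta E b"
  and psi_zeta: "psi E c (zeta E b) = tAC E (zeta E b, [c])"
  using entw unfolding entwining_over_def by blast+

lemma kalgA: "k_algebra (scaleA E)" and coalg: "coalgebra E" and psi_hom: "psi E \<in> hom_CA_AC E"
  and psi_mult: "psi E c (x * y) = mu_psi_psi E (*) (psi E) (psi E) c x y"
  and delta_psi: "delta_at E 1 (Delta E) (psi E c a) = psi_psi_delta E (psi E) (psi E) (Delta E) c a"
  using ent unfolding entwining_def by blast+

lemma vsA: "vector_space (scaleA E)" and vsB: "vector_space (scaleB E)"
  and vsC: "vector_space (scaleC E)"
  using kalgA kalgB coalg unfolding k_algebra_def coalgebra_def by blast+

lemma scaleA_mult: "scaleA E r (x * y) = scaleA E r x * y" "scaleA E r (x * y) = x * scaleA E r y"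
  using kalgA unfolding k_algebra_def k_algebra_axioms_def by blast+

lemma scaleB_mult: "scaleB E r (x * y) = scaleB E r x * y" "scaleB E r (x * y) = x * scaleB E r y"
  using kalgB unfolding k_algebra_def k_algebra_axioms_def by blast+

lemma Delta_coch: "Delta E \<in> CochC E 2"
  using coalg unfolding coalgebra_def CochC_def by blast

lemma linear_mult_left: "linAA E (\<lambda>x. a * x)" and linear_mult_right: "linAA E (\<lambda>x. x * a)"
  using vsA by (auto simp: Vector_Spaces.linear_iff distrib_left distrib_right
      simp flip: scaleA_mult)

lemma linear_multB_left: "Vector_Spaces.linear (scaleB E) (scaleB E) (\<lambda>x. b * x)"
  and linear_multB_right: "Vector_Spaces.linear (scaleB E) (scaleB E) (\<lambda>x. x * b)"
  using vsB by (auto simp: Vector_Spaces.linear_iff distrib_left distrib_right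
      simp flip: scaleB_mult)

section \<open>Linearity of the composites\<close>

lemma linear_tAC_A:
  "Vector_Spaces.linear s (scaleA E) f \<Longrightarrow> Vector_Spaces.linear s tscale (\<lambda>u. tAC E (f u, cs))"
  by (rule linear_comp[where f = f and ?s2.0 = "scaleA E"])
    (use mlinAC_pureAC[OF vsA vsC] in \<open>auto simp: mlinAC_def\<close>)

lemma linear_tAC_C:
  "Vector_Spaces.linear s (scaleC E) f \<Longrightarrow> Vector_Spaces.linear s tscale (\<lambda>u. tAC E (a, xs @ f u # ys))"
  by (rule linear_comp[where f = f and ?s2.0 = "scaleC E"])
    (use mlinAC_pureAC[OF vsA vsC] in \<open>auto simp: mlinAC_def mlinC_def\<close>)

lemma linear_tC:
  "Vector_Spaces.linear s (scaleC E) f \<Longrightarrow> Vector_Spaces.linear s tscale (\<lambda>u. tC E (xs @ f u # ys))"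
  by (rule linear_comp[where f = f and ?s2.0 = "scaleC E"])
    (use mlinC_pureC[OF vsC] in \<open>auto simp: mlinC_def\<close>)

lemma mlinC_tAC: "mlinC (scaleC E) n tscale (\<lambda>ds. tAC E (a, xs @ ds @ ys))"
  unfolding mlinC_def
  using linear_tAC_C[OF linear_ident[OF vsC], of a "xs @ _" "_ @ ys"] by simp

lemma mlinC_tC: "mlinC (scaleC E) n tscale (\<lambda>ds. tC E (xs @ ds @ ys))"
  unfolding mlinC_def
  using linear_tC[OF linear_ident[OF vsC], of "xs @ _" "_ @ ys"] by simp

lemma mlinAC_tAC:
  assumes "linAA E h"
  shows "mlinAC (scaleA E) (scaleC E) n tscale (\<lambda>(a, ds). tAC E (h a, xs @ ds @ ys))"
  using mlinC_tAC linear_tAC_A[OF assms] by (simp add: mlinAC_def)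

lemma homD:
  assumes "\<psi> \<in> hom_CA_AC E"
  shows "linCT E (\<lambda>c. \<psi> c a)" "linAT E (\<psi> c)" "\<psi> c a \<in> TAC 1"
  using assms by (auto simp: hom_CA_AC_def)

lemma cochD:
  assumes "D \<in> CochC E n"
  shows "linCT E D" "D c \<in> TC n"
  using assms by (auto simp: CochC_def)

text \<open>Linearity in \<open>a\<close> comes from \<psi>, whose value is the tensor being
  integrated; linearity in the entries of \<open>cs\<close> comes from the pure tensors, where
  \<open>cs\<close> is only appended. This is what makes \<open>psi_on\<close> computable on pure
  tensors.\<close>

lemma psi_on_mlin:
  assumes "\<psi> \<in> hom_CA_AC E"
  shows "mlinAC (scaleA E) (scaleC E) n tscale
    (\<lambda>(a, cs). sweedler (\<psi> c a) (\<lambda>(a', ds). tAC E (a', ds @ cs)))"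
  unfolding mlinAC_def mlinC_def prod.case
proof (intro allI conjI impI)
  show "linAT E (\<lambda>a. sweedler (\<psi> c a) (\<lambda>(a', ds). tAC E (a', ds @ cs)))" for cs
    by (rule linear_sweedler_arg[OF homD(2)[OF assms]])
  show "linCT E (\<lambda>x. sweedler (\<psi> c a) (\<lambda>(a', ds). tAC E (a', ds @ xs @ x # ys)))" for a xs ys
    using homD(3)[OF assms]
  proof (rule linear_sweedlerAC[OF _ vsC])
    show "mlinAC (scaleA E) (scaleC E) 1 tscale (\<lambda>(a', ds). tAC E (a', ds @ xs @ x # ys))" for x
      using mlinAC_tAC[OF linear_ident[OF vsA], of 1 "[]"] by simp
    show "linCT E (\<lambda>u. case (a, cs) of (a', ds) \<Rightarrow> tAC E (a', ds @ xs @ u # ys))" for a cs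
      using linear_tAC_C[OF linear_ident[OF vsC], of a "cs @ xs" ys] by simp
  qed
qed

lemma psi_on_tAC:
  assumes "\<psi> \<in> hom_CA_AC E"
  shows "psi_on E \<psi> c (tAC E (a, cs)) = sweedler (\<psi> c a) (\<lambda>(a', ds). tAC E (a', ds @ cs))"
  unfolding psi_on_def by (subst sweedler_pureAC[OF psi_on_mlin[OF assms]]) simp

lemma tAC_id: "x \<in> TAC n \<Longrightarrow> sweedler x (\<lambda>(a', ds). tAC E (a', ds)) = x"
  using sweedler_ident_AC[OF _ vsA vsC] by (simp add: case_prod_eta)

lemma psi_on_tAC_Nil:
  assumes "\<psi> \<in> hom_CA_AC E"
  shows "psi_on E \<psi> c (tAC E (a, [])) = \<psi> c a"
  using tAC_id[OF homD(3)[OF assms]] by (simp add: psi_on_tAC[OF assms])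

lemma psi_on_linear_c:
  assumes "\<psi> \<in> hom_CA_AC E" "x \<in> TAC n"
  shows "linCT E (\<lambda>c. psi_on E \<psi> c x)"
  unfolding psi_on_def
  by (rule linear_sweedlerAC[OF assms(2) vsC psi_on_mlin[OF assms(1)]])
    (simp add: linear_sweedler_arg homD(1)[OF assms(1)])

lemma psi_on_linear_x:
  assumes "Vector_Spaces.linear s tscale X"
  shows "Vector_Spaces.linear s tscale (\<lambda>u. psi_on E \<psi> c (X u))"
  unfolding psi_on_def by (rule linear_sweedler_arg[OF assms])

lemma psi_on_in:
  assumes "\<psi> \<in> hom_CA_AC E" "x \<in> TAC n"
  shows "psi_on E \<psi> c x \<in> TAC (Suc n)"
  unfolding psi_on_def
proof (rule sweedlerAC_in[OF assms(2) subspace_tensAC psi_on_mlin[OF assms(1)]])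
  fix a and cs :: "'c list"
  assume n: "length cs = n"
  have "sweedler (\<psi> c a) (\<lambda>(a', ds). tAC E (a', ds @ cs)) \<in> TAC (Suc n)"
    by (rule sweedlerAC_in[OF homD(3)[OF assms(1)] subspace_tensAC])
      (use mlinAC_tAC[OF linear_ident[OF vsA], of 1 "[]"] n in \<open>auto intro: pureAC_in_tensAC\<close>)
  then show "(case (a, cs) of (a, cs) \<Rightarrow> sweedler (\<psi> c a) (\<lambda>(a', ds). tAC E (a', ds @ cs))) \<in> TAC (Suc n)"
    by simp
qed

text \<open>Differences are the only vector space operation followed through the composites below: a
  nonempty set closed under differences is a subgroup, which is what is later used of the
  coboundaries.\<close>

lemma hom_diff:
  assumes "\<psi> \<in> hom_CA_AC E" "\<psi>' \<in> hom_CA_AC E"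
  shows "\<psi> - \<psi>' \<in> hom_CA_AC E"
proof -
  have "linAT E ((\<psi> - \<psi>') c)" for c
    using linear_diff[of "scaleA E" tscale "\<psi> c" "\<psi>' c"] assms
    by (simp add: hom_CA_AC_def minus_apply fun_diff_def[of "\<psi> c"])
  then show ?thesis
    using assms by (auto simp: hom_CA_AC_def minus_apply intro: linear_diff
        tens.subspace_diff[OF subspace_tensAC] simp del: One_nat_def)
qed

lemma coch_diff:
  assumes "D \<in> CochC E n" "D' \<in> CochC E n"
  shows "D - D' \<in> CochC E n"
  using assms linear_diff[of "scaleC E" tscale D D']
  by (auto simp: CochC_def fun_diff_def[of D] intro: tens.subspace_diff[OF subspace_tensC])

lemma psi_on_diff:
  assumes "\<psi> \<in> hom_CA_AC E" "\<psi>' \<in> hom_CA_AC E" "x \<in> TAC n"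
  shows "psi_on E (\<psi> - \<psi>') c x = psi_on E \<psi> c x - psi_on E \<psi>' c x"
  unfolding psi_on_def
  by (subst sweedlerAC_diff[OF assms(3) psi_on_mlin[OF assms(1)] psi_on_mlin[OF assms(2)], symmetric])
    (simp add: minus_apply sweedler_diff_left split_def)

lemma psi_psi_mlin:
  assumes "\<psi>' \<in> hom_CA_AC E" "\<psi>'' \<in> hom_CA_AC E"
  shows "mlinC (scaleC E) 2 tscale (\<lambda>cs. psi_on E \<psi>' (cs ! 0) (\<psi>'' (cs ! 1) a))"
  by (simp add: mlinC_2 psi_on_linear_c[OF assms(1) homD(3)[OF assms(2)]]
      psi_on_linear_x[OF homD(1)[OF assms(2)]])

lemma psi_psi_delta_linear_c:
  "D \<in> CochC E 2 \<Longrightarrow> linCT E (\<lambda>c. psi_psi_delta E \<psi>' \<psi>'' D c a)"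
  unfolding psi_psi_delta_def by (rule linear_sweedler_arg[OF cochD(1)])

lemma psi_psi_delta_linear_a:
  assumes "\<psi>' \<in> hom_CA_AC E" "\<psi>'' \<in> hom_CA_AC E" "D \<in> CochC E 2"
  shows "linAT E (\<lambda>a. psi_psi_delta E \<psi>' \<psi>'' D c a)"
  unfolding psi_psi_delta_def
  by (rule linear_sweedlerC[OF cochD(2)[OF assms(3)] vsA psi_psi_mlin[OF assms(1,2)]])
    (rule psi_on_linear_x[OF homD(2)[OF assms(2)]])

lemma psi_psi_delta_in:
  assumes "\<psi>' \<in> hom_CA_AC E" "\<psi>'' \<in> hom_CA_AC E" "D \<in> CochC E 2"
  shows "psi_psi_delta E \<psi>' \<psi>'' D c a \<in> TAC 2"
  unfolding psi_psi_delta_def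
  by (rule sweedlerC_in[OF cochD(2)[OF assms(3)] subspace_tensAC psi_psi_mlin[OF assms(1,2)]])
    (use psi_on_in[OF assms(1) homD(3)[OF assms(2)]] in \<open>simp add: numeral_2_eq_2\<close>)

text \<open>The coproduct is the tensor being integrated, so subtraction there is immediate. The
  other two positions sit inside the integrand and rely on its multilinearity.\<close>

lemma psi_psi_delta_diff:
  assumes "\<psi>' \<in> hom_CA_AC E" "\<psi>'' \<in> hom_CA_AC E" "D \<in> CochC E 2"
  shows "\<phi> \<in> hom_CA_AC E \<Longrightarrow> psi_psi_delta E (\<psi>' - \<phi>) \<psi>'' D c a =
      psi_psi_delta E \<psi>' \<psi>'' D c a - psi_psi_delta E \<phi> \<psi>'' D c a"
    "\<phi> \<in> hom_CA_AC E \<Longrightarrow> psi_psi_delta E \<psi>' (\<psi>'' - \<phi>) D c a =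
      psi_psi_delta E \<psi>' \<psi>'' D c a - psi_psi_delta E \<psi>' \<phi> D c a"
    "psi_psi_delta E \<psi>' \<psi>'' (D - D') c a =
      psi_psi_delta E \<psi>' \<psi>'' D c a - psi_psi_delta E \<psi>' \<psi>'' D' c a"
proof -
  show "psi_psi_delta E \<psi>' \<psi>'' (D - D') c a =
      psi_psi_delta E \<psi>' \<psi>'' D c a - psi_psi_delta E \<psi>' \<psi>'' D' c a"
    by (simp add: psi_psi_delta_def minus_apply sweedler_diff_left)
  assume \<phi>: "\<phi> \<in> hom_CA_AC E"
  show "psi_psi_delta E (\<psi>' - \<phi>) \<psi>'' D c a =
      psi_psi_delta E \<psi>' \<psi>'' D c a - psi_psi_delta E \<phi> \<psi>'' D c a"
    unfolding psi_psi_delta_def psi_on_diff[OF assms(1) \<phi> homD(3)[OF assms(2)]]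
    by (rule sweedlerC_diff[OF cochD(2)[OF assms(3)] psi_psi_mlin[OF assms(1,2)] psi_psi_mlin[OF \<phi> assms(2)]])
  have "psi_on E \<psi>' d ((\<psi>'' - \<phi>) d' a) = psi_on E \<psi>' d (\<psi>'' d' a) - psi_on E \<psi>' d (\<phi> d' a)" for d d'
    by (simp add: psi_on_def minus_apply sweedler_diff_left)
  then show "psi_psi_delta E \<psi>' (\<psi>'' - \<phi>) D c a =
      psi_psi_delta E \<psi>' \<psi>'' D c a - psi_psi_delta E \<psi>' \<phi> D c a"
    unfolding psi_psi_delta_def
    by (simp only: sweedlerC_diff[OF cochD(2)[OF assms(3)] psi_psi_mlin[OF assms(1,2)] psi_psi_mlin[OF assms(1) \<phi>]])
qed

lemma delta_at_1:
  assumes "x \<in> TAC 1"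
  shows "delta_at E 1 D x = sweedler x (\<lambda>(a, cs). sweedler (D (cs ! 0)) (\<lambda>ds. tAC E (a, ds)))"
  unfolding delta_at_def by (rule sweedlerAC_cong[OF assms]) simp

lemma delta_at_mlin:
  assumes "D \<in> CochC E n"
  shows "mlinAC (scaleA E) (scaleC E) 1 tscale
    (\<lambda>(a, cs). sweedler (D (cs ! 0)) (\<lambda>ds. tAC E (a, ds)))"
proof -
  have "mlinC (scaleC E) n tscale (\<lambda>ds. tAC E (a, ds))" for a
    using mlinC_tAC[of n a "[]" "[]"] by simp
  then have "linAT E (\<lambda>a. sweedler (D c) (\<lambda>ds. tAC E (a, ds)))" for c
    by (rule linear_sweedlerC[OF cochD(2)[OF assms] vsA]) (rule linear_tAC_A[OF linear_ident[OF vsA]])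
  moreover have "linCT E (\<lambda>c. sweedler (D c) (\<lambda>ds. tAC E (a, ds)))" for a
    by (rule linear_sweedler_arg[OF cochD(1)[OF assms]])
  ultimately show ?thesis by (simp add: mlinAC_1)
qed

lemma delta_at_linear:
  assumes "Vector_Spaces.linear s tscale X"
  shows "Vector_Spaces.linear s tscale (\<lambda>u. delta_at E i D (X u))"
  unfolding delta_at_def by (rule linear_sweedler_arg[OF assms])

lemma delta_at_in:
  assumes "D \<in> CochC E n" "x \<in> TAC 1"
  shows "delta_at E 1 D x \<in> TAC n"
  unfolding delta_at_1[OF assms(2)]
proof (rule sweedlerAC_in[OF assms(2) subspace_tensAC delta_at_mlin[OF assms(1)]])
  fix a and cs :: "'c list"
  have "sweedler (D (cs ! 0)) (\<lambda>ds. tAC E (a, ds)) \<in> TAC n"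
    by (rule sweedlerC_in[OF cochD(2)[OF assms(1)] subspace_tensAC])
      (use mlinC_tAC[of n a "[]" "[]"] in \<open>auto intro: pureAC_in_tensAC\<close>)
  then show "(case (a, cs) of (a, cs) \<Rightarrow> sweedler (D (cs ! 0)) (\<lambda>ds. tAC E (a, ds))) \<in> TAC n"
    by simp
qed

lemma delta_at_diff:
  assumes "D \<in> CochC E n" "D' \<in> CochC E n" "x \<in> TAC 1"
  shows "delta_at E 1 (D - D') x = delta_at E 1 D x - delta_at E 1 D' x"
  unfolding delta_at_1[OF assms(3)]
  by (subst sweedlerAC_diff[OF assms(3) delta_at_mlin[OF assms(1)] delta_at_mlin[OF assms(2)], symmetric])
    (simp add: minus_apply sweedler_diff_left split_def)

lemma delta_at_diff_arg: "delta_at E i D (x - y) = delta_at E i D x - delta_at E i D y"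
  by (simp add: delta_at_def sweedler_diff_left)


section \<open>Bilinear multiplications after two entwinings\<close>

lemma bilin_mlin:
  assumes "\<And>x. linAA E (h x)"
  shows "mlinAC (scaleA E) (scaleC E) n tscale (\<lambda>(y, ds). tAC E (h x y, ds))"
  using mlinAC_tAC[OF assms, where xs = "[]" and ys = "[]"] by simp

lemma mu_psi_psi_mlin:
  assumes "\<psi> \<in> hom_CA_AC E" "\<And>y. linAA E (\<lambda>x. h x y)" "\<And>x. linAA E (h x)"
  shows "mlinAC (scaleA E) (scaleC E) 1 tscale
    (\<lambda>(x', cs). sweedler (\<psi> (cs ! 0) y) (\<lambda>(y', ds). tAC E (h x' y', ds)))"
proof -
  have "linAT E (\<lambda>x'. sweedler (\<psi> c y) (\<lambda>(y', ds). tAC E (h x' y', ds)))" for c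
    by (rule linear_sweedlerAC[OF homD(3)[OF assms(1)] vsA bilin_mlin[OF assms(3)]])
      (simp add: linear_tAC_A assms(2))
  moreover have "linCT E (\<lambda>c. sweedler (\<psi> c y) (\<lambda>(y', ds). tAC E (h x' y', ds)))" for x'
    by (rule linear_sweedler_arg[OF homD(1)[OF assms(1)]])
  ultimately show ?thesis by (simp add: mlinAC_1)
qed

lemma mu_psi_psi_linear_c:
  "\<psi>'' \<in> hom_CA_AC E \<Longrightarrow> linCT E (\<lambda>c. mu_psi_psi E h \<psi>' \<psi>'' c x y)"
  unfolding mu_psi_psi_def by (rule linear_sweedler_arg[OF homD(1)])

lemma mu_psi_psi_linear_x:
  "\<psi>'' \<in> hom_CA_AC E \<Longrightarrow> linAT E (\<lambda>x. mu_psi_psi E h \<psi>' \<psi>'' c x y)"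
  unfolding mu_psi_psi_def by (rule linear_sweedler_arg[OF homD(2)])

lemma mu_psi_psi_linear_y:
  assumes "\<psi>' \<in> hom_CA_AC E" "\<psi>'' \<in> hom_CA_AC E" "\<And>y. linAA E (\<lambda>x. h x y)" "\<And>x. linAA E (h x)"
  shows "linAT E (mu_psi_psi E h \<psi>' \<psi>'' c x)"
  unfolding mu_psi_psi_def
  by (rule linear_sweedlerAC[OF homD(3)[OF assms(2)] vsA mu_psi_psi_mlin[OF assms(1,3,4)]])
    (simp add: linear_sweedler_arg[OF homD(2)[OF assms(1)]])

lemma mu_psi_psi_in:
  assumes "\<psi>' \<in> hom_CA_AC E" "\<psi>'' \<in> hom_CA_AC E" "\<And>y. linAA E (\<lambda>x. h x y)" "\<And>x. linAA E (h x)"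
  shows "mu_psi_psi E h \<psi>' \<psi>'' c x y \<in> TAC 1"
  unfolding mu_psi_psi_def
proof (rule sweedlerAC_in[OF homD(3)[OF assms(2)] subspace_tensAC mu_psi_psi_mlin[OF assms(1,3,4)]])
  fix x' and cs :: "'c list"
  have "sweedler (\<psi>' (cs ! 0) y) (\<lambda>(y', ds). tAC E (h x' y', ds)) \<in> TAC 1"
    by (rule sweedlerAC_in[OF homD(3)[OF assms(1)] subspace_tensAC bilin_mlin[OF assms(4)]])
      (simp add: pureAC_in_tensAC)
  then show "(case (x', cs) of (x', cs) \<Rightarrow>
      sweedler (\<psi>' (cs ! 0) y) (\<lambda>(y', ds). tAC E (h x' y', ds))) \<in> TAC 1"
    by simp
qed

text \<open>Supplies linearity in the entry from B, which enters such a composite only through the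
  multiplication \<open>h b\<close>.\<close>

lemma mu_psi_psi_linear_mult:
  assumes "\<psi>' \<in> hom_CA_AC E" "\<psi>'' \<in> hom_CA_AC E"
    and "\<And>b y. linAA E (\<lambda>x. h b x y)" "\<And>b x. linAA E (h b x)"
    and "\<And>x y. Vector_Spaces.linear s (scaleA E) (\<lambda>b. h b x y)"
  shows "Vector_Spaces.linear s tscale (\<lambda>b. mu_psi_psi E (h b) \<psi>' \<psi>'' c x y)"
  unfolding mu_psi_psi_def
proof (rule linear_sweedlerAC[OF homD(3)[OF assms(2)] linear_vs(1)[OF assms(5)]
      mu_psi_psi_mlin[OF assms(1,3,4)]])
  fix x' and cs :: "'c list"
  have "Vector_Spaces.linear s tscale
      (\<lambda>b. sweedler (\<psi>' (cs ! 0) y) (\<lambda>(y', ds). tAC E (h b x' y', ds)))"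
    by (rule linear_sweedlerAC[OF homD(3)[OF assms(1)] linear_vs(1)[OF assms(5)] bilin_mlin[OF assms(4)]])
      (simp add: linear_tAC_A assms(5))
  then show "Vector_Spaces.linear s tscale (\<lambda>b. case (x', cs) of (x', cs) \<Rightarrow>
      sweedler (\<psi>' (cs ! 0) y) (\<lambda>(y', ds). tAC E (h b x' y', ds)))"
    by simp
qed

text \<open>The composite is additive in each of its three maps. For \<psi>'', applied first, this
  is linearity of \<open>sweedler\<close> in the tensor; for \<psi>' and \<open>h\<close> it needs
  the integrand to be multilinear.\<close>

lemma mu_psi_psi_diff:
  assumes "\<psi>' \<in> hom_CA_AC E" "\<psi>'' \<in> hom_CA_AC E" "\<And>y. linAA E (\<lambda>x. h x y)" "\<And>x. linAA E (h x)"
  shows "(\<And>y. linAA E (\<lambda>x. h' x y)) \<Longrightarrow> (\<And>x. linAA E (h' x)) \<Longrightarrow>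
      mu_psi_psi E (\<lambda>x y. h x y - h' x y) \<psi>' \<psi>'' c x y =
      mu_psi_psi E h \<psi>' \<psi>'' c x y - mu_psi_psi E h' \<psi>' \<psi>'' c x y"
    "\<phi> \<in> hom_CA_AC E \<Longrightarrow> mu_psi_psi E h (\<psi>' - \<phi>) \<psi>'' c x y =
      mu_psi_psi E h \<psi>' \<psi>'' c x y - mu_psi_psi E h \<phi> \<psi>'' c x y"
    "mu_psi_psi E h \<psi>' (\<psi>'' - \<phi>) c x y =
      mu_psi_psi E h \<psi>' \<psi>'' c x y - mu_psi_psi E h \<psi>' \<phi> c x y"
proof -
  show "mu_psi_psi E h \<psi>' (\<psi>'' - \<phi>) c x y =
      mu_psi_psi E h \<psi>' \<psi>'' c x y - mu_psi_psi E h \<psi>' \<phi> c x y"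
    by (simp add: mu_psi_psi_def minus_apply sweedler_diff_left)
  show "mu_psi_psi E h (\<psi>' - \<phi>) \<psi>'' c x y =
      mu_psi_psi E h \<psi>' \<psi>'' c x y - mu_psi_psi E h \<phi> \<psi>'' c x y" if \<phi>: "\<phi> \<in> hom_CA_AC E"
    unfolding mu_psi_psi_def
    by (subst sweedlerAC_diff[OF homD(3)[OF assms(2)] mu_psi_psi_mlin[OF assms(1,3,4)]
          mu_psi_psi_mlin[OF \<phi> assms(3,4)], symmetric])
      (simp add: minus_apply sweedler_diff_left split_def)
  assume h': "\<And>y. linAA E (\<lambda>x. h' x y)" "\<And>x. linAA E (h' x)"
  have "tAC E (h x y - h' x y, ds) = tAC E (h x y, ds) - tAC E (h' x y, ds)" for x y ds
  proof -
    interpret Vector_Spaces.linear "scaleA E" tscale "\<lambda>a. tAC E (a, ds)"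
      by (rule linear_tAC_A[OF linear_ident[OF vsA]])
    show ?thesis by (rule diff)
  qed
  then have "sweedler (\<psi>' d y) (\<lambda>(y', ds). tAC E (h x' y' - h' x' y', ds)) =
      sweedler (\<psi>' d y) (\<lambda>(y', ds). tAC E (h x' y', ds)) -
      sweedler (\<psi>' d y) (\<lambda>(y', ds). tAC E (h' x' y', ds))" for d x'
    by (subst sweedlerAC_diff[OF homD(3)[OF assms(1)] bilin_mlin[OF assms(4)] bilin_mlin[OF h'(2)], symmetric])
      (simp add: split_def)
  then show "mu_psi_psi E (\<lambda>x y. h x y - h' x y) \<psi>' \<psi>'' c x y =
      mu_psi_psi E h \<psi>' \<psi>'' c x y - mu_psi_psi E h' \<psi>' \<psi>'' c x y"
    unfolding mu_psi_psi_def
    by (subst sweedlerAC_diff[OF homD(3)[OF assms(2)] mu_psi_psi_mlin[OF assms(1,3,4)]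
          mu_psi_psi_mlin[OF assms(1) h'], symmetric])
      (simp add: split_def)
qed

section \<open>Iterated coproducts\<close>

lemma delta_left_mlin:
  assumes "D' \<in> CochC E n"
  shows "mlinC (scaleC E) 2 tscale (\<lambda>cs. sweedler (D' (cs ! 0)) (\<lambda>ds. tC E (ds @ [cs ! 1])))"
proof -
  have "linCT E (\<lambda>d. sweedler (D' c) (\<lambda>ds. tC E (ds @ [d])))" for c
    by (rule linear_sweedlerC[OF cochD(2)[OF assms] vsC])
      (use mlinC_tC[of n "[]"] linear_tC[OF linear_ident[OF vsC], of _ "[]"] in simp_all)
  then show ?thesis
    by (simp add: mlinC_2 linear_sweedler_arg[OF cochD(1)[OF assms]])
qed

lemma delta_right_mlin:
  assumes "D' \<in> CochC E n"
  shows "mlinC (scaleC E) 2 tscale (\<lambda>cs. sweedler (D' (cs ! 1)) (\<lambda>ds. tC E ((cs ! 0) # ds)))"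
proof -
  have "linCT E (\<lambda>d. sweedler (D' c) (\<lambda>ds. tC E (d # ds)))" for c
    by (rule linear_sweedlerC[OF cochD(2)[OF assms] vsC])
      (use mlinC_tC[of n "[_]" "[]"] linear_tC[OF linear_ident[OF vsC], of "[]"] in simp_all)
  then show ?thesis
    by (simp add: mlinC_2 linear_sweedler_arg[OF cochD(1)[OF assms]])
qed

lemma delta_left_linear: "D'' \<in> CochC E 2 \<Longrightarrow> linCT E (delta_left E D' D'')"
  unfolding delta_left_def by (rule linear_sweedler_arg[OF cochD(1)])

lemma delta_right_linear: "D'' \<in> CochC E 2 \<Longrightarrow> linCT E (delta_right E D' D'')"
  unfolding delta_right_def by (rule linear_sweedler_arg[OF cochD(1)])

lemma delta_left_in:
  assumes "D' \<in> CochC E n" "D'' \<in> CochC E 2"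
  shows "delta_left E D' D'' c \<in> TC (Suc n)"
  unfolding delta_left_def
proof (rule sweedlerC_in[OF cochD(2)[OF assms(2)] subspace_tensC delta_left_mlin[OF assms(1)]])
  show "sweedler (D' (cs ! 0)) (\<lambda>ds. tC E (ds @ [cs ! 1])) \<in> TC (Suc n)" for cs
    by (rule sweedlerC_in[OF cochD(2)[OF assms(1)] subspace_tensC])
      (use mlinC_tC[of n "[]"] in \<open>simp_all add: pureC_in_tensC\<close>)
qed

lemma delta_right_in:
  assumes "D' \<in> CochC E n" "D'' \<in> CochC E 2"
  shows "delta_right E D' D'' c \<in> TC (Suc n)"
  unfolding delta_right_def
proof (rule sweedlerC_in[OF cochD(2)[OF assms(2)] subspace_tensC delta_right_mlin[OF assms(1)]])
  show "sweedler (D' (cs ! 1)) (\<lambda>ds. tC E ((cs ! 0) # ds)) \<in> TC (Suc n)" for cs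
    by (rule sweedlerC_in[OF cochD(2)[OF assms(1)] subspace_tensC])
      (use mlinC_tC[of n "[_]" "[]"] in \<open>simp_all add: pureC_in_tensC\<close>)
qed

lemma delta_left_diff:
  assumes "D' \<in> CochC E n" "D'' \<in> CochC E 2"
  shows "D \<in> CochC E n \<Longrightarrow> delta_left E (D' - D) D'' c = delta_left E D' D'' c - delta_left E D D'' c"
    "delta_left E D' (D'' - F) c = delta_left E D' D'' c - delta_left E D' F c"
proof -
  show "delta_left E (D' - D) D'' c = delta_left E D' D'' c - delta_left E D D'' c"
    if "D \<in> CochC E n"
    unfolding delta_left_def
    by (subst sweedlerC_diff[OF cochD(2)[OF assms(2)] delta_left_mlin[OF assms(1)]
          delta_left_mlin[OF that], symmetric]) (simp add: minus_apply sweedler_diff_left)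
qed (simp add: delta_left_def minus_apply sweedler_diff_left)

lemma delta_right_diff:
  assumes "D' \<in> CochC E n" "D'' \<in> CochC E 2"
  shows "D \<in> CochC E n \<Longrightarrow> delta_right E (D' - D) D'' c = delta_right E D' D'' c - delta_right E D D'' c"
    "delta_right E D' (D'' - F) c = delta_right E D' D'' c - delta_right E D' F c"
proof -
  show "delta_right E (D' - D) D'' c = delta_right E D' D'' c - delta_right E D D'' c"
    if "D \<in> CochC E n"
    unfolding delta_right_def
    by (subst sweedlerC_diff[OF cochD(2)[OF assms(2)] delta_right_mlin[OF assms(1)]
          delta_right_mlin[OF that], symmetric]) (simp add: minus_apply sweedler_diff_left)
qed (simp add: delta_right_def minus_apply sweedler_diff_left)


section \<open>The differentials in low degrees\<close>

lemma tscale_minus_one [simp]: "tscale (- 1) x = - x" and tscale_one [simp]: "tscale 1 x = x"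
  by (simp_all add: tens.scale_minus_left)

lemma scaleA_minus_one [simp]: "scaleA E (- 1) x = - x" and scaleA_one [simp]: "scaleA E 1 x = x"
proof -
  interpret vector_space "scaleA E" by (rule vsA)
  show "scaleA E (- 1) x = - x" "scaleA E 1 x = x" by simp_all
qed

text \<open>The scalar is treated as a linear parameter of the integrand: a linear map on k takes at
  \<open>r\<close> the value \<open>r\<close> times its value at 1.\<close>

lemma sweedlerAC_scale:
  assumes "x \<in> tensAC sA sC n" "mlinAC sA sC n tscale G"
  shows "sweedler x (\<lambda>g. tscale r (G g)) = tscale r (sweedler x G)"
proof -
  have "Vector_Spaces.linear (*) tscale (\<lambda>u. sweedler x (\<lambda>g. tscale u (G g)))"
    by (rule linear_sweedlerAC[OF assms(1) vector_space_mult])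
      (auto intro: mlinAC_comp[OF assms(2)] linear_scale_const[OF linear_ident] vector_space_tscale
        simp: Vector_Spaces.linear_iff vector_space_mult tens.scale_left_distrib)
  then show ?thesis
    by (metis (no_types, lifting) Vector_Spaces.linear_iff mult.right_neutral sweedler_linear(2) tens.scale_one ext)
qed

section \<open>The bimodule structure and the explicit horizontal and vertical differentials\<close>

lemma lact_mlin: "mlinAC (scaleA E) (scaleC E) n tscale (\<lambda>(a, cs). tAC E (a' * a, cs))"
  using mlinAC_tAC[OF linear_mult_left, where xs = "[]" and ys = "[]"] by simp

lemma lact_tAC: "lact E a' (tAC E (a, cs)) = tAC E (a' * a, cs)"
  unfolding lact_def by (subst sweedler_pureAC[OF lact_mlin]) simp

lemma lact_one: "x \<in> TAC n \<Longrightarrow> lact E 1 x = x"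
  using tAC_id by (simp add: lact_def)

lemma lact_sweedler: "lact E a (sweedler x G) = sweedler x (\<lambda>g. lact E a (G g))"
  by (simp add: lact_def sweedler_assoc)

lemma lact_linear_a:
  assumes "x \<in> TAC n"
  shows "linAT E (\<lambda>a. lact E a x)"
  unfolding lact_def
  by (rule linear_sweedlerAC[OF assms vsA lact_mlin]) (simp add: linear_tAC_A linear_mult_right)

lemma lact_lact: "lact E a (lact E a' x) = lact E (a * a') x"
proof -
  have "(\<lambda>g. lact E a (case g of (x, cs) \<Rightarrow> tAC E (a' * x, cs))) = (\<lambda>(x, cs). tAC E (a * a' * x, cs))"
    by (auto simp: lact_tAC mult.assoc)
  then show ?thesis unfolding lact_def[of E a'] lact_sweedler by (simp add: lact_def)
qed

lemma move_in: "move E cs a \<in> TAC (length cs)"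
  by (induction cs) (auto intro: pureAC_in_tensAC psi_on_in[OF psi_hom])

text \<open>Induction over the entries before the varying one: at that entry \<open>psi_on\<close>
  is linear in its C-argument, and each further passage is linear in the tensor already
  produced.\<close>

lemma move_mlin: "mlinC (scaleC E) n tscale (\<lambda>cs. move E cs a)"
  unfolding mlinC_def
proof (intro allI impI)
  fix xs ys :: "'c list"
  show "linCT E (\<lambda>x. move E (xs @ x # ys) a)"
    by (induction xs) (simp_all add: psi_on_linear_c[OF psi_hom move_in] psi_on_linear_x)
qed

lemma ract_tAC: "ract E (tAC E (a, cs)) a'' = lact E a (move E cs a'')"
proof -
  have "mlinC (scaleC E) (length cs) tscale (\<lambda>cs. lact E a (move E cs a''))" for a
    unfolding mlinC_def lact_def
    using move_mlin[of "length cs" a'', unfolded mlinC_def] linear_sweedler_arg by blast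
  then have "mlinAC (scaleA E) (scaleC E) (length cs) tscale (\<lambda>(a, cs). lact E a (move E cs a''))"
    by (simp add: mlinAC_def lact_linear_a[OF move_in])
  then show ?thesis unfolding ract_def by (subst sweedler_pureAC) simp_all
qed

lemma move_single: "move E [c] a = psi E c a"
  by (simp add: psi_on_tAC_Nil[OF psi_hom])

text \<open>For \<open>m = 0\<close> the sum over merges and both products over B are empty, and
  \<open>jbar\<close> puts 1 into A. Only the two outer actions survive: the left one multiplies 1
  by the entry, the right one is \<open>move\<close>.\<close>

lemma hdiff_jbar:
  assumes "g \<in> CochC E n"
  shows "hdiff E 0 (jbar E g) c a b =
    delta_at E 1 g (psi E c (a 1)) - sweedler (g c) (\<lambda>cs. move E cs (a 1))"
proof -
  have "lact E x (sweedler (g d) (\<lambda>cs. tAC E (1, cs))) = sweedler (g d) (\<lambda>cs. tAC E (x, cs))" for x d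
    by (simp add: lact_sweedler lact_tAC)
  moreover have "ract E (sweedler (g c) (\<lambda>cs. tAC E (1, cs))) (a 1) =
      sweedler (g c) (\<lambda>cs. lact E 1 (move E cs (a 1)))"
    unfolding ract_def sweedler_assoc unfolding ract_def[symmetric] ract_tAC by simp
  moreover have "lact E 1 (sweedler (g c) (\<lambda>cs. lact E 1 (move E cs (a 1)))) =
      sweedler (g c) (\<lambda>cs. move E cs (a 1))"
    by (simp add: lact_sweedler lact_one[OF move_in])
  ultimately show ?thesis
    unfolding delta_at_1[OF homD(3)[OF psi_hom]]
    by (simp add: hdiff_def jbar_def)
qed

lemma sweedler_move_2:
  assumes "D \<in> CochC E 2"
  shows "sweedler (D c) (\<lambda>cs. move E cs a) = psi_psi_delta E (psi E) (psi E) D c a"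
  unfolding psi_psi_delta_def
proof (rule sweedlerC_cong[OF cochD(2)[OF assms]])
  fix cs :: "'c list"
  assume "length cs = 2"
  then obtain c d where "cs = [c, d]" by (auto simp: numeral_2_eq_2 length_Suc_conv)
  then show "move E cs a = psi_on E (psi E) (cs ! 0) (psi E (cs ! 1) a)"
    by (simp add: psi_on_tAC_Nil[OF psi_hom])
qed

lemma snocAC_mlin:
  "mlinAC (scaleA E) (scaleC E) n tscale (\<lambda>(a, cs). tAC E (a, cs @ [c]))"
  using mlinAC_tAC[OF linear_ident[OF vsA], where xs = "[]" and ys = "[c]"] by simp

lemma snocAC_tAC: "snocAC E (tAC E (a, cs)) c = tAC E (a, cs @ [c])"
  unfolding snocAC_def by (subst sweedler_pureAC[OF snocAC_mlin]) simp

text \<open>The three summands are the three places of the compatibility with the coproduct in which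
  \<psi> can stand. In the last one, \<open>psi_on\<close> puts its new C-factor in front of the
  existing factors, which agrees with appending the passed element by \<open>snocAC\<close>.\<close>

lemma vdiff_1_1:
  assumes "\<psi> \<in> hom_CA_AC E"
  shows "vdiff E 1 1 (\<lambda>c a b. \<psi> c (a 1)) c a b =
    psi_psi_delta E (psi E) \<psi> (Delta E) c (a (1::nat)) - delta_at E 1 (Delta E) (\<psi> c (a 1))
    + psi_psi_delta E \<psi> (psi E) (Delta E) c (a 1)"
proof -
  have "sweedler (psi E d x) (\<lambda>(x, cs). snocAC E (\<psi> c x) (cs ! 0)) =
      psi_on E \<psi> c (psi E d x)" for c d x
    unfolding psi_on_def
  proof (rule sweedlerAC_cong[OF homD(3)[OF psi_hom]])
    fix y and cs :: "'c list"
    assume "length cs = 1"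
    then obtain e where "cs = [e]" by (auto simp: length_Suc_conv)
    then show "(case (y, cs) of (x, cs) \<Rightarrow> snocAC E (\<psi> c x) (cs ! 0)) =
        (case (y, cs) of (a, cs) \<Rightarrow> sweedler (\<psi> c a) (\<lambda>(a', ds). tAC E (a', ds @ cs)))"
      by (simp add: snocAC_def)
  qed
  then show ?thesis by (simp add: vdiff_def psi_psi_delta_def)
qed

text \<open>The left action lets \<open>psi E\<close> pass \<open>a 1\<close> before \<psi> meets
  \<open>a 2\<close>; the right action does the reverse, since \<open>move\<close> past a single
  factor is \<open>psi E\<close>. So both outer terms are \<open>mu_psi_psi\<close> with exchanged
  maps.\<close>

lemma hdiff_1:
  assumes "\<psi> \<in> hom_CA_AC E"
  shows "hdiff E 1 (\<lambda>c (a :: nat \<Rightarrow> 'a) (b :: nat \<Rightarrow> nat \<Rightarrow> 'b). \<psi> c (a 1)) c a b =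
    mu_psi_psi E (\<lambda>x y. zeta E (b 1 2) * x * y) \<psi> (psi E) c (a 1) (a 2)
    - \<psi> c (zeta E (b 1 2) * a 1 * a 2)
    + mu_psi_psi E (\<lambda>x y. zeta E (b 1 2) * x * y) (psi E) \<psi> c (a 1) (a 2)"
proof -
  have "lact E (zeta E (b 1 2)) (ract E (\<psi> c (a 1)) (a 2)) =
      mu_psi_psi E (\<lambda>x y. zeta E (b 1 2) * x * y) (psi E) \<psi> c (a 1) (a 2)"
    unfolding ract_def mu_psi_psi_def lact_sweedler
  proof (rule sweedlerAC_cong[OF homD(3)[OF assms]])
    fix y and cs :: "'c list"
    assume "length cs = 1"
    then obtain e where "cs = [e]" by (auto simp: length_Suc_conv)
    then show "lact E (zeta E (b 1 2)) (case (y, cs) of (z, cs) \<Rightarrow> lact E z (move E cs (a 2))) =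
        (case (y, cs) of (x', cs) \<Rightarrow> sweedler (psi E (cs ! 0) (a 2))
          (\<lambda>(y', ds). tAC E (zeta E (b 1 2) * x' * y', ds)))"
      by (simp add: move_single lact_lact del: move.simps) (simp add: lact_def)
  qed
  then show ?thesis
    by (simp add: hdiff_def mu_psi_psi_def shiftA_def lact_def mergeA_def numeral_2_eq_2)
qed

section \<open>The row n = 0: contraction by the counit\<close>

lemma counit:
  "sweedler (Delta E c) (\<lambda>cs. tC E [scaleC E (eps E (cs ! 0)) (cs ! 1)]) = tC E [c]"
  "sweedler (Delta E c) (\<lambda>cs. tC E [scaleC E (eps E (cs ! 1)) (cs ! 0)]) = tC E [c]"
  using coalg unfolding coalgebra_def by blast+

lemma sweedler_tC_1: "linCT E h \<Longrightarrow> sweedler (tC E [c]) (\<lambda>cs. h (cs ! 0)) = h c"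
  by (subst sweedler_pureC) (simp_all add: mlinC_1)

lemma linear_scale_eq: "Vector_Spaces.linear s t f \<Longrightarrow> f (s r x) = t r (f x)"
  by (simp add: Vector_Spaces.linear_iff)

text \<open>The counit axioms are equations between tensors of length one; applying the linear
  extension of \<open>h\<close> to both sides turns them into equations for
  \<open>h\<close>.\<close>

lemma counit_linear:
  assumes "linCT E h"
  shows "sweedler (Delta E c) (\<lambda>cs. h (scaleC E (eps E (cs ! 0)) (cs ! 1))) = h c"
    "sweedler (Delta E c) (\<lambda>cs. h (scaleC E (eps E (cs ! 1)) (cs ! 0))) = h c"
  using arg_cong[OF counit(1)[of c], of "\<lambda>x. sweedler x (\<lambda>cs. h (cs ! 0))"]
    arg_cong[OF counit(2)[of c], of "\<lambda>x. sweedler x (\<lambda>cs. h (cs ! 0))"]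
  by (simp_all add: sweedler_assoc sweedler_tC_1[OF assms])

text \<open>The scalar \<open>eps\<close> of the second leg is moved onto the first leg inside
  \<open>psi E\<close>, where the counit axiom absorbs it. The number of entries read by
  \<open>f\<close> does not matter.\<close>

lemma vdiff_jmap_left:
  "sweedler (Delta E c) (\<lambda>cs. psi_on E (psi E) (cs ! 0) (jmap E f (cs ! 1) a b)) = psi E c (f a b)"
proof -
  have "psi_on E (psi E) d (jmap E f e a b) = psi E (scaleC E (eps E e) d) (f a b)" for d e
    by (simp add: jmap_def psi_on_tAC_Nil[OF psi_hom] linear_scale_eq[OF homD(1)[OF psi_hom]]
        linear_scale_eq[OF homD(2)[OF psi_hom]])
  then show ?thesis by (simp add: counit_linear(2)[OF homD(1)[OF psi_hom], unfolded One_nat_def])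
qed

lemma tAC_scale: "tAC E (scaleA E r y, cs) = tscale r (tAC E (y, cs))"
  by (rule linear_scale_eq[of _ _ "\<lambda>y. tAC E (y, cs)", OF linear_tAC_A[OF linear_ident[OF vsA]]])

lemma snoc_jmap: "snocAC E (jmap E f d a b) c = tscale (eps E d) (tAC E (f a b, [c]))"
  by (simp only: jmap_def tAC_scale snocAC_def sweedler_linear)
    (simp only: snocAC_tAC append_Nil flip: snocAC_def)

lemma mlinAC_last:
  assumes "linAA E \<alpha>" "linCC E \<gamma>"
  shows "mlinAC (scaleA E) (scaleC E) 1 tscale (\<lambda>(x, cs). tAC E (\<alpha> x, [\<gamma> (cs ! 0)]))"
  using linear_tAC_A[OF assms(1)] linear_tAC_C[OF assms(2), of _ "[]" "[]"]
  by (simp add: mlinAC_1)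

lemma vdiff_1_0:
  assumes "linAA E \<alpha>"
  shows "vdiff E 1 0 (jmap E (\<lambda>a b. \<alpha> (a 1))) c a b =
    psi E c (\<alpha> (a 1)) - sweedler (psi E c (a 1)) (\<lambda>(x, cs). tAC E (\<alpha> x, [cs ! 0]))"
proof -
  let ?h = "\<lambda>d. sweedler (psi E d (a 1)) (\<lambda>(x, cs). tAC E (\<alpha> x, [cs ! 0]))"
  have lin: "linCT E ?h"
    by (rule linear_sweedler_arg[OF homD(1)[OF psi_hom]])
  \<comment> \<open>In the right coaction term the counit hits the first leg \<open>d\<close>. Its
    value is pulled out of the tensor and put back as a factor of \<open>e\<close>, the shape that
    \<open>counit_linear\<close> removes.\<close>
  have "sweedler (psi E e (a 1)) (\<lambda>(x, cs). snocAC E (jmap E (\<lambda>a b. \<alpha> (a 1)) d (a(1 := x)) b) (cs ! 0))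
      = ?h (scaleC E (eps E d) e)" for d e
    unfolding linear_scale_eq[OF lin]
    using sweedlerAC_scale[OF homD(3)[OF psi_hom] mlinAC_last[OF assms linear_ident[OF vsC]]]
    by (simp add: snoc_jmap split_def)
  then show ?thesis
    unfolding vdiff_def vdiff_jmap_left
    by (simp add: counit_linear(1)[OF lin, unfolded One_nat_def])
qed

lemma vdiff_2_0:
  assumes "\<And>b y. linAA E (\<lambda>x. \<mu> x y b)" "\<And>b x. linAA E (\<lambda>y. \<mu> x y b)"
  shows "vdiff E 2 0 (jmap E (\<lambda>a (b :: nat \<Rightarrow> nat \<Rightarrow> 'b). \<mu> (a 1) (a 2) (b 1 2))) c a b =
    psi E c (\<mu> (a 1) (a 2) (b 1 2))
    - mu_psi_psi E (\<lambda>x y. \<mu> x y (b 1 2)) (psi E) (psi E) c (a 1) (a 2)"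
proof -
  let ?m = "\<lambda>x y. \<mu> x y (b 1 2)" and ?f = "\<lambda>a (b :: nat \<Rightarrow> nat \<Rightarrow> 'b). \<mu> (a 1) (a 2) (b 1 2)"
  let ?h = "\<lambda>d. mu_psi_psi E ?m (psi E) (psi E) d (a 1) (a 2)"
  have lin: "linCT E ?h"
    by (rule mu_psi_psi_linear_c[OF psi_hom])
  \<comment> \<open>The scalar has to leave the nested expression from the inside outwards, because
    each extraction uses multilinearity of what is left; this is the inner passage, past
    \<open>a 2\<close>.\<close>
  have 1: "sweedler (psi E e (a 2))
      (\<lambda>(y, es). snocAC E (jmap E ?f d (a(1 := x, 2 := y)) b) (es ! 0)) =
      tscale (eps E d) (sweedler (psi E e (a 2)) (\<lambda>(y, es). tAC E (\<mu> x y (b 1 2), es)))" for d e x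
  proof -
    have "sweedler (psi E e (a 2)) (\<lambda>(y, es). snocAC E (jmap E ?f d (a(1 := x, 2 := y)) b) (es ! 0)) =
        sweedler (psi E e (a 2)) (\<lambda>g. tscale (eps E d) (case g of (y, es) \<Rightarrow> tAC E (\<mu> x y (b 1 2), es)))"
      by (rule sweedlerAC_cong[OF homD(3)[OF psi_hom]]) (auto simp: snoc_jmap length_Suc_conv)
    also have "\<dots> = tscale (eps E d) (sweedler (psi E e (a 2)) (\<lambda>(y, es). tAC E (\<mu> x y (b 1 2), es)))"
      by (rule sweedlerAC_scale[OF homD(3)[OF psi_hom] bilin_mlin[OF assms(2)]])
    finally show ?thesis .
  qed
  have "sweedler (psi E e (a 1)) (\<lambda>(x, ds). sweedler (psi E (ds ! 0) (a 2))
        (\<lambda>(y, es). snocAC E (jmap E ?f d (a(1 := x, 2 := y)) b) (es ! 0)))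
      = ?h (scaleC E (eps E d) e)" for d e
    unfolding 1 linear_scale_eq[OF lin]
    using sweedlerAC_scale[OF homD(3)[OF psi_hom] mu_psi_psi_mlin[OF psi_hom assms]]
    by (simp add: split_def mu_psi_psi_def)
  moreover have "[1..<2 + 1] = [1, 2 :: nat]"
    by (simp add: upt_rec)
  ultimately show ?thesis
    unfolding vdiff_def vdiff_jmap_left
    by (simp add: counit_linear(1)[OF lin, unfolded One_nat_def] del: upt_Suc)
qed

lemma vdiffC_2:
  assumes "D \<in> CochC E 2"
  shows "vdiffC E 2 D c = delta_right E D (Delta E) c - delta_left E (Delta E) D c
    + delta_right E (Delta E) D c - delta_left E D (Delta E) c"
proof -
  have "delta_atC E 1 (Delta E) (D c) = delta_left E (Delta E) D c"
    unfolding delta_atC_def delta_left_def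
    by (rule sweedlerC_cong[OF cochD(2)[OF assms]])
      (auto simp: numeral_2_eq_2 length_Suc_conv)
  moreover have "delta_atC E 2 (Delta E) (D c) = delta_right E (Delta E) D c"
    unfolding delta_atC_def delta_right_def
    by (rule sweedlerC_cong[OF cochD(2)[OF assms]])
      (auto simp: numeral_2_eq_2 length_Suc_conv)
  moreover have "{1..2::nat} = {1, 2}" by auto
  ultimately show ?thesis
    by (simp add: vdiffC_def consC_def snocC_def flip: delta_left_def delta_right_def)
      (simp add: delta_left_def delta_right_def)
qed

lemma hdiffA_2:
  "hdiffA E 2 (\<lambda>a b. \<mu> (a 1) (a 2) (b 1 2)) a b =
    zeta E (b 1 2 * b 1 3) * a 1 * \<mu> (a 2) (a 3) (b 2 3)
    - \<mu> (zeta E (b 1 2) * a 1 * a 2) (a 3) (b 1 3 * b 2 3)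
    + \<mu> (a 1) (zeta E (b 2 3) * a 2 * a 3) (b 1 2 * b 1 3)
    - zeta E (b 1 3 * b 2 3) * \<mu> (a 1) (a 2) (b 1 2) * a 3"
proof -
  have sets: "{1..2::nat} = {1, 2}" "{2..2 + 1::nat} = {2, 3}" by auto
  show ?thesis
    by (simp add: hdiffA_def sets shiftA_def shiftB_def mergeA_def mergeB_def
        numeral_2_eq_2 numeral_3_eq_3)
qed

lemma hdiffA_1:
  "hdiffA E 1 (\<lambda>a b. \<alpha> (a 1)) a b =
    zeta E (b 1 2) * a 1 * \<alpha> (a 2) - \<alpha> (zeta E (b 1 2) * a 1 * a 2) + zeta E (b 1 2) * \<alpha> (a 1) * a 2"
  by (simp add: hdiffA_def shiftA_def mergeA_def numeral_2_eq_2)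

lemma coch_tC:
  assumes "linCC E \<gamma>"
  shows "(\<lambda>c. tC E [\<gamma> c]) \<in> CochC E 1"
  using linear_tC[OF assms, of "[]" "[]"] by (simp add: CochC_def pureC_in_tensC)

lemma vdiffC_1:
  assumes "linCC E \<gamma>"
  shows "vdiffC E 1 (\<lambda>c. tC E [\<gamma> c]) c =
    sweedler (Delta E c) (\<lambda>cs. tC E [cs ! 0, \<gamma> (cs ! 1)]) - Delta E (\<gamma> c)
    + sweedler (Delta E c) (\<lambda>cs. tC E [\<gamma> (cs ! 0), cs ! 1])"
proof -
  have "mlinC (scaleC E) (length [d]) tscale (\<lambda>cs. tC E (c # cs))"
    "mlinC (scaleC E) (length [d]) tscale (\<lambda>cs. tC E (cs @ [c]))" for c d
    using mlinC_tC[of 1 "[c]" "[]"] mlinC_tC[of 1 "[]" "[c]"] by simp_all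
  then have *: "consC E c (tC E [d]) = tC E [c, d]" "snocC E (tC E [d]) c = tC E [d, c]" for c d
    by (simp_all add: consC_def snocC_def sweedler_pureC)
  have "linCT E (\<lambda>c. sweedler (Delta E c) (tC E))"
    by (rule linear_sweedler_arg[OF cochD(1)[OF Delta_coch]])
  then have "delta_atC E 1 (Delta E) (tC E [d]) = sweedler (Delta E d) (tC E)" for d
    by (simp add: delta_atC_def sweedler_pureC mlinC_1)
  then have "delta_atC E 1 (Delta E) (tC E [d]) = Delta E d" for d
    by (simp add: sweedler_ident_C[OF cochD(2)[OF Delta_coch] vsC])
  then show ?thesis by (simp add: vdiffC_def *)
qed


section \<open>Cochains of total degree one and two\<close>

text \<open>The component at \<open>m = 1\<close> ignores the B-entries, since a tensor matrix of
  size 1 has none. \<open>inf_cochain\<close> is the case of the coefficients of index 1.\<close>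

definition coch2 where
  "coch2 \<mu> \<psi> D = ((\<lambda>a b. \<mu> (a 1) (a 2) (b 1 2)) :: (nat \<Rightarrow> 'a) \<Rightarrow> (nat \<Rightarrow> nat \<Rightarrow> 'b) \<Rightarrow> 'a,
     (\<lambda>m. if m = 1 then \<lambda>c a b. \<psi> c (a 1) else 0)
       :: nat \<Rightarrow> 'c \<Rightarrow> (nat \<Rightarrow> 'a) \<Rightarrow> (nat \<Rightarrow> nat \<Rightarrow> 'b) \<Rightarrow> ('a \<times> 'c list, 'k) tens,
     D :: 'c \<Rightarrow> ('c list, 'k) tens)"

text \<open>No bidegree (m, n) with m, n > 0 has total degree 1, so the middle family is 0. The
  component in Hom(C, C) takes values in tensors of length one, hence the embedding of \<gamma> by
  \<open>tC\<close>.\<close>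

definition coch1 where
  "coch1 \<alpha> \<gamma> = ((\<lambda>a b. \<alpha> (a 1)) :: (nat \<Rightarrow> 'a) \<Rightarrow> (nat \<Rightarrow> nat \<Rightarrow> 'b) \<Rightarrow> 'a,
     0 :: nat \<Rightarrow> 'c \<Rightarrow> (nat \<Rightarrow> 'a) \<Rightarrow> (nat \<Rightarrow> nat \<Rightarrow> 'b) \<Rightarrow> ('a \<times> 'c list, 'k) tens,
     \<lambda>c. tC E [\<gamma> c])"

lemma muD:
  assumes "\<mu> \<in> hom_AAB_A E"
  shows "linAA E (\<lambda>x. \<mu> x y b)" "linAA E (\<lambda>y. \<mu> x y b)" "linBA E (\<lambda>b. \<mu> x y b)"
  using assms by (auto simp: hom_AAB_A_def)

lemma mu_diff:
  assumes "\<mu> \<in> hom_AAB_A E" "\<mu>' \<in> hom_AAB_A E"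
  shows "\<mu> - \<mu>' \<in> hom_AAB_A E"
  using linear_diff[OF muD(1)[OF assms(1)] muD(1)[OF assms(2)]]
    linear_diff[OF muD(2)[OF assms(1)] muD(2)[OF assms(2)]]
    linear_diff[OF muD(3)[OF assms(1)] muD(3)[OF assms(2)]]
  by (simp add: hom_AAB_A_def minus_apply fun_diff_def[of "\<mu> _ _"])

lemma coch2_diff: "coch2 (\<mu> - \<mu>') (\<psi> - \<psi>') (D - D') = coch2 \<mu> \<psi> D - coch2 \<mu>' \<psi>' D'"
  by (auto simp: coch2_def fun_eq_iff minus_apply zero_fun_apply)

lemma tC_diff: "tC E [x - y] = tC E [x] - tC E [y]"
proof -
  have "linCT E (\<lambda>x. tC E [x])"
    using linear_tC[OF linear_ident[OF vsC], of "[]" "[]"] by simp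
  then interpret Vector_Spaces.linear "scaleC E" tscale "\<lambda>x. tC E [x]" .
  show ?thesis by (rule diff)
qed

lemma coch1_diff: "coch1 (\<alpha> - \<alpha>') (\<gamma> - \<gamma>') = coch1 \<alpha> \<gamma> - coch1 \<alpha>' \<gamma>'"
  by (simp add: coch1_def tC_diff fun_eq_iff minus_apply)

lemma coch2_in_Tot:
  assumes "\<mu> \<in> hom_AAB_A E" "\<psi> \<in> hom_CA_AC E" "D \<in> CochC E 2"
  shows "coch2 \<mu> \<psi> D \<in> Tot E 2"
proof -
  have 1: "i = Suc 0 \<or> i = 2" if "Suc 0 \<le> i" "i \<le> 2" for i using that by auto
  have 2: "i = 1 \<and> j = 2" if "1 \<le> i \<and> i < j \<and> j \<le> 2" for i j :: nat using that by auto
  have "(\<lambda>a b. \<mu> (a 1) (a 2) (b 1 2)) \<in> CochA E 2"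
    unfolding CochA_def same_entries_def
    using muD[OF assms(1)] by (auto dest!: 1 2)
  moreover have "(\<lambda>c a b. \<psi> c (a 1)) \<in> CochAC E 1 1"
    using homD[OF assms(2)] linear_zero_fun[OF vsB vector_space_tscale]
    by (auto simp: CochAC_def same_entries_def)
  ultimately show ?thesis
    using assms(3) by (auto simp: Tot_def coch2_def less_2_cases_iff)
qed

lemma Tot_2E:
  assumes "x \<in> Tot E 2"
  obtains \<mu> \<psi> D where "\<mu> \<in> hom_AAB_A E" "\<psi> \<in> hom_CA_AC E" "D \<in> CochC E 2" "x = coch2 \<mu> \<psi> D"
proof -
  obtain f F D where x: "x = (f, F, D)" by (cases x)
  have f: "f \<in> CochA E 2" and D: "D \<in> CochC E 2"
    and Fm: "if 0 < m \<and> m < 2 then F m \<in> CochAC E m (2 - m) else F m = 0" for m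
    using assms by (auto simp: x Tot_def)
  have F1: "F 1 \<in> CochAC E 1 1" using Fm[of 1] by simp
  have F0: "F m = 0" if "m \<noteq> 1" for m
    using Fm[of m] that by (auto split: if_splits)
  \<comment> \<open>A cochain reads only the entries inside its array. The constant functions fill
    in those entries, and their values at all other positions have no influence on
    \<open>f\<close>.\<close>
  define \<mu> where "\<mu> = (\<lambda>x y b. f ((\<lambda>_. y)(1 := x)) (\<lambda>_ _. b))"
  define \<psi> where "\<psi> = (\<lambda>c x. F 1 c (\<lambda>_. x) (\<lambda>_ _. 0))"
  have f_cong: "f a b = f a' b'" if "a 1 = a' 1" "a 2 = a' 2" "b 1 2 = b' 1 2" for a b a' b'
  proof -
    have "same_entries 2 a b a' b'"
      unfolding same_entries_def using that
      by (auto simp: numeral_2_eq_2 le_Suc_eq less_Suc_eq)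
    then show ?thesis using f by (auto simp: CochA_def)
  qed
  have f\<mu>: "f = (\<lambda>a b. \<mu> (a 1) (a 2) (b 1 2))"
    unfolding \<mu>_def by (intro ext f_cong) auto
  have F_cong: "F 1 c a b = F 1 c a' b'" if "a 1 = a' 1" for c a b a' b'
  proof -
    have "same_entries 1 a b a' b'" using that by (auto simp: same_entries_def)
    then show ?thesis using F1 unfolding CochAC_def by blast
  qed
  have F\<psi>: "F = (\<lambda>m. if m = 1 then \<lambda>c a b. \<psi> c (a 1) else 0)"
  proof (rule ext)
    show "F m = (if m = 1 then \<lambda>c a b. \<psi> c (a 1) else 0)" for m
      unfolding \<psi>_def using F0[of m] by (auto intro!: ext fun_cong[OF F_cong[unfolded One_nat_def]])
  qed
  have lA: "linAA E (\<lambda>x. f (a(i := x)) b)" if "i \<in> {1..2}" for a b i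
    using f that unfolding CochA_def by blast
  have fA: "linAA E (\<lambda>x. \<mu> x y b)" "linAA E (\<lambda>y. \<mu> x y b)" for x y b
  proof -
    have "linAA E (\<lambda>x. f ((\<lambda>_. y)(1 := x)) (\<lambda>_ _. b))" for y b
      by (rule lA) simp
    then show "linAA E (\<lambda>x. \<mu> x y b)" for y b by (simp add: f\<mu>)
    have "linAA E (\<lambda>y. f ((\<lambda>_. x)(2 := y)) (\<lambda>_ _. b))" for x b
      by (rule lA) simp
    then show "linAA E (\<lambda>y. \<mu> x y b)" for x b by (simp add: f\<mu>)
  qed
  have "linBA E (\<lambda>x. f a (b(i := (b i)(j := x))))" if "1 \<le> i \<and> i < j \<and> j \<le> 2" for a b i j
    using f that unfolding CochA_def by blast
  from this[of 1 2 "\<lambda>i. if i = 1 then _ else _"] have fB: "linBA E (\<lambda>b. \<mu> x y b)" for x y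
    unfolding f\<mu> by simp
  have "\<psi> \<in> hom_CA_AC E"
  proof -
    have "linCT E (\<lambda>c. F 1 c (\<lambda>_. x) (\<lambda>_ _. 0))" "F 1 c (\<lambda>_. x) (\<lambda>_ _. 0) \<in> TAC 1"
      "linAT E (\<lambda>x. F 1 c (a(1 := x)) b)" for a b c x
      using F1 unfolding CochAC_def by auto
    then show ?thesis
      unfolding F\<psi> hom_CA_AC_def by simp
  qed
  moreover have "\<mu> \<in> hom_AAB_A E" using fA fB by (simp add: hom_AAB_A_def)
  ultimately show thesis
    using that D x f\<mu> F\<psi> by (simp add: coch2_def)
qed

text \<open>The linear map from C to tensors of length one has an image closed under the span
  operations, so a span of pure tensors contains only pure tensors here. With injectivity below,
  this identifies C with its first tensor power.\<close>

lemma TC1_E: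
  assumes "x \<in> TC 1"
  obtains c where "x = tC E [c]"
proof -
  have lin: "linCT E (\<lambda>x. tC E [x])"
    using linear_tC[OF linear_ident[OF vsC], of "[]" "[]"] by simp
  then interpret Vector_Spaces.linear "scaleC E" tscale "\<lambda>x. tC E [x]" .
  have "\<exists>c. x = tC E [c]"
    using assms unfolding tensC_def
  proof (induction rule: tens.span_induct_alt)
    case base
    show ?case using zero by metis
  next
    case (step r x y)
    then obtain c d where "x = tC E [c]" "y = tC E [d]" by (auto simp: length_Suc_conv)
    then have "tscale r x + y = tC E [scaleC E r c + d]" by (simp add: add scale)
    then show ?case by blast
  qed
  then show thesis using that by blast
qed

text \<open>A linear functional separating \<open>c\<close> from \<open>d\<close> is, read on lists
  of length one, a multilinear form, and so it also separates the two pure tensors.\<close>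

lemma tC_inject: "tC E [c] = tC E [d] \<longleftrightarrow> c = d"
proof
  assume eq: "tC E [c] = tC E [d]"
  show "c = d"
  proof (rule ccontr)
    assume "c \<noteq> d"
    then obtain l where l: "Vector_Spaces.linear (scaleC E) (*) l" "l (c - d) = 1"
      using exists_functional[OF vsC, of "c - d"] by auto
    interpret Vector_Spaces.linear "scaleC E" "(*)" l by (rule l(1))
    have "mlinC (scaleC E) (Suc 0) (*) (\<lambda>cs. l (cs ! 0))" using l(1) by (simp add: mlinC_1)
    then have "l c = l d"
      using fun_cong[OF eq, of "\<lambda>cs. l (cs ! 0)"] by (simp add: pureC_def evalt_def)
    then show False using l(2) by (simp add: diff)
  qed
qed simp

lemma coch1_in_Tot:
  assumes "linAA E \<alpha>" "linCC E \<gamma>"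
  shows "coch1 \<alpha> \<gamma> \<in> Tot E 1"
proof -
  have "(\<lambda>a b. \<alpha> (a 1)) \<in> CochA E 1"
    using assms(1) by (auto simp: CochA_def same_entries_def)
  then show ?thesis
    using coch_tC[OF assms(2)] by (auto simp: Tot_def coch1_def zero_fun_apply)
qed

lemma Tot_1E:
  assumes "x \<in> Tot E 1"
  obtains \<alpha> \<gamma> where "linAA E \<alpha>" "linCC E \<gamma>" "x = coch1 \<alpha> \<gamma>"
proof -
  obtain f F g where x: "x = (f, F, g)" by (cases x)
  have f: "f \<in> CochA E 1" and g: "g \<in> CochC E 1"
    and Fm: "if 0 < m \<and> m < 1 then F m \<in> CochAC E m (1 - m) else F m = 0" for m
    using assms by (auto simp: x Tot_def)
  have F: "F = 0"
  proof (rule ext)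
    fix m :: nat
    have "\<not> (0 < m \<and> m < 1)" by linarith
    with Fm[of m] show "F m = 0 m" by (simp only: if_False zero_fun_apply)
  qed
  define \<alpha> where "\<alpha> = (\<lambda>x. f (\<lambda>_. x) (\<lambda>_ _. 0))"
  have f\<alpha>: "f = (\<lambda>a b. \<alpha> (a 1))"
  proof (intro ext)
    fix a :: "nat \<Rightarrow> 'a" and b :: "nat \<Rightarrow> nat \<Rightarrow> 'b"
    have "same_entries 1 a b (\<lambda>_. a 1) (\<lambda>_ _. 0)" by (auto simp: same_entries_def)
    then show "f a b = \<alpha> (a 1)" using f unfolding \<alpha>_def CochA_def by blast
  qed
  have "linAA E (\<lambda>x. f (a(1 := x)) b)" for a b
  proof -
    have "\<forall>i\<in>{1..1}. linAA E (\<lambda>x. f (a(i := x)) b)"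
      using f unfolding CochA_def by blast
    then show ?thesis by simp
  qed
  then have \<alpha>: "linAA E \<alpha>" unfolding f\<alpha> by simp
  have "\<forall>c. \<exists>d. g c = tC E [d]"
    using cochD(2)[OF g] TC1_E by metis
  then obtain \<gamma> where \<gamma>: "g c = tC E [\<gamma> c]" for c by metis
  have lin: "linCT E (\<lambda>x. tC E [x])"
    using linear_tC[OF linear_ident[OF vsC], of "[]" "[]"] by simp
  \<comment> \<open>The map \<gamma> was only chosen pointwise; its linearity is that of
    \<open>g\<close>, pulled back along the injective embedding of C.\<close>
  have \<gamma>_lin: "linCC E \<gamma>"
    unfolding Vector_Spaces.linear_iff
  proof (intro conjI allI vsC)
    interpret t: Vector_Spaces.linear "scaleC E" tscale "\<lambda>x. tC E [x]" by (rule lin)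
    interpret g: Vector_Spaces.linear "scaleC E" tscale g by (rule cochD(1)[OF g])
    show "\<gamma> (x + y) = \<gamma> x + \<gamma> y" for x y
      using g.add[of x y] unfolding \<gamma> t.add[symmetric] tC_inject .
    show "\<gamma> (scaleC E r x) = scaleC E r (\<gamma> x)" for r x
      using g.scale[of r x] unfolding \<gamma> t.scale[symmetric] tC_inject .
  qed
  have "g = (\<lambda>c. tC E [\<gamma> c])" by (rule ext) (rule \<gamma>)
  then have "x = coch1 \<alpha> \<gamma>" using x F f\<alpha> by (simp only: coch1_def)
  then show thesis by (rule that[OF \<alpha> \<gamma>_lin])
qed

text \<open>The component at \<open>m = 2\<close> is \<open>vdiff\<close> of \<mu> minus
  \<open>hdiff\<close> of \<psi>, and that at \<open>m = 1\<close> is \<open>hdiff\<close> of D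
  minus \<open>vdiff\<close> of \<psi>. The signs of the bicomplex thereby make every component a
  linearised deformation equation, one side minus the other.\<close>

lemma Dtot_coch2:
  assumes "\<mu> \<in> hom_AAB_A E" "\<psi> \<in> hom_CA_AC E" "D \<in> CochC E 2"
  shows "Dtot E 2 (coch2 \<mu> \<psi> D) =
    (\<lambda>a b. zeta E (b 1 2 * b 1 3) * a 1 * \<mu> (a 2) (a 3) (b 2 3)
        - \<mu> (zeta E (b 1 2) * a 1 * a 2) (a 3) (b 1 3 * b 2 3)
        + \<mu> (a 1) (zeta E (b 2 3) * a 2 * a 3) (b 1 2 * b 1 3)
        - zeta E (b 1 3 * b 2 3) * \<mu> (a 1) (a 2) (b 1 2) * a 3,
     \<lambda>m. if m = 2 then \<lambda>c a b.
          psi E c (\<mu> (a 1) (a 2) (b 1 2)) + \<psi> c (zeta E (b 1 2) * a 1 * a 2)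
          - mu_psi_psi E (\<lambda>x y. \<mu> x y (b 1 2)) (psi E) (psi E) c (a 1) (a 2)
          - mu_psi_psi E (\<lambda>x y. zeta E (b 1 2) * x * y) \<psi> (psi E) c (a 1) (a 2)
          - mu_psi_psi E (\<lambda>x y. zeta E (b 1 2) * x * y) (psi E) \<psi> c (a 1) (a 2)
        else if m = 1 then \<lambda>c a b.
          delta_at E 1 D (psi E c (a 1)) + delta_at E 1 (Delta E) (\<psi> c (a 1))
          - psi_psi_delta E (psi E) (psi E) D c (a 1)
          - psi_psi_delta E (psi E) \<psi> (Delta E) c (a 1)
          - psi_psi_delta E \<psi> (psi E) (Delta E) c (a 1)
        else 0,
     \<lambda>c. delta_right E D (Delta E) c + delta_right E (Delta E) D c
        - delta_left E (Delta E) D c - delta_left E D (Delta E) c)"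
proof -
  have 1: "1 \<le> m \<and> m \<le> 2 \<longleftrightarrow> m = 1 \<or> m = 2" for m :: nat by auto
  have 2: "2 - Suc 0 = 1" by simp
  show ?thesis
    unfolding Dtot_def coch2_def prod.case hdiffA_2 vdiffC_2[OF assms(3)] 1
    by (intro arg_cong2[where f = Pair] ext)
      (auto simp: algebra_simps fun_eq_iff zero_fun_apply hdiff_jbar[OF assms(3)] sweedler_move_2[OF assms(3)]
        vdiff_1_1[OF assms(2), unfolded One_nat_def] hdiff_1[OF assms(2), unfolded One_nat_def]
        vdiff_2_0[of \<mu>, OF muD(1,2)[OF assms(1)], unfolded One_nat_def] 2)
qed

text \<open>Each component is the first-order change of a structure map under the substitutions id +
  t\<alpha> on A and id + t\<gamma> on C.\<close>

lemma Dtot_coch1: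
  assumes "linAA E \<alpha>" "linCC E \<gamma>"
  shows "Dtot E 1 (coch1 \<alpha> \<gamma>) = coch2
    (\<lambda>x y b. \<alpha> (zeta E b * x * y) - zeta E b * x * \<alpha> y - zeta E b * \<alpha> x * y)
    (\<lambda>c x. sweedler (psi E c x) (\<lambda>(x, cs). tAC E (x, [\<gamma> (cs ! 0)])) - psi E (\<gamma> c) x
      - psi E c (\<alpha> x) + sweedler (psi E c x) (\<lambda>(x, cs). tAC E (\<alpha> x, [cs ! 0])))
    (\<lambda>c. sweedler (Delta E c) (\<lambda>cs. tC E [cs ! 0, \<gamma> (cs ! 1)]) - Delta E (\<gamma> c)
      + sweedler (Delta E c) (\<lambda>cs. tC E [\<gamma> (cs ! 0), cs ! 1]))"
proof -
  have "mlinC (scaleC E) (length [d]) tscale (\<lambda>cs. tAC E (x, cs))" for x d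
    using mlinC_tAC[of 1 x "[]" "[]"] by simp
  then have "sweedler (tC E [d]) (\<lambda>ds. tAC E (x, ds)) = tAC E (x, [d])" for x d
    by (rule sweedler_pureC)
  then have 1: "delta_at E 1 (\<lambda>c. tC E [\<gamma> c]) (psi E c x) =
      sweedler (psi E c x) (\<lambda>(x, cs). tAC E (x, [\<gamma> (cs ! 0)]))" for c x
    by (simp only: delta_at_1[OF homD(3)[OF psi_hom]])
  have "sweedler (tC E [d]) (\<lambda>cs. move E cs x) = psi E d x" for d x
    using sweedler_pureC[of "scaleC E" "[d]", OF move_mlin] by (simp add: move_single del: move.simps)
  note 2 = this
  have 3: "1 \<le> m \<and> m \<le> 1 \<longleftrightarrow> m = 1" for m :: nat by auto
  show ?thesis
    unfolding Dtot_def coch1_def prod.case hdiffA_1 vdiffC_1[OF assms(2)] coch2_def 3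
    by (intro arg_cong2[where f = Pair] ext)
      (auto simp: algebra_simps fun_eq_iff zero_fun_apply hdiff_jbar[OF coch_tC[OF assms(2)]] 2
        1[unfolded One_nat_def] vdiff_1_0[OF assms(1), unfolded One_nat_def])
qed


section \<open>Coboundaries\<close>

lemma mu0_hom: "(\<lambda>x y b. zeta E b * x * y) \<in> hom_AAB_A E"
proof -
  have "linAA E (\<lambda>x. zeta E b * x * y)" for b y
    using linear_comp[OF linear_mult_left linear_mult_right] .
  moreover have "linAA E (\<lambda>y. zeta E b * x * y)" for b x
    by (rule linear_mult_left)
  moreover have "linBA E (\<lambda>b. zeta E b * (x * y))" for x y
    using linear_comp[OF linear_zeta linear_mult_right] .
  ultimately show ?thesis by (simp add: hom_AAB_A_def mult.assoc)
qed

lemma psi_diff: "psi E c (x - y) = psi E c x - psi E c y"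
proof -
  interpret Vector_Spaces.linear "scaleA E" tscale "psi E c" by (rule homD(2)[OF psi_hom])
  show ?thesis by (rule diff)
qed

text \<open>Gives closure of the coboundaries of degree 3 under differences. In the explicit formula
  every summand contains exactly one of \<mu>, \<psi>, D, and depends linearly on it.\<close>

lemma Dtot_2_diff:
  assumes "x \<in> Tot E 2" "y \<in> Tot E 2"
  shows "x - y \<in> Tot E 2" "Dtot E 2 (x - y) = Dtot E 2 x - Dtot E 2 y"
proof -
  obtain \<mu> \<psi> D where x: "\<mu> \<in> hom_AAB_A E" "\<psi> \<in> hom_CA_AC E" "D \<in> CochC E 2" "x = coch2 \<mu> \<psi> D"
    using assms(1) by (rule Tot_2E)
  obtain \<mu>' \<psi>' D' where y: "\<mu>' \<in> hom_AAB_A E" "\<psi>' \<in> hom_CA_AC E" "D' \<in> CochC E 2" "y = coch2 \<mu>' \<psi>' D'"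
    using assms(2) by (rule Tot_2E)
  have xy: "x - y = coch2 (\<mu> - \<mu>') (\<psi> - \<psi>') (D - D')"
    by (simp add: x(4) y(4) coch2_diff)
  note h = mu_diff[OF x(1) y(1)] hom_diff[OF x(2) y(2)] coch_diff[OF x(3) y(3)]
  show "x - y \<in> Tot E 2" unfolding xy using h by (rule coch2_in_Tot)
  note m0 = muD(1,2)[OF mu0_hom]
  have m1: "mu_psi_psi E (\<lambda>x y. zeta E b * x * y) (\<psi> - \<psi>') (psi E) c x y =
      mu_psi_psi E (\<lambda>x y. zeta E b * x * y) \<psi> (psi E) c x y
      - mu_psi_psi E (\<lambda>x y. zeta E b * x * y) \<psi>' (psi E) c x y" for b c x y
    by (rule mu_psi_psi_diff(2)[OF x(2) psi_hom m0 y(2)])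
  have m2: "mu_psi_psi E (\<lambda>x y. zeta E b * x * y) (psi E) (\<psi> - \<psi>') c x y =
      mu_psi_psi E (\<lambda>x y. zeta E b * x * y) (psi E) \<psi> c x y
      - mu_psi_psi E (\<lambda>x y. zeta E b * x * y) (psi E) \<psi>' c x y" for b c x y
    by (rule mu_psi_psi_diff(3)[OF psi_hom x(2) m0])
  have mm: "mu_psi_psi E (\<lambda>x y. \<mu> x y b - \<mu>' x y b) (psi E) (psi E) c x y =
      mu_psi_psi E (\<lambda>x y. \<mu> x y b) (psi E) (psi E) c x y - mu_psi_psi E (\<lambda>x y. \<mu>' x y b) (psi E) (psi E) c x y"
    for b c x y
    by (rule mu_psi_psi_diff(1)[OF psi_hom psi_hom muD(1,2)[OF x(1)] muD(1,2)[OF y(1)]])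
  show "Dtot E 2 (x - y) = Dtot E 2 x - Dtot E 2 y"
    unfolding xy Dtot_coch2[OF h] unfolding x(4) y(4) Dtot_coch2[OF x(1-3)] Dtot_coch2[OF y(1-3)]
    unfolding diff_Pair
    by (intro arg_cong2[where f = Pair] ext)
      (auto simp: minus_apply zero_fun_apply psi_diff mm
        m1 m2
        delta_at_diff[OF x(3) y(3) homD(3)[OF psi_hom], unfolded One_nat_def] delta_at_diff_arg
        psi_psi_delta_diff(3)[OF psi_hom psi_hom x(3)] psi_psi_delta_diff(2)[OF psi_hom x(2) Delta_coch y(2)]
        psi_psi_delta_diff(1)[OF x(2) psi_hom Delta_coch y(2)]
        delta_right_diff(1)[OF x(3) Delta_coch y(3)] delta_right_diff(2)[OF Delta_coch x(3)]
        delta_left_diff(1)[OF x(3) Delta_coch y(3)] delta_left_diff(2)[OF Delta_coch x(3)]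
        plus_fun_apply algebra_simps simp del: mult.assoc)
qed

lemma Dtot_1_diff:
  assumes "x \<in> Tot E 1" "y \<in> Tot E 1"
  shows "x - y \<in> Tot E 1" "Dtot E 1 (x - y) = Dtot E 1 x - Dtot E 1 y"
proof -
  obtain \<alpha> \<gamma> where x: "linAA E \<alpha>" "linCC E \<gamma>" "x = coch1 \<alpha> \<gamma>"
    using assms(1) by (rule Tot_1E)
  obtain \<alpha>' \<gamma>' where y: "linAA E \<alpha>'" "linCC E \<gamma>'" "y = coch1 \<alpha>' \<gamma>'"
    using assms(2) by (rule Tot_1E)
  have xy: "x - y = coch1 (\<alpha> - \<alpha>') (\<gamma> - \<gamma>')"
    by (simp add: x(3) y(3) coch1_diff)
  have h: "linAA E (\<alpha> - \<alpha>')" "linCC E (\<gamma> - \<gamma>')"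
    unfolding fun_diff_def using x y by (auto intro: linear_diff)
  show "x - y \<in> Tot E 1" unfolding xy using h by (rule coch1_in_Tot)
  have A: "tAC E (u - v, cs) = tAC E (u, cs) - tAC E (v, cs)" for u v cs
  proof -
    interpret Vector_Spaces.linear "scaleA E" tscale "\<lambda>a. tAC E (a, cs)"
      by (rule linear_tAC_A[OF linear_ident[OF vsA]])
    show ?thesis by (rule diff)
  qed
  have C: "tAC E (u, [c - d]) = tAC E (u, [c]) - tAC E (u, [d])" for u c d
  proof -
    interpret Vector_Spaces.linear "scaleC E" tscale "\<lambda>c. tAC E (u, [c])"
      using linear_tAC_C[OF linear_ident[OF vsC], of u "[]" "[]"] by simp
    show ?thesis by (rule diff)
  qed
  have CC: "tC E [e, c - d] = tC E [e, c] - tC E [e, d]" "tC E [c - d, e] = tC E [c, e] - tC E [d, e]" for e c d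
  proof -
    interpret l: Vector_Spaces.linear "scaleC E" tscale "\<lambda>c. tC E [e, c]"
      using linear_tC[OF linear_ident[OF vsC], of "[e]" "[]"] by simp
    show "tC E [e, c - d] = tC E [e, c] - tC E [e, d]" by (rule l.diff)
    interpret r: Vector_Spaces.linear "scaleC E" tscale "\<lambda>c. tC E [c, e]"
      using linear_tC[OF linear_ident[OF vsC], of "[]" "[e]"] by simp
    show "tC E [c - d, e] = tC E [c, e] - tC E [d, e]" by (rule r.diff)
  qed
  have Cm: "mlinC (scaleC E) 2 tscale (\<lambda>cs. tC E [\<gamma> (cs ! 0), cs ! 1])"
    "mlinC (scaleC E) 2 tscale (\<lambda>cs. tC E [cs ! 0, \<gamma> (cs ! 1)])" if "linCC E \<gamma>" for \<gamma>
    using linear_tC[OF that, of "[]" "[_]"] linear_tC[OF that, of "[_]" "[]"]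
      linear_tC[OF linear_ident[OF vsC], of "[]" "[_]"] linear_tC[OF linear_ident[OF vsC], of "[_]" "[]"]
    by (simp_all add: mlinC_2)
  have s1: "sweedler (psi E c u) (\<lambda>(x, cs). tAC E (x, [\<gamma> (cs ! 0) - \<gamma>' (cs ! 0)])) =
      sweedler (psi E c u) (\<lambda>(x, cs). tAC E (x, [\<gamma> (cs ! 0)])) -
      sweedler (psi E c u) (\<lambda>(x, cs). tAC E (x, [\<gamma>' (cs ! 0)]))" for c u
    using sweedlerAC_diff[OF homD(3)[OF psi_hom] mlinAC_last[OF linear_ident[OF vsA] x(2)]
        mlinAC_last[OF linear_ident[OF vsA] y(2)]] by (simp add: C split_def)
  have s2: "sweedler (psi E c u) (\<lambda>(x, cs). tAC E (\<alpha> x - \<alpha>' x, [cs ! 0])) =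
      sweedler (psi E c u) (\<lambda>(x, cs). tAC E (\<alpha> x, [cs ! 0])) -
      sweedler (psi E c u) (\<lambda>(x, cs). tAC E (\<alpha>' x, [cs ! 0]))" for c u
    using sweedlerAC_diff[OF homD(3)[OF psi_hom] mlinAC_last[OF x(1) linear_ident[OF vsC]]
        mlinAC_last[OF y(1) linear_ident[OF vsC]]] by (simp add: A split_def)
  have s3: "sweedler (Delta E c) (\<lambda>cs. tC E [cs ! 0, \<gamma> (cs ! 1) - \<gamma>' (cs ! 1)]) =
      sweedler (Delta E c) (\<lambda>cs. tC E [cs ! 0, \<gamma> (cs ! 1)]) -
      sweedler (Delta E c) (\<lambda>cs. tC E [cs ! 0, \<gamma>' (cs ! 1)])" for c
    unfolding CC by (rule sweedlerC_diff[OF cochD(2)[OF Delta_coch] Cm(2)[OF x(2)] Cm(2)[OF y(2)]])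
  have s4: "sweedler (Delta E c) (\<lambda>cs. tC E [\<gamma> (cs ! 0) - \<gamma>' (cs ! 0), cs ! 1]) =
      sweedler (Delta E c) (\<lambda>cs. tC E [\<gamma> (cs ! 0), cs ! 1]) -
      sweedler (Delta E c) (\<lambda>cs. tC E [\<gamma>' (cs ! 0), cs ! 1])" for c
    unfolding CC by (rule sweedlerC_diff[OF cochD(2)[OF Delta_coch] Cm(1)[OF x(2)] Cm(1)[OF y(2)]])
  have s5: "Delta E (c - d) = Delta E c - Delta E d" for c d
  proof -
    interpret Vector_Spaces.linear "scaleC E" tscale "Delta E" by (rule cochD(1)[OF Delta_coch])
    show ?thesis by (rule diff)
  qed
  have s6: "psi E (c - d) u = psi E c u - psi E d u" for c d u
  proof -
    interpret Vector_Spaces.linear "scaleC E" tscale "\<lambda>c. psi E c u" by (rule homD(1)[OF psi_hom])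
    show ?thesis by (rule diff)
  qed
  show "Dtot E 1 (x - y) = Dtot E 1 x - Dtot E 1 y"
    unfolding xy Dtot_coch1[OF h] unfolding x(3) y(3) Dtot_coch1[OF x(1,2)] Dtot_coch1[OF y(1,2)]
    unfolding coch2_diff[symmetric]
    by (intro arg_cong3[where f = coch2] ext)
      (simp_all add: minus_apply algebra_simps psi_diff s1 s2 s3[unfolded One_nat_def] s4[unfolded One_nat_def] s5 s6)
qed

lemma coboundaries_2: "coboundaries E 2 = Dtot E 1 ` Tot E 1"
  and coboundaries_3: "coboundaries E 3 = Dtot E 2 ` Tot E 2"
  by (simp_all add: coboundaries_def)

lemma coboundaries_diff:
  "x \<in> coboundaries E 2 \<Longrightarrow> y \<in> coboundaries E 2 \<Longrightarrow> x - y \<in> coboundaries E 2"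
  "x \<in> coboundaries E 3 \<Longrightarrow> y \<in> coboundaries E 3 \<Longrightarrow> x - y \<in> coboundaries E 3"
proof -
  show "x - y \<in> coboundaries E 2" if x: "x \<in> coboundaries E 2" and y: "y \<in> coboundaries E 2"
  proof -
    obtain u where u: "x = Dtot E 1 u" "u \<in> Tot E 1" using x unfolding coboundaries_2 by (rule imageE)
    obtain v where v: "y = Dtot E 1 v" "v \<in> Tot E 1" using y unfolding coboundaries_2 by (rule imageE)
    show ?thesis
      unfolding u v coboundaries_2 Dtot_1_diff(2)[OF u(2) v(2), symmetric]
      by (rule imageI[OF Dtot_1_diff(1)[OF u(2) v(2)]])
  qed
  show "x - y \<in> coboundaries E 3" if x: "x \<in> coboundaries E 3" and y: "y \<in> coboundaries E 3"
  proof -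
    obtain u where u: "x = Dtot E 2 u" "u \<in> Tot E 2" using x unfolding coboundaries_3 by (rule imageE)
    obtain v where v: "y = Dtot E 2 v" "v \<in> Tot E 2" using y unfolding coboundaries_3 by (rule imageE)
    show ?thesis
      unfolding u v coboundaries_3 Dtot_2_diff(2)[OF u(2) v(2), symmetric]
      by (rule imageI[OF Dtot_2_diff(1)[OF u(2) v(2)]])
  qed
qed

text \<open>Zero is the difference of a coboundary with itself, so one cochain per degree suffices:
  the identity maps in degree 1, the structure maps themselves in degree 2.\<close>

lemma coboundaries_zero: "0 \<in> coboundaries E 2" "0 \<in> coboundaries E 3"
proof -
  have "Dtot E 1 (coch1 (\<lambda>x. x) (\<lambda>x. x)) \<in> coboundaries E 2"
    unfolding coboundaries_2 by (intro imageI coch1_in_Tot linear_ident vsA vsC)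
  from coboundaries_diff(1)[OF this this] show "0 \<in> coboundaries E 2" by simp
  have "Dtot E 2 (coch2 (\<lambda>x y b. zeta E b * x * y) (psi E) (Delta E)) \<in> coboundaries E 3"
    unfolding coboundaries_3 by (intro imageI coch2_in_Tot mu0_hom psi_hom Delta_coch)
  from coboundaries_diff(2)[OF this this] show "0 \<in> coboundaries E 3" by simp
qed

text \<open>The usual criterion for equality of cosets of a subgroup, in the two degrees where
  closure under differences has been established.\<close>

lemma coh_class_eq_iff:
  assumes "p = 2 \<or> p = 3"
  shows "coh_class E p x = coh_class E p y \<longleftrightarrow> y - x \<in> coboundaries E p"
proof -
  have diff: "u - v \<in> coboundaries E p" if "u \<in> coboundaries E p" "v \<in> coboundaries E p" for u v
    using assms that by (elim disjE) (simp_all add: coboundaries_diff)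
  have zero: "0 \<in> coboundaries E p" using assms coboundaries_zero by auto
  show ?thesis
  proof
    assume eq: "coh_class E p x = coh_class E p y"
    have "y \<in> coh_class E p y"
      unfolding coh_class_def by (rule image_eqI[OF _ zero]) simp
    then have "y \<in> coh_class E p x" by (simp only: eq)
    then obtain u where "y = x + u" "u \<in> coboundaries E p" unfolding coh_class_def by (rule imageE)
    then show "y - x \<in> coboundaries E p" by simp
  next
    assume B: "y - x \<in> coboundaries E p"
    show "coh_class E p x = coh_class E p y"
    proof (intro equalityI subsetI)
      fix z
      assume "z \<in> coh_class E p x"
      then obtain u where u: "z = x + u" "u \<in> coboundaries E p" unfolding coh_class_def by (rule imageE)
      show "z \<in> coh_class E p y"
        unfolding coh_class_def
        by (rule image_eqI[OF _ diff[OF u(2) B]]) (simp only: u(1) algebra_simps)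
    next
      fix z
      assume "z \<in> coh_class E p y"
      then obtain u where u: "z = y + u" "u \<in> coboundaries E p" unfolding coh_class_def by (rule imageE)
      show "z \<in> coh_class E p x"
        unfolding coh_class_def
        \<comment> \<open>The sum of \<open>u\<close> and \<open>y - x\<close> is written as
          \<open>u\<close> minus (0 minus (\<open>y - x\<close>)), which stays within closure under
          differences.\<close>
        by (rule image_eqI[OF _ diff[OF u(2) diff[OF zero B]]]) (simp add: u(1) algebra_simps)
    qed
  qed
qed

end

section \<open>Deformation equations and obstructions\<close>

lemma finite_sum_pairs: "finite {(i, j). i + j = (p::nat)}"
  by (rule finite_subset[of _ "{..p} \<times> {..p}"]) auto

lemma finite_sum_triples: "finite {(i, j, l). i + j + l = (p::nat)}"
  by (rule finite_subset[of _ "{..p} \<times> {..p} \<times> {..p}"]) auto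

lemma sum_pairs_cong:
  assumes "\<And>i j. i \<le> p \<Longrightarrow> j \<le> p \<Longrightarrow> f i j = g i j"
  shows "(\<Sum>(i, j)\<in>{(i, j). i + j = (p::nat)}. f i j) = (\<Sum>(i, j)\<in>{(i, j). i + j = p}. g i j)"
  by (rule sum.cong) (use assms in auto)

lemma sum_triples_cong:
  assumes "\<And>i j l. i \<le> p \<Longrightarrow> j \<le> p \<Longrightarrow> l \<le> p \<Longrightarrow> f i j l = g i j l"
  shows "(\<Sum>(i, j, l)\<in>{(i, j, l). i + j + l = (p::nat)}. f i j l) =
    (\<Sum>(i, j, l)\<in>{(i, j, l). i + j + l = p}. g i j l)"
  by (rule sum.cong) (use assms in auto)

text \<open>An index equal to n + 1 leaves 0 for the other one, and the two extreme pairs are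
  distinct because n + 1 is positive. The remaining set is the range of summation in
  \<open>obstruction\<close>.\<close>

lemma sum_pairs_Suc:
  "(\<Sum>(i, j)\<in>{(i, j). i + j = (n::nat) + 1}. f i j) =
    f (n + 1) 0 + f 0 (n + 1) + (\<Sum>(i, j)\<in>{(i, j). i < n + 1 \<and> j < n + 1 \<and> i + j = n + 1}. f i j)"
proof -
  have "{(i, j). i + j = n + 1} = insert (n + 1, 0) (insert (0, n + 1)
      {(i, j). i < n + 1 \<and> j < n + 1 \<and> i + j = n + 1})" by auto
  moreover have "finite {(i, j). i < n + 1 \<and> j < n + 1 \<and> i + j = n + 1}"
    by (rule finite_subset[OF _ finite_sum_pairs[of "n + 1"]]) auto
  ultimately show ?thesis by (simp add: add.assoc)
qed

lemma sum_triples_Suc: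
  "(\<Sum>(i, j, l)\<in>{(i, j, l). i + j + l = (n::nat) + 1}. f i j l) =
    f (n + 1) 0 0 + f 0 (n + 1) 0 + f 0 0 (n + 1) +
    (\<Sum>(i, j, l)\<in>{(i, j, l). i < n + 1 \<and> j < n + 1 \<and> l < n + 1 \<and> i + j + l = n + 1}. f i j l)"
proof -
  have "{(i, j, l). i + j + l = n + 1} = insert (n + 1, 0, 0) (insert (0, n + 1, 0) (insert (0, 0, n + 1)
      {(i, j, l). i < n + 1 \<and> j < n + 1 \<and> l < n + 1 \<and> i + j + l = n + 1}))" by auto
  moreover have "finite {(i, j, l). i < n + 1 \<and> j < n + 1 \<and> l < n + 1 \<and> i + j + l = n + 1}"
    by (rule finite_subset[OF _ finite_sum_triples[of "n + 1"]]) auto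
  ultimately show ?thesis by (simp add: add.assoc)
qed

text \<open>Reconciles conventions: in the composites nested on the left, and in both coproduct
  terms, \<open>obstruction\<close> gives the outer map the second index, the deformation equations
  give it the first.\<close>

lemma sum_pairs_swap:
  "(\<Sum>(i, j)\<in>{(i, j). i < m \<and> j < m \<and> i + j = (p::nat)}. f j i) =
    (\<Sum>(i, j)\<in>{(i, j). i < m \<and> j < m \<and> i + j = p}. f i j)"
  by (rule sum.reindex_bij_witness[of _ prod.swap prod.swap]) auto

context entw
begin

text \<open>The coefficient of t^p in all four identities, isolated so that a lift can reuse the
  equations for p <= n and has to meet only the one for n + 1.\<close>

definition deform_eqs where
  "deform_eqs d p \<longleftrightarrow>
       (\<forall>b1 b2 b3 x y z.
          (\<Sum>(i, j)\<in>{(i, j). i + j = p}. dmu d i x (dmu d j y z b3) (b1 * b2)) =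
          (\<Sum>(i, j)\<in>{(i, j). i + j = p}. dmu d i (dmu d j x y b1) z (b2 * b3))) \<and>
       (\<forall>c.
          (\<Sum>(i, j)\<in>{(i, j). i + j = p}. delta_left E (dDelta d i) (dDelta d j) c) =
          (\<Sum>(i, j)\<in>{(i, j). i + j = p}. delta_right E (dDelta d i) (dDelta d j) c)) \<and>
       (\<forall>b c x y.
          (\<Sum>(i, j)\<in>{(i, j). i + j = p}. dpsi d i c (dmu d j x y b)) =
          (\<Sum>(i, j, l)\<in>{(i, j, l). i + j + l = p}.
             mu_psi_psi E (\<lambda>x y. dmu d i x y b) (dpsi d j) (dpsi d l) c x y)) \<and>
       (\<forall>c a.
          (\<Sum>(i, j)\<in>{(i, j). i + j = p}. delta_at E 1 (dDelta d i) (dpsi d j c a)) =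
          (\<Sum>(i, j, l)\<in>{(i, j, l). i + j + l = p}.
             psi_psi_delta E (dpsi d i) (dpsi d j) (dDelta d l) c a))"

lemma deform_eqs_cong:
  assumes "\<And>i. i \<le> p \<Longrightarrow> dmu d' i = dmu d i" "\<And>i. i \<le> p \<Longrightarrow> dDelta d' i = dDelta d i"
    "\<And>i. i \<le> p \<Longrightarrow> dpsi d' i = dpsi d i"
  shows "deform_eqs d' p \<longleftrightarrow> deform_eqs d p"
  unfolding deform_eqs_def
  by (intro conj_cong all_cong1 arg_cong2[where f = "(=)"] sum_pairs_cong sum_triples_cong)
    (simp_all add: assms)

lemma deformation_mod_iff:
  "deformation_mod E n d \<longleftrightarrow>
     dmu d 0 = (\<lambda>x y b. zeta E b * x * y) \<and> dDelta d 0 = Delta E \<and> dpsi d 0 = psi E \<and>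
     (\<forall>i\<in>{1..n}. dmu d i \<in> hom_AAB_A E \<and> dDelta d i \<in> CochC E 2 \<and> dpsi d i \<in> hom_CA_AC E) \<and>
     (\<forall>i>n. dmu d i = 0 \<and> dDelta d i = 0 \<and> dpsi d i = 0) \<and>
     (\<forall>p\<le>n. deform_eqs d p)"
  by (simp add: deformation_mod_def deform_eqs_def)

text \<open>Entries of an array can be prescribed independently, so equations between cochains are
  the same as equations for free variables, the form in which the deformation equations are
  stated.\<close>

lemma tensor_matrix3_iff:
  "(\<lambda>a b. F (a 1) (a 2) (a 3) (b 1 2) (b 1 3) (b 2 3)) =
   (\<lambda>(a :: nat \<Rightarrow> 'a) (b :: nat \<Rightarrow> nat \<Rightarrow> 'b). G (a 1) (a 2) (a 3) (b 1 2) (b 1 3) (b 2 3)) \<longleftrightarrow>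
   (\<forall>x y z b1 b2 b3. F x y z b1 b2 b3 = G x y z b1 b2 b3)"
proof
  assume eq: "(\<lambda>a b. F (a 1) (a 2) (a 3) (b 1 2) (b 1 3) (b 2 3)) =
   (\<lambda>(a :: nat \<Rightarrow> 'a) (b :: nat \<Rightarrow> nat \<Rightarrow> 'b). G (a 1) (a 2) (a 3) (b 1 2) (b 1 3) (b 2 3))"
  show "\<forall>x y z b1 b2 b3. F x y z b1 b2 b3 = G x y z b1 b2 b3"
  proof (intro allI)
    fix x y z b1 b2 b3
    \<comment> \<open>The array of B-entries below takes at the positions (1,2), (1,3), (2,3) the
      values \<open>b1\<close>, \<open>b2\<close>, \<open>b3\<close>.\<close>
    show "F x y z b1 b2 b3 = G x y z b1 b2 b3"
      using fun_cong[OF fun_cong[OF eq, of "\<lambda>i. if i = 1 then x else if i = 2 then y else z"],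
          of "\<lambda>i j. if i = 2 then b3 else if j = 2 then b1 else b2"] by simp
  qed
qed simp

lemma tensor_matrix2_iff:
  "(\<lambda>c a b. F c (a 1) (a 2) (b 1 2)) =
   (\<lambda>c (a :: nat \<Rightarrow> 'a) (b :: nat \<Rightarrow> nat \<Rightarrow> 'b). G c (a 1) (a 2) (b 1 2)) \<longleftrightarrow>
   (\<forall>c x y b. F c x y b = G c x y b)"
proof
  assume eq: "(\<lambda>c a b. F c (a 1) (a 2) (b 1 2)) =
   (\<lambda>c (a :: nat \<Rightarrow> 'a) (b :: nat \<Rightarrow> nat \<Rightarrow> 'b). G c (a 1) (a 2) (b 1 2))"
  show "\<forall>c x y b. F c x y b = G c x y b"
  proof (intro allI)
    fix c x y b
    show "F c x y b = G c x y b"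
      using fun_cong[OF fun_cong[OF fun_cong[OF eq, of c], of "\<lambda>i. if i = 1 then x else y"],
          of "\<lambda>_ _. b"] by simp
  qed
qed simp

lemma tensor_matrix1_iff:
  "(\<lambda>c a b. F c (a 1)) = (\<lambda>c (a :: nat \<Rightarrow> 'a) (b :: nat \<Rightarrow> nat \<Rightarrow> 'b). G c (a 1)) \<longleftrightarrow>
   (\<forall>c x. F c x = G c x)"
proof
  assume eq: "(\<lambda>c a b. F c (a 1)) = (\<lambda>c (a :: nat \<Rightarrow> 'a) (b :: nat \<Rightarrow> nat \<Rightarrow> 'b). G c (a 1))"
  show "\<forall>c x. F c x = G c x"
  proof (intro allI)
    fix c x
    show "F c x = G c x"
      using fun_cong[OF fun_cong[OF fun_cong[OF eq, of c], of "\<lambda>_. x"]] by simp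
  qed
qed simp

lemma family_eq_iff:
  "(\<lambda>m :: nat. if m = 2 then P else if m = 1 then Q else R) =
    (\<lambda>m. if m = 2 then P' else if m = 1 then Q' else R) \<longleftrightarrow> P = P' \<and> Q = Q'"
proof
  assume eq: "(\<lambda>m :: nat. if m = 2 then P else if m = 1 then Q else R) =
    (\<lambda>m. if m = 2 then P' else if m = 1 then Q' else R)"
  show "P = P' \<and> Q = Q'" using fun_cong[OF eq, of 2] fun_cong[OF eq, of 1] by simp
qed (elim conjE, hypsubst, rule refl)

text \<open>The equality of cochains splits into four: associativity is the first component,
  compatibility of \<psi> with the multiplication the one at \<open>m = 2\<close>, with the
  coproduct the one at \<open>m = 1\<close>, and coassociativity the last. In each, splitting off
  the index n + 1 and rearranging gives the equivalence.\<close>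

lemma deform_eqs_Suc_iff:
  assumes zero: "dmu d 0 = (\<lambda>x y b. zeta E b * x * y)" "dDelta d 0 = Delta E" "dpsi d 0 = psi E"
    and hom: "dmu d (n + 1) \<in> hom_AAB_A E" "dpsi d (n + 1) \<in> hom_CA_AC E" "dDelta d (n + 1) \<in> CochC E 2"
  shows "deform_eqs d (n + 1) \<longleftrightarrow>
    obstruction E n d = Dtot E 2 (coch2 (dmu d (n + 1)) (dpsi d (n + 1)) (dDelta d (n + 1)))"
proof -
  define I2 where "I2 = {(i, j). i < n + 1 \<and> j < n + 1 \<and> i + j = n + 1}"
  define I3 where "I3 = {(i, j, l). i < n + 1 \<and> j < n + 1 \<and> l < n + 1 \<and> i + j + l = n + 1}"
  let ?m = "dmu d (n + 1)" and ?p = "dpsi d (n + 1)" and ?D = "dDelta d (n + 1)"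
  \<comment> \<open>Sums of differences become differences of sums, so that each half can be matched
    with one side of a deformation equation.\<close>
  have obs: "obstruction E n d =
      (\<lambda>a b. (\<Sum>(i, j)\<in>I2. dmu d j (dmu d i (a 1) (a 2) (b 1 2)) (a 3) (b 1 3 * b 2 3))
          - (\<Sum>(i, j)\<in>I2. dmu d i (a 1) (dmu d j (a 2) (a 3) (b 2 3)) (b 1 2 * b 1 3)),
        \<lambda>m. if m = 2 then
              (\<lambda>c a b.
                (\<Sum>(i, j, l)\<in>I3.
                   mu_psi_psi E (\<lambda>x y. dmu d i x y (b 1 2)) (dpsi d j) (dpsi d l) c (a 1) (a 2))
                - (\<Sum>(i, j)\<in>I2. dpsi d i c (dmu d j (a 1) (a 2) (b 1 2))))
            else if m = 1 then
              (\<lambda>c a b.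
                (\<Sum>(i, j, l)\<in>I3. psi_psi_delta E (dpsi d i) (dpsi d j) (dDelta d l) c (a 1))
                - (\<Sum>(i, j)\<in>I2. delta_at E 1 (dDelta d i) (dpsi d j c (a 1))))
            else 0,
        \<lambda>c. (\<Sum>(i, j)\<in>I2. delta_left E (dDelta d j) (dDelta d i) c)
          - (\<Sum>(i, j)\<in>I2. delta_right E (dDelta d j) (dDelta d i) c))"
    unfolding obstruction_def Let_def I2_def I3_def by (simp only: sum_subtractf split_def)
  have A: "(\<forall>b1 b2 b3 x y z.
          (\<Sum>(i, j)\<in>{(i, j). i + j = n + 1}. dmu d i x (dmu d j y z b3) (b1 * b2)) =
          (\<Sum>(i, j)\<in>{(i, j). i + j = n + 1}. dmu d i (dmu d j x y b1) z (b2 * b3))) \<longleftrightarrow>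
    fst (obstruction E n d) = fst (Dtot E 2 (coch2 ?m ?p ?D))"
  proof -
    have swap: "(\<Sum>(i, j)\<in>I2. dmu d j (dmu d i x y b1) z (b2 * b3)) =
        (\<Sum>(i, j)\<in>I2. dmu d i (dmu d j x y b1) z (b2 * b3))" for x y z b1 b2 b3
      unfolding I2_def by (rule sum_pairs_swap)
    have "fst (obstruction E n d) = fst (Dtot E 2 (coch2 ?m ?p ?D)) \<longleftrightarrow>
      (\<forall>x y z b1 b2 b3.
        (\<Sum>(i, j)\<in>I2. dmu d i (dmu d j x y b1) z (b2 * b3))
          - (\<Sum>(i, j)\<in>I2. dmu d i x (dmu d j y z b3) (b1 * b2)) =
        zeta E (b1 * b2) * x * ?m y z b3 - ?m (zeta E b1 * x * y) z (b2 * b3)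
        + ?m x (zeta E b3 * y * z) (b1 * b2) - zeta E (b2 * b3) * ?m x y b1 * z)"
      unfolding obs Dtot_coch2[OF hom] fst_conv swap by (rule tensor_matrix3_iff)
    then show ?thesis
      unfolding sum_pairs_Suc I2_def[symmetric] zero
      by (auto simp: algebra_simps simp del: mult.assoc)
  qed
  have B: "(\<forall>c.
          (\<Sum>(i, j)\<in>{(i, j). i + j = n + 1}. delta_left E (dDelta d i) (dDelta d j) c) =
          (\<Sum>(i, j)\<in>{(i, j). i + j = n + 1}. delta_right E (dDelta d i) (dDelta d j) c)) \<longleftrightarrow>
    snd (snd (obstruction E n d)) = snd (snd (Dtot E 2 (coch2 ?m ?p ?D)))"
  proof -
    have swap: "(\<Sum>(i, j)\<in>I2. delta_left E (dDelta d j) (dDelta d i) c) =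
        (\<Sum>(i, j)\<in>I2. delta_left E (dDelta d i) (dDelta d j) c)"
      "(\<Sum>(i, j)\<in>I2. delta_right E (dDelta d j) (dDelta d i) c) =
        (\<Sum>(i, j)\<in>I2. delta_right E (dDelta d i) (dDelta d j) c)" for c
      unfolding I2_def by (rule sum_pairs_swap)+
    show ?thesis
      unfolding obs Dtot_coch2[OF hom] snd_conv swap fun_eq_iff[of "\<lambda>c :: 'c. _ c - _ c"]
      unfolding sum_pairs_Suc I2_def[symmetric] zero
      by (intro all_cong1) (auto simp: algebra_simps)
  qed
  have C: "(\<forall>b c x y.
          (\<Sum>(i, j)\<in>{(i, j). i + j = n + 1}. dpsi d i c (dmu d j x y b)) =
          (\<Sum>(i, j, l)\<in>{(i, j, l). i + j + l = n + 1}.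
             mu_psi_psi E (\<lambda>x y. dmu d i x y b) (dpsi d j) (dpsi d l) c x y)) \<longleftrightarrow>
    fst (snd (obstruction E n d)) 2 = fst (snd (Dtot E 2 (coch2 ?m ?p ?D))) 2"
  proof -
    have "fst (snd (obstruction E n d)) 2 = fst (snd (Dtot E 2 (coch2 ?m ?p ?D))) 2 \<longleftrightarrow>
      (\<forall>c x y b.
        (\<Sum>(i, j, l)\<in>I3. mu_psi_psi E (\<lambda>x y. dmu d i x y b) (dpsi d j) (dpsi d l) c x y)
          - (\<Sum>(i, j)\<in>I2. dpsi d i c (dmu d j x y b)) =
        psi E c (?m x y b) + ?p c (zeta E b * x * y)
          - mu_psi_psi E (\<lambda>x y. ?m x y b) (psi E) (psi E) c x y
          - mu_psi_psi E (\<lambda>x y. zeta E b * x * y) ?p (psi E) c x y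
          - mu_psi_psi E (\<lambda>x y. zeta E b * x * y) (psi E) ?p c x y)"
      unfolding obs Dtot_coch2[OF hom] fst_conv snd_conv if_True simp_thms by (rule tensor_matrix2_iff)
    then show ?thesis
      unfolding sum_pairs_Suc sum_triples_Suc I2_def[symmetric] I3_def[symmetric] zero
      by (auto simp: algebra_simps simp del: mult.assoc)
  qed
  have C': "(\<forall>c a.
          (\<Sum>(i, j)\<in>{(i, j). i + j = n + 1}. delta_at E 1 (dDelta d i) (dpsi d j c a)) =
          (\<Sum>(i, j, l)\<in>{(i, j, l). i + j + l = n + 1}.
             psi_psi_delta E (dpsi d i) (dpsi d j) (dDelta d l) c a)) \<longleftrightarrow>
    fst (snd (obstruction E n d)) 1 = fst (snd (Dtot E 2 (coch2 ?m ?p ?D))) 1"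
  proof -
    have "(1 :: nat) = 2 \<longleftrightarrow> False" by simp
    then have "fst (snd (obstruction E n d)) 1 = fst (snd (Dtot E 2 (coch2 ?m ?p ?D))) 1 \<longleftrightarrow>
      (\<forall>c x.
        (\<Sum>(i, j, l)\<in>I3. psi_psi_delta E (dpsi d i) (dpsi d j) (dDelta d l) c x)
          - (\<Sum>(i, j)\<in>I2. delta_at E 1 (dDelta d i) (dpsi d j c x)) =
        delta_at E 1 ?D (psi E c x) + delta_at E 1 (Delta E) (?p c x)
          - psi_psi_delta E (psi E) (psi E) ?D c x
          - psi_psi_delta E (psi E) ?p (Delta E) c x
          - psi_psi_delta E ?p (psi E) (Delta E) c x)"
      unfolding obs Dtot_coch2[OF hom] fst_conv snd_conv by (simp only: if_True if_False simp_thms) (rule tensor_matrix1_iff)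
    then show ?thesis
      unfolding sum_pairs_Suc sum_triples_Suc I2_def[symmetric] I3_def[symmetric] zero
      by (auto simp: algebra_simps)
  qed
  \<comment> \<open>Outside \<open>m = 1\<close> and \<open>m = 2\<close> both families are
    0.\<close>
  have F: "fst (snd (obstruction E n d)) = fst (snd (Dtot E 2 (coch2 ?m ?p ?D))) \<longleftrightarrow>
      fst (snd (obstruction E n d)) 2 = fst (snd (Dtot E 2 (coch2 ?m ?p ?D))) 2 \<and>
      fst (snd (obstruction E n d)) 1 = fst (snd (Dtot E 2 (coch2 ?m ?p ?D))) 1"
    unfolding obs Dtot_coch2[OF hom] fst_conv snd_conv family_eq_iff by simp
  show ?thesis
    unfolding deform_eqs_def A B C C' prod_eq_iff F by blast
qed

section \<open>The obstruction as a cochain of degree 3\<close>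

lemma coch_sum:
  assumes "\<And>i. i \<in> I \<Longrightarrow> D i \<in> CochC E n"
  shows "(\<lambda>c. \<Sum>i\<in>I. D i c) \<in> CochC E n"
  using assms
  by (auto simp: CochC_def intro!: linear_sum' vsC vector_space_tscale tens.subspace_sum[OF subspace_tensC])

lemma coch_delta_diff:
  assumes "D' \<in> CochC E 2" "D'' \<in> CochC E 2"
  shows "(\<lambda>c. delta_left E D' D'' c - delta_right E D' D'' c) \<in> CochC E 3"
  using delta_left_linear[OF assms(2)] delta_right_linear[OF assms(2)]
    delta_left_in[OF assms] delta_right_in[OF assms]
  by (auto simp: CochC_def numeral_2_eq_2 numeral_3_eq_3 intro!: linear_diff tens.subspace_diff[OF subspace_tensC])

text \<open>Updating one entry of the array changes exactly one argument of \<open>F\<close>, so the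
  conditions on a cochain become linearity of \<open>F\<close> in each argument.\<close>

lemma CochA_3I:
  assumes "\<And>y z b1 b2 b3. linAA E (\<lambda>x. F x y z b1 b2 b3)" "\<And>x z b1 b2 b3. linAA E (\<lambda>y. F x y z b1 b2 b3)"
    "\<And>x y b1 b2 b3. linAA E (\<lambda>z. F x y z b1 b2 b3)"
    "\<And>x y z b2 b3. linBA E (\<lambda>b. F x y z b b2 b3)" "\<And>x y z b1 b3. linBA E (\<lambda>b. F x y z b1 b b3)"
    "\<And>x y z b1 b2. linBA E (\<lambda>b. F x y z b1 b2 b)"
  shows "(\<lambda>a b. F (a 1) (a 2) (a 3) (b 1 2) (b 1 3) (b 2 3)) \<in> CochA E 3"
proof -
  have 1: "i = 1 \<or> i = 2 \<or> i = 3" if "i \<in> {1..3::nat}" for i using that by auto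
  have 2: "i = 1 \<and> j = 2 \<or> i = 1 \<and> j = 3 \<or> i = 2 \<and> j = 3" if "1 \<le> i \<and> i < j \<and> j \<le> 3" for i j :: nat
    using that by auto
  show ?thesis
    unfolding CochA_def
  proof (intro CollectI conjI allI ballI impI)
    show "F (a 1) (a 2) (a 3) (b 1 2) (b 1 3) (b 2 3) = F (a' 1) (a' 2) (a' 3) (b' 1 2) (b' 1 3) (b' 2 3)"
      if "same_entries 3 a b a' b'" for a a' :: "nat \<Rightarrow> 'a" and b b' :: "nat \<Rightarrow> nat \<Rightarrow> 'b"
      using that by (simp add: same_entries_def)
    show "linAA E (\<lambda>x. F ((a(i := x)) 1) ((a(i := x)) 2) ((a(i := x)) 3) (b 1 2) (b 1 3) (b 2 3))"
      if "i \<in> {1..3}" for a :: "nat \<Rightarrow> 'a" and b :: "nat \<Rightarrow> nat \<Rightarrow> 'b" and i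
      using 1[OF that] assms(1-3) by auto
    show "linBA E (\<lambda>x. F (a 1) (a 2) (a 3) ((b(i := (b i)(j := x))) 1 2) ((b(i := (b i)(j := x))) 1 3)
        ((b(i := (b i)(j := x))) 2 3))"
      if "1 \<le> i \<and> i < j \<and> j \<le> 3" for a :: "nat \<Rightarrow> 'a" and b :: "nat \<Rightarrow> nat \<Rightarrow> 'b" and i j
      using 2[OF that] assms(4-6) by auto
  qed
qed

lemma CochAC_2I:
  assumes "\<And>c x y b. F c x y b \<in> TAC n" "\<And>x y b. linCT E (\<lambda>c. F c x y b)"
    "\<And>c y b. linAT E (\<lambda>x. F c x y b)" "\<And>c x b. linAT E (\<lambda>y. F c x y b)" "\<And>c x y. linBT E (\<lambda>b. F c x y b)"
  shows "(\<lambda>c a b. F c (a 1) (a 2) (b 1 2)) \<in> CochAC E 2 n"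
proof -
  have 1: "i = 1 \<or> i = 2" if "i \<in> {1..2::nat}" for i using that by auto
  have 2: "i = 1 \<and> j = 2" if "1 \<le> i \<and> i < j \<and> j \<le> 2" for i j :: nat
    using that by auto
  show ?thesis
    unfolding CochAC_def
  proof (intro CollectI conjI allI ballI impI)
    show "F c (a 1) (a 2) (b 1 2) = F c (a' 1) (a' 2) (b' 1 2)"
      if "same_entries 2 a b a' b'" for c and a a' :: "nat \<Rightarrow> 'a" and b b' :: "nat \<Rightarrow> nat \<Rightarrow> 'b"
      using that by (simp add: same_entries_def)
    show "linAT E (\<lambda>x. F c ((a(i := x)) 1) ((a(i := x)) 2) (b 1 2))"
      if "i \<in> {1..2}" for c and a :: "nat \<Rightarrow> 'a" and b :: "nat \<Rightarrow> nat \<Rightarrow> 'b" and i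
      using 1[OF that] assms(3,4) by auto
    show "linBT E (\<lambda>x. F c (a 1) (a 2) ((b(i := (b i)(j := x))) 1 2))"
      if "1 \<le> i \<and> i < j \<and> j \<le> 2" for c and a :: "nat \<Rightarrow> 'a" and b :: "nat \<Rightarrow> nat \<Rightarrow> 'b" and i j
      using 2[OF that] assms(5) by auto
  qed (use assms in auto)
qed

lemma CochAC_1I:
  assumes "\<And>c x. F c x \<in> TAC n" "\<And>x. linCT E (\<lambda>c. F c x)" "\<And>c. linAT E (\<lambda>x. F c x)"
  shows "(\<lambda>c a b. F c (a 1)) \<in> CochAC E 1 n"
  unfolding CochAC_def
proof (intro CollectI conjI allI ballI impI)
  show "F c (a 1) = F c (a' 1)"
    if "same_entries 1 a b a' b'" for c and a a' :: "nat \<Rightarrow> 'a" and b b' :: "nat \<Rightarrow> nat \<Rightarrow> 'b"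
    using that by (simp add: same_entries_def)
qed (use assms linear_zero_fun[OF vsB vector_space_tscale] in auto)

lemma obstruction_in_Tot:
  assumes "deformation_mod E n d"
  shows "obstruction E n d \<in> Tot E 3"
proof -
  define I2 where "I2 = {(i, j). i < n + 1 \<and> j < n + 1 \<and> i + j = n + 1}"
  define I3 where "I3 = {(i, j, l). i < n + 1 \<and> j < n + 1 \<and> l < n + 1 \<and> i + j + l = n + 1}"
  \<comment> \<open>Triples in \<open>I3\<close> may contain one index 0, so the original structure
    maps have to be covered along with the coefficients of the deformation.\<close>
  have hom: "dmu d i \<in> hom_AAB_A E" "dDelta d i \<in> CochC E 2" "dpsi d i \<in> hom_CA_AC E" if "i < n + 1" for i
    using assms that mu0_hom Delta_coch psi_hom unfolding deformation_mod_iff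
    by (cases "i = 0"; auto)+
  note mu = muD[OF hom(1)]
  have A: "(\<lambda>a b. \<Sum>(i, j)\<in>I2. dmu d j (dmu d i (a 1) (a 2) (b 1 2)) (a 3) (b 1 3 * b 2 3)
          - dmu d i (a 1) (dmu d j (a 2) (a 3) (b 2 3)) (b 1 2 * b 1 3)) \<in> CochA E 3"
    by (rule CochA_3I)
      (auto simp: split_def I2_def intro!: linear_sum' vsA vsB linear_diff
        intro: mu linear_comp[OF mu(1) mu(1)] linear_comp[OF mu(1) mu(2)] linear_comp[OF mu(2) mu(1)]
          linear_comp[OF mu(2) mu(2)] linear_comp[OF mu(3) mu(1)] linear_comp[OF mu(3) mu(2)]
          linear_comp[OF linear_multB_left mu(3)] linear_comp[OF linear_multB_right mu(3)])
  have P2: "(\<lambda>c a b.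
                (\<Sum>(i, j, l)\<in>I3.
                   mu_psi_psi E (\<lambda>x y. dmu d i x y (b 1 2)) (dpsi d j) (dpsi d l) c (a 1) (a 2))
                - (\<Sum>(i, j)\<in>I2. dpsi d i c (dmu d j (a 1) (a 2) (b 1 2)))) \<in> CochAC E 2 1"
    by (rule CochAC_2I)
      (auto simp: split_def I2_def I3_def simp del: One_nat_def
        intro!: linear_sum' vsA vsB vsC vector_space_tscale linear_diff tens.subspace_sum[OF subspace_tensAC]
          tens.subspace_diff[OF subspace_tensAC] mu_psi_psi_in mu_psi_psi_linear_c mu_psi_psi_linear_x
          mu_psi_psi_linear_y mu_psi_psi_linear_mult hom mu homD[OF hom(3)]
        intro: linear_comp[OF mu(1) homD(2)[OF hom(3)]] linear_comp[OF mu(2) homD(2)[OF hom(3)]]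
          linear_comp[OF mu(3) homD(2)[OF hom(3)]])
  have P1: "(\<lambda>c a b.
                (\<Sum>(i, j, l)\<in>I3. psi_psi_delta E (dpsi d i) (dpsi d j) (dDelta d l) c (a 1))
                - (\<Sum>(i, j)\<in>I2. delta_at E 1 (dDelta d i) (dpsi d j c (a 1)))) \<in> CochAC E 1 2"
    by (rule CochAC_1I)
      (auto simp: split_def I2_def I3_def simp del: One_nat_def
        intro!: linear_sum' vsA vsB vsC vector_space_tscale linear_diff tens.subspace_sum[OF subspace_tensAC]
          tens.subspace_diff[OF subspace_tensAC] psi_psi_delta_in psi_psi_delta_linear_c
          psi_psi_delta_linear_a delta_at_in delta_at_linear hom homD[OF hom(3)])
  have C: "(\<lambda>c. \<Sum>(i, j)\<in>I2.
          delta_left E (dDelta d j) (dDelta d i) c - delta_right E (dDelta d j) (dDelta d i) c) \<in> CochC E 3"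
    unfolding split_def by (rule coch_sum, rule coch_delta_diff) (auto simp: I2_def hom)
  have m: "0 < m \<and> m < 3 \<longleftrightarrow> m = 2 \<or> m = 1" for m :: nat by auto
  show ?thesis
    unfolding obstruction_def Let_def Tot_def I2_def[symmetric] I3_def[symmetric] mem_Collect_eq prod.case
    unfolding m using A C P1 P2 by (auto simp: numeral_2_eq_2 numeral_3_eq_3)
qed

text \<open>All indices in the obstruction are at most \<open>n\<close>, exactly the range on which
  a lift agrees with the given deformation.\<close>

lemma obstruction_cong:
  assumes "lifts_to n d d'"
  shows "obstruction E n d' = obstruction E n d"
proof -
  have eq: "dmu d' i = dmu d i" "dDelta d' i = dDelta d i" "dpsi d' i = dpsi d i" if "i < n + 1" for i
    using assms that by (auto simp: lifts_to_def)
  show ?thesis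
    unfolding obstruction_def Let_def
    by (intro arg_cong2[where f = Pair] ext if_cong arg_cong2[where f = minus] sum.cong refl
        | (auto simp: eq)[1])+
qed


lemma lifting:
  assumes d: "deformation_mod E n d"
  shows "(\<exists>d'. lifts_to n d d' \<and> deformation_mod E (n + 1) d') \<longleftrightarrow>
    obstruction E n d \<in> coboundaries E 3"
proof
  assume "\<exists>d'. lifts_to n d d' \<and> deformation_mod E (n + 1) d'"
  then obtain d' where d': "lifts_to n d d'" "deformation_mod E (n + 1) d'" by blast
  then have zero: "dmu d' 0 = (\<lambda>x y b. zeta E b * x * y)" "dDelta d' 0 = Delta E" "dpsi d' 0 = psi E"
    and hom: "dmu d' (n + 1) \<in> hom_AAB_A E" "dpsi d' (n + 1) \<in> hom_CA_AC E"
      "dDelta d' (n + 1) \<in> CochC E 2"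
    and eqs: "deform_eqs d' (n + 1)"
    unfolding deformation_mod_iff by auto
  show "obstruction E n d \<in> coboundaries E 3"
    using deform_eqs_Suc_iff[OF zero hom] eqs coch2_in_Tot[OF hom]
    unfolding obstruction_cong[OF d'(1)] coboundaries_3 by (metis imageI)
next
  assume "obstruction E n d \<in> coboundaries E 3"
  then obtain x where x: "obstruction E n d = Dtot E 2 x" "x \<in> Tot E 2"
    unfolding coboundaries_3 by (rule imageE)
  obtain \<mu> \<psi> D where y: "\<mu> \<in> hom_AAB_A E" "\<psi> \<in> hom_CA_AC E" "D \<in> CochC E 2" "x = coch2 \<mu> \<psi> D"
    using x(2) by (rule Tot_2E)
  define d' where "d' = \<lparr>dmu = (dmu d)(n + 1 := \<mu>), dDelta = (dDelta d)(n + 1 := D),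
    dpsi = (dpsi d)(n + 1 := \<psi>)\<rparr>"
  have lift: "lifts_to n d d'" by (simp add: lifts_to_def d'_def)
  have d'n: "dmu d' (n + 1) = \<mu>" "dpsi d' (n + 1) = \<psi>" "dDelta d' (n + 1) = D"
    by (simp_all add: d'_def)
  have zero: "dmu d' 0 = (\<lambda>x y b. zeta E b * x * y)" "dDelta d' 0 = Delta E" "dpsi d' 0 = psi E"
    using d by (simp_all add: deformation_mod_iff d'_def)
  have "deform_eqs d' p" if "p \<le> n + 1" for p
  proof (cases "p = n + 1")
    case True
    have "deform_eqs d' (n + 1)"
      using deform_eqs_Suc_iff[of d' n, unfolded d'n, OF zero y(1-3)] x(1)
      unfolding obstruction_cong[OF lift] y(4) by blast
    then show ?thesis using True by simp
  next
    case False
    then have "p \<le> n" using that by simp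
    then have "deform_eqs d' p \<longleftrightarrow> deform_eqs d p"
      by (intro deform_eqs_cong) (simp_all add: d'_def)
    then show ?thesis using d \<open>p \<le> n\<close> unfolding deformation_mod_iff by blast
  qed
  moreover have "dmu d' i \<in> hom_AAB_A E \<and> dDelta d' i \<in> CochC E 2 \<and> dpsi d' i \<in> hom_CA_AC E"
    if "i \<in> {1..n + 1}" for i
    using d that y(1-3) unfolding deformation_mod_iff d'_def by (cases "i = n + 1") auto
  moreover have "dmu d' i = 0 \<and> dDelta d' i = 0 \<and> dpsi d' i = 0" if "i > n + 1" for i
    using d that unfolding deformation_mod_iff d'_def by auto
  ultimately have "deformation_mod E (n + 1) d'"
    unfolding deformation_mod_iff using zero by blast
  with lift show "\<exists>d'. lifts_to n d d' \<and> deformation_mod E (n + 1) d'" by blast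
qed

section \<open>Infinitesimal deformations\<close>

text \<open>The entwining axiom covers the plain product. An element \<open>zeta E b\<close> passes
  \<open>c\<close> without changing either, so it comes out as a left action on the result for
  \<open>x * y\<close>.\<close>

lemma psi_mu0: "psi E c (zeta E b * x * y) = mu_psi_psi E (\<lambda>x y. zeta E b * x * y) (psi E) (psi E) c x y"
proof -
  have "mu_psi_psi E (*) (psi E) (psi E) c (zeta E b) z = lact E (zeta E b) (psi E c z)" for z
  proof -
    have "sweedler (tAC E (zeta E b, [c])) (\<lambda>(x', cs). sweedler (psi E (cs ! 0) z) (\<lambda>(y', ds). tAC E (x' * y', ds)))
        = sweedler (psi E c z) (\<lambda>(y', ds). tAC E (zeta E b * y', ds))"
      by (subst sweedler_pureAC)
        (use mu_psi_psi_mlin[OF psi_hom linear_mult_right linear_mult_left] in simp_all)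
    then show ?thesis by (simp add: mu_psi_psi_def psi_zeta lact_def)
  qed
  then have "psi E c (zeta E b * (x * y)) = lact E (zeta E b) (mu_psi_psi E (*) (psi E) (psi E) c x y)"
    by (simp only: psi_mult)
  also have "\<dots> = mu_psi_psi E (\<lambda>x y. zeta E b * (x * y)) (psi E) (psi E) c x y"
    by (simp add: mu_psi_psi_def lact_sweedler lact_tAC split_def)
  finally show ?thesis by (simp only: mult.assoc)
qed

lemma deform_eqs_0:
  assumes "dmu d 0 = (\<lambda>x y b. zeta E b * x * y)" "dDelta d 0 = Delta E" "dpsi d 0 = psi E"
  shows "deform_eqs d 0"
proof -
  have sets: "{(i, j). i + j = (0::nat)} = {(0, 0)}" "{(i, j, l). i + j + l = (0::nat)} = {(0, 0, 0)}"
    by auto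
  \<comment> \<open>Associativity of the constant coefficient with parameters: centrality brings
    \<open>zeta E b3\<close> to the left of \<open>x\<close>, and commutativity of B regroups the
    three parameters.\<close>
  have "zeta E (b1 * b2) * x * (zeta E b3 * y * z) = zeta E (b2 * b3) * (zeta E b1 * x * y) * z"
    for b1 b2 b3 x y z
  proof -
    have "zeta E (b1 * b2) * x * (zeta E b3 * y * z) = zeta E (b1 * b2) * (zeta E b3 * x) * y * z"
      unfolding zeta_central[of b3 x] by (simp only: mult.assoc)
    also have "\<dots> = zeta E (b1 * b2 * b3) * x * y * z"
      by (simp only: zeta_mult mult.assoc)
    also have "b1 * b2 * b3 = b2 * b3 * b1"
      by (simp only: ac_simps)
    also have "zeta E (b2 * b3 * b1) * x * y * z = zeta E (b2 * b3) * (zeta E b1 * x * y) * z"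
      by (simp only: zeta_mult mult.assoc)
    finally show ?thesis .
  qed
  moreover have "delta_left E (Delta E) (Delta E) c = delta_right E (Delta E) (Delta E) c" for c
    using coalg unfolding coalgebra_def by blast
  ultimately show ?thesis
    unfolding deform_eqs_def sets using psi_mu0 delta_psi by (simp add: assms)
qed

lemma inf_cochain_coch2: "inf_cochain d = coch2 (dmu d 1) (dpsi d 1) (dDelta d 1)"
  by (simp add: inf_cochain_def coch2_def del: One_nat_def)

lemma obstruction_0: "obstruction E 0 d = 0"
proof -
  have sets: "{(i, j). i < 0 + 1 \<and> j < 0 + 1 \<and> i + j = 0 + (1::nat)} = {}"
    "{(i, j, l). i < 0 + 1 \<and> j < 0 + 1 \<and> l < 0 + 1 \<and> i + j + l = 0 + (1::nat)} = {}"
    by auto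
  show ?thesis
    unfolding obstruction_def Let_def sets zero_prod_def
    by (intro arg_cong2[where f = Pair] ext) (simp_all add: zero_fun_apply)
qed

lemma inf_deformationD:
  assumes "d \<in> inf_deformations E"
  shows "dmu d 0 = (\<lambda>x y b. zeta E b * x * y)" "dDelta d 0 = Delta E" "dpsi d 0 = psi E"
    "dmu d 1 \<in> hom_AAB_A E" "dpsi d 1 \<in> hom_CA_AC E" "dDelta d 1 \<in> CochC E 2"
  using assms unfolding inf_deformations_def deformation_mod_iff by auto

lemma inf_cochain_in_cocycles:
  assumes "d \<in> inf_deformations E"
  shows "inf_cochain d \<in> cocycles E 2"
proof -
  note h = inf_deformationD[OF assms]
  have "deform_eqs d (0 + 1)"
    using assms unfolding inf_deformations_def deformation_mod_iff by auto
  then have "obstruction E 0 d = Dtot E 2 (inf_cochain d)"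
    using deform_eqs_Suc_iff[of d 0] h unfolding inf_cochain_coch2 by simp
  then show ?thesis
    using coch2_in_Tot[OF h(4-6)] unfolding cocycles_def inf_cochain_coch2 obstruction_0 by simp
qed

lemma cocycle_inf_cochain:
  assumes "x \<in> cocycles E 2"
  obtains d where "d \<in> inf_deformations E" "x = inf_cochain d"
proof -
  have x: "x \<in> Tot E 2" "Dtot E 2 x = 0" using assms by (auto simp: cocycles_def)
  obtain \<mu> \<psi> D where y: "\<mu> \<in> hom_AAB_A E" "\<psi> \<in> hom_CA_AC E" "D \<in> CochC E 2" "x = coch2 \<mu> \<psi> D"
    using x(1) by (rule Tot_2E)
  \<comment> \<open>The cocycle supplies the coefficient of t. The values at higher indices are 0,
    as \<open>deformation_mod\<close> prescribes.\<close>
  define d :: "('k, 'a, 'b, 'c) deform" where "d =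
    \<lparr>dmu = \<lambda>i. if i = 0 then \<lambda>x y b. zeta E b * x * y else if i = 1 then \<mu> else 0,
     dDelta = \<lambda>i. if i = 0 then Delta E else if i = 1 then D else 0,
     dpsi = \<lambda>i. if i = 0 then psi E else if i = 1 then \<psi> else 0\<rparr>"
  have zero: "dmu d 0 = (\<lambda>x y b. zeta E b * x * y)" "dDelta d 0 = Delta E" "dpsi d 0 = psi E"
    and one: "dmu d (0 + 1) = \<mu>" "dDelta d (0 + 1) = D" "dpsi d (0 + 1) = \<psi>"
    and other: "\<forall>i>1. dmu d i = 0 \<and> dDelta d i = 0 \<and> dpsi d i = 0"
    by (simp_all add: d_def)
  have "obstruction E 0 d = Dtot E 2 (coch2 \<mu> \<psi> D)"
    using x(2) unfolding y(4) obstruction_0 by simp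
  then have "deform_eqs d (0 + 1)"
    using deform_eqs_Suc_iff[of d 0, unfolded one, OF zero y(1-3)] by blast
  then have eqs: "\<forall>p\<le>1. deform_eqs d p"
    using deform_eqs_0[OF zero] by (auto simp: le_Suc_eq)
  have hom: "\<forall>i\<in>{1..1}. dmu d i \<in> hom_AAB_A E \<and> dDelta d i \<in> CochC E 2 \<and> dpsi d i \<in> hom_CA_AC E"
    using one y(1-3) by simp
  have "d \<in> inf_deformations E"
    unfolding inf_deformations_def mem_Collect_eq deformation_mod_iff
    using zero hom other eqs by blast
  moreover have "x = inf_cochain d"
    unfolding inf_cochain_coch2 y(4) using one by simp
  ultimately show thesis by (rule that)
qed

lemma coch2_inject: "coch2 \<mu> \<psi> D = coch2 \<mu>' \<psi>' D' \<longleftrightarrow> \<mu> = \<mu>' \<and> \<psi> = \<psi>' \<and> D = D'"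
proof
  assume eq: "coch2 \<mu> \<psi> D = coch2 \<mu>' \<psi>' D'"
  have "\<mu> x y b = \<mu>' x y b" for x y b
    using fun_cong[OF fun_cong[OF arg_cong[OF eq, of fst], of "\<lambda>i. if i = 1 then x else y"], of "\<lambda>_ _. b"]
    by (simp add: coch2_def)
  moreover have "\<psi> c x = \<psi>' c x" for c x
    using fun_cong[OF fun_cong[OF fun_cong[OF arg_cong[OF eq, of "\<lambda>z. fst (snd z) 1"], of c], of "\<lambda>_. x"], of "\<lambda>_ _. 0"]
    by (simp add: coch2_def)
  moreover have "D = D'" using eq by (simp add: coch2_def)
  ultimately show "\<mu> = \<mu>' \<and> \<psi> = \<psi>' \<and> D = D'" by blast
qed simp

text \<open>Where the coefficients of \<gamma> are identities, the equivalence equations take a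
  tensor apart and reassemble it; this lemma and the next remove that detour.\<close>

lemma TC2_ident:
  assumes "x \<in> TC 2"
  shows "sweedler x (\<lambda>cs. tC E [cs ! 0, cs ! 1]) = x"
proof -
  have "sweedler x (\<lambda>cs. tC E [cs ! 0, cs ! 1]) = sweedler x (tC E)"
    by (rule sweedlerC_cong[OF assms]) (auto simp: numeral_2_eq_2 length_Suc_conv)
  then show ?thesis by (simp add: sweedler_ident_C[OF assms vsC])
qed

lemma TAC1_ident:
  assumes "x \<in> TAC 1"
  shows "sweedler x (\<lambda>(a, cs). tAC E (a, [cs ! 0])) = x"
proof -
  have "sweedler x (\<lambda>(a, cs). tAC E (a, [cs ! 0])) = sweedler x (tAC E)"
    by (rule sweedlerAC_cong[OF assms]) (auto simp: length_Suc_conv)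
  then show ?thesis by (simp add: sweedler_ident_AC[OF assms vsA vsC])
qed

section \<open>Equivalence modulo t^2 as equality of cohomology classes\<close>

definition equivalence_eqs where
  "equivalence_eqs d d' \<alpha> \<gamma> p \<longleftrightarrow>
         (\<forall>b x y.
            (\<Sum>(i, j)\<in>{(i, j). i + j = p}. \<alpha> i (dmu d j x y b)) =
            (\<Sum>(i, j, l)\<in>{(i, j, l). i + j + l = p}. dmu d' i (\<alpha> j x) (\<alpha> l y) b)) \<and>
         (\<forall>c.
            (\<Sum>(i, j, l)\<in>{(i, j, l). i + j + l = p}.
               sweedler (dDelta d l c) (\<lambda>cs. tC E [\<gamma> i (cs ! 0), \<gamma> j (cs ! 1)])) =
            (\<Sum>(i, j)\<in>{(i, j). i + j = p}. dDelta d' i (\<gamma> j c))) \<and>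
         (\<forall>c a.
            (\<Sum>(i, j, l)\<in>{(i, j, l). i + j + l = p}. dpsi d' i (\<gamma> j c) (\<alpha> l a)) =
            (\<Sum>(i, j, l)\<in>{(i, j, l). i + j + l = p}.
               sweedler (dpsi d l c a) (\<lambda>(x, cs). tAC E (\<alpha> i x, [\<gamma> j (cs ! 0)]))))"

lemma equivalence_eqs_0:
  assumes "d \<in> inf_deformations E" "d' \<in> inf_deformations E" "\<alpha> 0 = id" "\<gamma> 0 = id"
  shows "equivalence_eqs d d' \<alpha> \<gamma> 0"
proof -
  have sets: "{(i, j). i + j = (0::nat)} = {(0, 0)}" "{(i, j, l). i + j + l = (0::nat)} = {(0, 0, 0)}"
    by auto
  show ?thesis
    using TC2_ident[OF cochD(2)[OF Delta_coch]] TAC1_ident[OF homD(3)[OF psi_hom]]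
    unfolding equivalence_eqs_def sets
    by (simp add: inf_deformationD[OF assms(1)] inf_deformationD[OF assms(2)] assms)
qed

text \<open>In the coefficient of t exactly one index is 1 and the others are 0, so each summand has
  a single factor that is not an original structure map or an identity. Rearranging the three
  equations gives the three components on the right.\<close>

lemma equivalence_eqs_1:
  assumes d: "d \<in> inf_deformations E" "d' \<in> inf_deformations E" and id: "\<alpha> 0 = id" "\<gamma> 0 = id"
    and lin: "linAA E (\<alpha> 1)" "linCC E (\<gamma> 1)"
  shows "equivalence_eqs d d' \<alpha> \<gamma> 1 \<longleftrightarrow>
    inf_cochain d' - inf_cochain d = Dtot E 1 (coch1 (\<alpha> 1) (\<gamma> 1))"
proof -
  have sets: "{(i, j). i + j = (1::nat)} = {(0, 1), (1, 0)}"
    "{(i, j, l). i + j + l = (1::nat)} = {(0, 0, 1), (0, 1, 0), (1, 0, 0)}"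
    by auto
  note dd = inf_deformationD[OF d(1)] inf_deformationD[OF d(2)]
  note ident = TC2_ident[OF cochD(2)[OF dd(6)]] TAC1_ident[OF homD(3)[OF dd(5)]]
  show ?thesis
    unfolding inf_cochain_coch2 Dtot_coch1[OF lin] coch2_diff[symmetric] coch2_inject
      equivalence_eqs_def sets
    using ident
    by (simp add: dd id fun_eq_iff[of "_ :: 'a \<Rightarrow> 'a \<Rightarrow> 'b \<Rightarrow> 'a"] fun_eq_iff[of "_ :: 'a \<Rightarrow> 'b \<Rightarrow> 'a"] fun_eq_iff[of "_ :: 'b \<Rightarrow> 'a"]
       fun_eq_iff[of "_ :: 'c \<Rightarrow> 'a \<Rightarrow> ('a \<times> 'c list, 'k) tens"] fun_eq_iff[of "_ :: 'a \<Rightarrow> ('a \<times> 'c list, 'k) tens"]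
       fun_eq_iff[of "_ :: 'c \<Rightarrow> ('c list, 'k) tens"] minus_apply)
      (auto simp: algebra_simps)
qed

lemma equivalent_iff:
  assumes d: "d \<in> inf_deformations E" "d' \<in> inf_deformations E"
  shows "equivalent_mod E 1 d d' \<longleftrightarrow> inf_cochain d' - inf_cochain d \<in> coboundaries E 2"
proof -
  have all: "(\<forall>p\<le>1. Q p) \<longleftrightarrow> Q 0 \<and> Q 1" for Q :: "nat \<Rightarrow> bool"
    by (auto simp: le_Suc_eq)
  have "equivalent_mod E 1 d d' \<longleftrightarrow> (\<exists>\<alpha> \<gamma>. \<alpha> 0 = id \<and> \<gamma> 0 = id \<and>
      (\<forall>i\<ge>1. linAA E (\<alpha> i) \<and> linCC E (\<gamma> i)) \<and> (\<forall>p\<le>1. equivalence_eqs d d' \<alpha> \<gamma> p))"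
    unfolding equivalent_mod_def equivalence_eqs_def ..
  also have "\<dots> \<longleftrightarrow> (\<exists>\<alpha> \<gamma>. linAA E \<alpha> \<and> linCC E \<gamma> \<and>
      inf_cochain d' - inf_cochain d = Dtot E 1 (coch1 \<alpha> \<gamma>))" (is "?l \<longleftrightarrow> ?r")
  proof
    assume ?l
    then obtain \<alpha> :: "nat \<Rightarrow> 'a \<Rightarrow> 'a" and \<gamma> :: "nat \<Rightarrow> 'c \<Rightarrow> 'c"
      where *: "\<alpha> 0 = id" "\<gamma> 0 = id" "linAA E (\<alpha> 1)" "linCC E (\<gamma> 1)" "equivalence_eqs d d' \<alpha> \<gamma> 1"
      by auto
    then show ?r using equivalence_eqs_1[OF d *(1-4)] by blast
  next
    assume ?r
    then obtain \<alpha> \<gamma> where *: "linAA E \<alpha>" "linCC E \<gamma>"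
      "inf_cochain d' - inf_cochain d = Dtot E 1 (coch1 \<alpha> \<gamma>)" by blast
    \<comment> \<open>Modulo t^2 only the index 1 counts; repeating the same linear map at all
      higher indices meets the linearity condition on the whole family.\<close>
    define \<alpha>' where "\<alpha>' = (\<lambda>i :: nat. if i = 0 then id else \<alpha>)"
    define \<gamma>' where "\<gamma>' = (\<lambda>i :: nat. if i = 0 then id else \<gamma>)"
    have 0: "\<alpha>' 0 = id" "\<gamma>' 0 = id" and 1: "\<alpha>' 1 = \<alpha>" "\<gamma>' 1 = \<gamma>" by (simp_all add: \<alpha>'_def \<gamma>'_def)
    have "equivalence_eqs d d' \<alpha>' \<gamma>' 1"
      using equivalence_eqs_1[of d d' \<alpha>' \<gamma>', unfolded 1, OF d 0 *(1,2)] *(3) by blast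
    moreover have "\<forall>i\<ge>1. linAA E (\<alpha>' i) \<and> linCC E (\<gamma>' i)"
      using * by (simp add: \<alpha>'_def \<gamma>'_def)
    ultimately show ?l
      unfolding all using 0 equivalence_eqs_0[of d d' \<alpha>' \<gamma>', OF d 0] by blast
  qed
  also have "\<dots> \<longleftrightarrow> inf_cochain d' - inf_cochain d \<in> coboundaries E 2"
  proof
    assume ?r
    then show "inf_cochain d' - inf_cochain d \<in> coboundaries E 2"
      unfolding coboundaries_2 using coch1_in_Tot by blast
  next
    assume "inf_cochain d' - inf_cochain d \<in> coboundaries E 2"
    then obtain x where x: "inf_cochain d' - inf_cochain d = Dtot E 1 x" "x \<in> Tot E 1"
      unfolding coboundaries_2 by (rule imageE)
    from x(2) obtain \<alpha> \<gamma> where "linAA E \<alpha>" "linCC E \<gamma>" "x = coch1 \<alpha> \<gamma>" by (rule Tot_1E)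
    with x(1) show ?r by blast
  qed
  finally show ?thesis .
qed

text \<open>Exhibits the relation as the kernel of the map sending a deformation to its class. It is
  thereby an equivalence relation, and the induced map on the quotient is well defined and
  injective.\<close>

lemma inf_equivalence_iff:
  "(d, d') \<in> inf_equivalence E \<longleftrightarrow> d \<in> inf_deformations E \<and> d' \<in> inf_deformations E \<and>
    coh_class E 2 (inf_cochain d) = coh_class E 2 (inf_cochain d')"
  unfolding inf_equivalence_def using equivalent_iff coh_class_eq_iff[of 2] by auto

lemma classification:
  "\<exists>\<Phi>. bij_betw \<Phi> (inf_deformations E // inf_equivalence E) (cohomology E 2) \<and>
    (\<forall>d\<in>inf_deformations E. \<Phi> (inf_equivalence E `` {d}) = coh_class E 2 (inf_cochain d))"
proof -
  let ?f = "\<lambda>d. coh_class E 2 (inf_cochain d)"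
  \<comment> \<open>A representative is picked by choice; the kernel description makes the class
    independent of that choice.\<close>
  define \<Phi> where "\<Phi> X = ?f (SOME d. d \<in> X)" for X
  have \<Phi>: "\<Phi> (inf_equivalence E `` {d}) = ?f d" if "d \<in> inf_deformations E" for d
  proof -
    have "d \<in> inf_equivalence E `` {d}" using that by (simp add: inf_equivalence_iff)
    then have "(SOME e. e \<in> inf_equivalence E `` {d}) \<in> inf_equivalence E `` {d}" by (rule someI)
    then have "(d, SOME e. e \<in> inf_equivalence E `` {d}) \<in> inf_equivalence E"
      by (simp only: Image_singleton_iff)
    then show ?thesis unfolding \<Phi>_def inf_equivalence_iff by (elim conjE) (rule sym)
  qed
  have "bij_betw \<Phi> (inf_deformations E // inf_equivalence E) (cohomology E 2)"
    unfolding bij_betw_def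
  proof
    show "inj_on \<Phi> (inf_deformations E // inf_equivalence E)"
    proof (rule inj_onI)
      fix X Y
      assume "X \<in> inf_deformations E // inf_equivalence E" "Y \<in> inf_deformations E // inf_equivalence E"
      then obtain d e where "d \<in> inf_deformations E" "X = inf_equivalence E `` {d}"
        "e \<in> inf_deformations E" "Y = inf_equivalence E `` {e}" by (auto elim!: quotientE)
      moreover assume "\<Phi> X = \<Phi> Y"
      ultimately show "X = Y" using \<Phi> by (auto simp: inf_equivalence_iff)
    qed
    have "\<Phi> ` (inf_deformations E // inf_equivalence E) = ?f ` inf_deformations E"
      using \<Phi> by (auto simp: quotient_def image_iff)
    also have "\<dots> = cohomology E 2"
    proof -
      have "inf_cochain ` inf_deformations E = cocycles E 2"
        using inf_cochain_in_cocycles by (blast elim: cocycle_inf_cochain)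
      then show ?thesis unfolding cohomology_def by (metis image_image)
    qed
    finally show "\<Phi> ` (inf_deformations E // inf_equivalence E) = cohomology E 2" .
  qed
  with \<Phi> show ?thesis by blast
qed

end

theorem theorem1p3:
  fixes E :: "('k::field, 'a::{ring, monoid_mult}, 'b::{comm_ring, comm_monoid_mult},
    'c::ab_group_add) entw_data"
  assumes "entwining_over E"
  shows "(\<exists>\<Phi>. bij_betw \<Phi> (inf_deformations E // inf_equivalence E) (cohomology E 2) \<and>
            (\<forall>d\<in>inf_deformations E. \<Phi> (inf_equivalence E `` {d}) = coh_class E 2 (inf_cochain d))) \<and>
         (\<forall>n d. deformation_mod E n d \<longrightarrow>
            obstruction E n d \<in> Tot E 3 \<and>
            ((\<exists>d'. lifts_to n d d' \<and> deformation_mod E (n + 1) d') \<longleftrightarrow>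
               obstruction E n d \<in> coboundaries E 3) \<and>
            (obstruction E n d \<in> coboundaries E 3 \<longleftrightarrow>
               coh_class E 3 (obstruction E n d) = coh_class E 3 0))"
proof -
  interpret entw E by unfold_locales (rule assms)
  have "obstruction E n d \<in> coboundaries E 3 \<longleftrightarrow>
      coh_class E 3 (obstruction E n d) = coh_class E 3 0" for n d
    using coh_class_eq_iff[of 3 0 "obstruction E n d"] by auto
  then show ?thesis using classification obstruction_in_Tot lifting by blast
qed

end
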